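(* Let $d\le n$, $\omega\in\mathcal D_d(\nu,\tau)$, let $\mathcal M=\mathbb T^n\times B$ be the phase space described in the context and let $f_\mu:\mathcal M\to\mathcal M$, $\mu\in\mathbb R^d$, be a family of real analytic conformally symplectic maps, $f_\mu^*\Omega=\lambda\Omega$, with $0<\lambda<1$. Let $0<\delta<\rho$ and let $(K^{(1)},\mu^{(1)})$, $(K^{(2)},\mu^{(2)})$, with $K^{(i)}\in\mathcal A_{\rho+2\delta}$, be solutions of $$f_{\mu^{(i)}}\circ K^{(i)}=K^{(i)}\circ T_\omega,\qquad i=1,2,$$ where $K^{(1)}$ is a whiskered torus with invariant splitting $E^s_\theta\oplus E^c_\theta\oplus E^u_\theta$, as in the context. Let $W^c=M^{-1}\Pi^c_\theta(K^{(2)}-K^{(1)})$ (in the coordinates given by the matrix $M$ of $K^{(1)}$), $W^s=\Pi^s_\theta(K^{(2)}-K^{(1)})$, $W^u=\Pi^u_\theta(K^{(2)}-K^{(1)})$ be the center, stable and unstable components of $K^{(2)}-K^{(1)}$, and let $[\,\cdot\,]_1$ denote the first $d$ components of a vector in $\mathbb R^{2d}$. Assume the normalization $$\int_{\mathbb T^d}\big[M^{-1}(\theta)\,\Pi^c_\theta\,(K^{(2)}(\theta)-K^{(1)}(\theta))\big]_1\,d\theta=0$$ and assume that the non-degeneracy condition $\det\mathcal S\ne0$ holds at $(K^{(1)},\mu^{(1)})$, with $\mathcal S$ as in the context. Then there is a constant $C>0$, not depending on $(K^{(2)},\mu^{(2)})$, such that if $$C\,\nu\,\delta^{-\tau}\max\big(\|W^c\|_{\rho+2\delta},\,|\mu^{(2)}-\mu^{(1)}|\big)<1,\qquad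 C\big(\|W^s\|_{\rho+\delta}+\|W^u\|_{\rho+\delta}\big)<1,$$ then $$K^{(1)}=K^{(2)},\qquad\mu^{(1)}=\mu^{(2)}.$$
   Context: Phase space. $\mathcal M=\mathbb T^n\times B$ with $B\subseteq\mathbb R^n$ open, simply connected, with smooth boundary, standard scalar product $\langle\cdot,\cdot\rangle$, tangent spaces identified with $\mathbb R^{2n}$, symplectic form $\Omega$. Differences $K^{(2)}-K^{(1)}$ are taken in (a lift to) $\mathbb R^{2n}$. $T_\omega(\theta)=\theta+\omega$. The maps $f_\mu$, for $\mu$ near $\mu^{(1)}$, extend analytically to a complex domain containing a neighborhood of the range $K^{(1)}(\mathbb T^d_{\rho+2\delta})$. $\omega\in\mathcal D_d(\nu,\tau)$ means $\sup_{k\in\mathbb Z^d\setminus\{0\}}|e^{2\pi ik\cdot\omega}-1|^{-1}|k|^{-\tau}=\nu<\infty$. $\mathbb T^d_\rho=\{z\in\mathbb C^d/\mathbb Z^d:|\operatorname{Im}z_j|\le\rho\}$; $\mathcal A_\rho$ is the space of functions analytic in the interior of $\mathbb T^d_\rho$ and continuous up to the boundary, with sup norm $\|\cdot\|_\rho$. Whiskered torus. For the cocycle $\gamma=Df_{\mu^{(1)}}\circ K^{(1)}$, let $\Gamma^j=\gamma\circ T_{(j-1)\omega}\cdots\gamma$ for $j\ge0$, extended to $j<0$ by $\Gamma^{j+m}=\Gamma^j\circ T_{m\omega}\Gamma^m$. There is an analytic splitting $E^s_\theta\oplus E^c_\theta\oplus E^u_\theta$ of the tangent space at $K^{(1)}(\theta)$,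 invariant under $\gamma$, with projections $\Pi^{s/c/u}_\theta$, $\dim E^c_\theta=2d$, a constant $C_0>0$ and rates $\lambda_-<\lambda_c^-\le\lambda_c^+<\lambda_+$, $\lambda_-<1<\lambda_+$, $\lambda_-<\lambda\lambda_+^{-1}<\lambda_c^-$, $\lambda_c^-\le\lambda\le\lambda_c^+$, such that $v\in E^s_\theta\iff|\Gamma^j(\theta)v|\le C_0\lambda_-^j|v|$, $j\ge0$; $v\in E^u_\theta\iff|\Gamma^j(\theta)v|\le C_0\lambda_+^j|v|$, $j\le0$; $v\in E^c_\theta\iff|\Gamma^j(\theta)v|\le C_0(\lambda_c^+)^j|v|$, $j\ge0$, and $|\Gamma^j(\theta)v|\le C_0(\lambda_c^-)^j|v|$, $j\le0$. The matrices $M$ and $\mathcal S$ (with $K=K^{(1)}$, $\mu=\mu^{(1)}$). $J^c$ acts on $E^c_\theta$ with $\langle u,J^cv\rangle=\Omega_{K(\theta)}(u,v)$ for $u,v\in E^c_\theta$ (non-degenerate in this setting); $(J^c)^{-1}$ is its inverse on $E^c_\theta$. $N=(DK^TDK)^{-1}$, $P=DK\,N$, $\chi=DK^T((J^c)^{-1}\circ K)DK$, $M=[DK\,|\,((J^c)^{-1}\circ K)DK\,N]$, which maps $\mathbb R^{2d}$ isomorphically onto $E^c_\theta$, with inverse $M^{-1}$; $$S(\theta)=P(\theta+\omega)^TDf_\mu\circ K(\theta)\,(J^c)^{-1}\circ K(\theta)P(\theta)-\lambda N(\theta+\omega)^T\chi(\theta+\omega)N(\theta+\omega);$$ $\widetilde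 A^c=M^{-1}\circ T_\omega\,\Pi^c_{\theta+\omega}D_\mu f_\mu\circ K$ with first $d$ rows $\widetilde A_1^c$ and last $d$ rows $\widetilde A_2^c$. An overline denotes the average over $\mathbb T^d$, $(g)^0=g-\overline g$, and $(W_b^c)^0$ is the zero average solution of $\lambda(W_b^c)^0-(W_b^c)^0\circ T_\omega=-(\widetilde A_2^c)^0$. Then $$\mathcal S=\begin{pmatrix}\overline S&\overline{S(W_b^c)^0}+\overline{\widetilde A_1^c}\\(\lambda-1)\mathrm{Id}_d&\overline{\widetilde A_2^c}\end{pmatrix}.$$ *)

theory Defs
  imports "HOL-Analysis.Analysis"
begin

definition cvec :: "real^'m \<Rightarrow> complex^'m" where
  "cvec x = (\<chi> i. complex_of_real (x $ i))"

definition ivec :: "int^'m \<Rightarrow> real^'m" where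
  "ivec k = (\<chi> i. real_of_int (k $ i))"

definition holo_on :: "(complex^'m \<Rightarrow> complex) \<Rightarrow> (complex^'m) set \<Rightarrow> bool" where
  "holo_on G U \<longleftrightarrow>
     (\<forall>z\<in>U. \<exists>c::complex^'m. (G has_derivative (\<lambda>h. \<Sum>i\<in>UNIV. c $ i * h $ i)) (at z))"

definition real_analytic_on :: "(real^'m \<Rightarrow> real) \<Rightarrow> (real^'m) set \<Rightarrow> bool" where
  "real_analytic_on g X \<longleftrightarrow>
     (\<forall>x\<in>X. \<exists>r>0. \<exists>G. holo_on G (ball (cvec x) r) \<and>
        (\<forall>y\<in>X \<inter> ball x r. G (cvec y) = complex_of_real (g y)))"

definition closed_strip :: "real \<Rightarrow> (complex^'d) set" where
  "closed_strip r = {z. \<forall>i. \<bar>Im (z $ i)\<bar> \<le> r}"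

definition open_strip :: "real \<Rightarrow> (complex^'d) set" where
  "open_strip r = {z. \<forall>i. \<bar>Im (z $ i)\<bar> < r}"

text \<open>Functions on the complexified torus are handled on the universal cover. Real objects are
  functions of a real \<open>\<theta>\<close>; their values on a complex strip are those of the (unique) holomorphic
  extension.\<close>

definition strip_ext ::
    "real \<Rightarrow> (real^'d \<Rightarrow> real^'m) \<Rightarrow> (complex^'d \<Rightarrow> complex^'m) \<Rightarrow> bool" where
  "strip_ext r g G \<longleftrightarrow>
     (\<forall>i. holo_on (\<lambda>z. G z $ i) (open_strip r)) \<and> (\<forall>\<theta>. G (cvec \<theta>) = cvec (g \<theta>))"

text \<open>The defining condition of the space $\mathcal{A}_r$, without periodicity, so that it also
  applies to lifts of torus-valued maps.\<close>

definition in_A :: "real \<Rightarrow> (real^'d \<Rightarrow> real^'m) \<Rightarrow> bool" where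
  "in_A r g \<longleftrightarrow> (\<exists>G. strip_ext r g G \<and> continuous_on (closed_strip r) G)"

text \<open>Infinite if there is no holomorphic extension. The sup is over the open strip, where it makes
  sense for expressions in $DK$; for a function continuous up to the boundary it equals the sup over
  the closed strip. The infimum only selects the extension: all of them agree on the strip.\<close>

definition strip_norm :: "real \<Rightarrow> (real^'d \<Rightarrow> real^'m) \<Rightarrow> ennreal" where
  "strip_norm r g = (INF G\<in>{G. strip_ext r g G}. SUP z\<in>open_strip r. ennreal (norm (G z)))"

definition torus_avg :: "(real^'d \<Rightarrow> 'b::euclidean_space) \<Rightarrow> 'b" where
  "torus_avg g = integral (cbox 0 1) g"

text \<open>Here $|k| = |k_1| + \dots + |k_d|$. The first conjunct is needed because \<open>inverse 0 = 0\<close>.\<close>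

definition diophantine :: "real \<Rightarrow> real \<Rightarrow> real^'d \<Rightarrow> bool" where
  "diophantine \<nu> \<tau> \<omega> \<longleftrightarrow>
     (let den = (\<lambda>k::int^'d. cmod (cis (2 * pi * (ivec k \<bullet> \<omega>)) - 1));
          q = (\<lambda>k. inverse (den k) * (\<Sum>i\<in>UNIV. \<bar>real_of_int (k $ i)\<bar>) powr (- \<tau>))
      in (\<forall>k. k \<noteq> 0 \<longrightarrow> den k \<noteq> 0) \<and> bdd_above (q ` (UNIV - {0})) \<and>
         (SUP k\<in>UNIV - {0}. q k) = \<nu>)"

text \<open>Iterated partial derivatives; meaningful for open \<open>U\<close>.\<close>

primrec Ck_on :: "nat \<Rightarrow> ('a::euclidean_space \<Rightarrow> real) \<Rightarrow> 'a set \<Rightarrow> bool" where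
  "Ck_on 0 g U = continuous_on U g"
| "Ck_on (Suc k) g U = (g differentiable_on U \<and>
     (\<forall>b\<in>Basis. Ck_on k (\<lambda>x. frechet_derivative g (at x) b) U))"

definition smooth_boundary :: "'a::euclidean_space set \<Rightarrow> bool" where
  "smooth_boundary B \<longleftrightarrow>
     (\<forall>p\<in>frontier B. \<exists>U g. open U \<and> p \<in> U \<and> (\<forall>k. Ck_on k g U) \<and>
        (\<forall>x\<in>U. \<exists>v. frechet_derivative g (at x) v \<noteq> 0) \<and> B \<inter> U = {x\<in>U. g x < 0})"

text \<open>Points of $\mathbb{T}^n \times B$ are represented by lifts in $\mathbb{R}^{2n}$, with angles
  indexed by \<open>Inl\<close> and actions by \<open>Inr\<close>.\<close>

definition phase :: "(real^'n) set \<Rightarrow> (real^('n::finite+'n)) set" where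
  "phase B = {x. (\<chi> i. x $ Inr i) \<in> B}"

definition zshift :: "int^'n \<Rightarrow> real^('n::finite+'n)" where
  "zshift k = (\<chi> i. case i of Inl a \<Rightarrow> real_of_int (k $ a) | Inr b \<Rightarrow> 0)"

definition phase_map :: "(real^'n) set \<Rightarrow> (real^('n::finite+'n) \<Rightarrow> real^('n::finite+'n)) \<Rightarrow> bool" where
  "phase_map B F \<longleftrightarrow>
     (\<forall>x\<in>phase B. F x \<in> phase B) \<and>
     (\<forall>x\<in>phase B. \<forall>k. \<exists>l. F (x + zshift k) = F x + zshift l) \<and>
     (\<forall>i. real_analytic_on (\<lambda>x. F x $ i) (phase B))"

definition torus_map :: "(real^'n) set \<Rightarrow> (real^'d \<Rightarrow> real^('n::finite+'n)) \<Rightarrow> bool" where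
  "torus_map B K \<longleftrightarrow>
     (\<forall>\<theta>. K \<theta> \<in> phase B) \<and> (\<forall>\<theta> k. \<exists>l. K (\<theta> + ivec k) = K \<theta> + zshift l)"

text \<open>The form is taken real analytic, like the maps. The fourth condition is closedness, tested on
  constant vector fields.\<close>

definition symplectic_form ::
    "(real^'n) set \<Rightarrow> (real^('n::finite+'n) \<Rightarrow> real^('n::finite+'n) \<Rightarrow> real^('n::finite+'n) \<Rightarrow> real) \<Rightarrow> bool" where
  "symplectic_form B \<Omega> \<longleftrightarrow>
     (\<forall>u v. real_analytic_on (\<lambda>x. \<Omega> x u v) (phase B)) \<and>
     (\<forall>x\<in>phase B. bilinear (\<Omega> x) \<and> (\<forall>u v. \<Omega> x u v = - \<Omega> x v u)) \<and>
     (\<forall>x\<in>phase B. \<forall>u. u \<noteq> 0 \<longrightarrow> (\<exists>v. \<Omega> x u v \<noteq> 0)) \<and>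
     (\<forall>x\<in>phase B. \<forall>u v w.
        frechet_derivative (\<lambda>y. \<Omega> y v w) (at x) u +
        frechet_derivative (\<lambda>y. \<Omega> y w u) (at x) v +
        frechet_derivative (\<lambda>y. \<Omega> y u v) (at x) w = 0) \<and>
     (\<forall>x\<in>phase B. \<forall>k. \<Omega> (x + zshift k) = \<Omega> x)"

definition conf_symplectic ::
    "(real^'n) set \<Rightarrow> (real^('n::finite+'n) \<Rightarrow> real^('n::finite+'n) \<Rightarrow> real^('n::finite+'n) \<Rightarrow> real) \<Rightarrow> real \<Rightarrow>
     (real^('n::finite+'n) \<Rightarrow> real^('n::finite+'n)) \<Rightarrow> bool" where
  "conf_symplectic B \<Omega> lam F \<longleftrightarrow>
     (\<forall>x\<in>phase B. \<forall>u v.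
        \<Omega> (F x) (jacobian F (at x) *v u) (jacobian F (at x) *v v) = lam * \<Omega> x u v)"

text \<open>For \<open>m\<close> near \<open>\<mu>\<close> the maps \<open>f m\<close> extend holomorphically to one domain \<open>U\<close> (a
  $\mathbb{Z}^n$-periodic lift) around the range of \<open>K\<close> on the closed strip of width \<open>r\<close>; the
  extensions form a $C^1$ family in the parameter.\<close>

definition extends_near ::
    "(real^'n) set \<Rightarrow> (real^'d \<Rightarrow> real^('n::finite+'n) \<Rightarrow> real^('n::finite+'n)) \<Rightarrow> real^'d \<Rightarrow> real \<Rightarrow>
     (real^'d \<Rightarrow> real^('n::finite+'n)) \<Rightarrow> bool" where
  "extends_near B f \<mu> r K \<longleftrightarrow>
     (\<exists>G U \<epsilon> F D.
        strip_ext r K G \<and> continuous_on (closed_strip r) G \<and>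
        open U \<and> G ` closed_strip r \<subseteq> U \<and> (\<forall>z\<in>U. \<forall>k. z + cvec (zshift k) \<in> U) \<and>
        \<epsilon> > 0 \<and>
        (\<forall>m\<in>ball \<mu> \<epsilon>.
           (\<forall>i. holo_on (\<lambda>z. F m z $ i) U) \<and>
           (\<forall>x\<in>phase B. cvec x \<in> U \<longrightarrow> F m (cvec x) = cvec (f m x)) \<and>
           (\<forall>z\<in>U. ((\<lambda>m'. F m' z) has_derivative (\<lambda>h. D m z *v cvec h)) (at m))) \<and>
        continuous_on (ball \<mu> \<epsilon> \<times> U) (\<lambda>(m, z). (D m z :: complex^'d^('n::finite+'n))))"

primrec cocycle_nat ::
    "(real^'d \<Rightarrow> real^'m^'m) \<Rightarrow> real^'d \<Rightarrow> nat \<Rightarrow> real^'d \<Rightarrow> real^'m^'m" where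
  "cocycle_nat \<gamma> \<omega> 0 \<theta> = mat 1"
| "cocycle_nat \<gamma> \<omega> (Suc j) \<theta> = \<gamma> (\<theta> + real j *\<^sub>R \<omega>) ** cocycle_nat \<gamma> \<omega> j \<theta>"

text \<open>The cocycle identity forces $\Gamma^{-m}(\theta) = (\Gamma^m(\theta - m\omega))^{-1}$.\<close>

definition cocycle ::
    "(real^'d \<Rightarrow> real^'m^'m) \<Rightarrow> real^'d \<Rightarrow> int \<Rightarrow> real^'d \<Rightarrow> real^'m^'m" where
  "cocycle \<gamma> \<omega> j \<theta> =
     (if j \<ge> 0 then cocycle_nat \<gamma> \<omega> (nat j) \<theta>
      else matrix_inv (cocycle_nat \<gamma> \<omega> (nat (- j)) (\<theta> + real_of_int j *\<^sub>R \<omega>)))"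

definition splitting_at ::
    "(real^'m) set \<Rightarrow> (real^'m) set \<Rightarrow> (real^'m) set \<Rightarrow>
     real^'m^'m \<Rightarrow> real^'m^'m \<Rightarrow> real^'m^'m \<Rightarrow> bool" where
  "splitting_at Es Ec Eu Ps Pc Pu \<longleftrightarrow>
     subspace Es \<and> subspace Ec \<and> subspace Eu \<and>
     (\<forall>v. Ps *v v \<in> Es \<and> Pc *v v \<in> Ec \<and> Pu *v v \<in> Eu \<and> Ps *v v + Pc *v v + Pu *v v = v) \<and>
     (\<forall>v\<in>Es. Ps *v v = v \<and> Pc *v v = 0 \<and> Pu *v v = 0) \<and>
     (\<forall>v\<in>Ec. Ps *v v = 0 \<and> Pc *v v = v \<and> Pu *v v = 0) \<and>
     (\<forall>v\<in>Eu. Ps *v v = 0 \<and> Pc *v v = 0 \<and> Pu *v v = v)"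

definition analytic_splitting ::
    "(real^'d \<Rightarrow> (real^'m) set) \<Rightarrow> (real^'d \<Rightarrow> (real^'m) set) \<Rightarrow> (real^'d \<Rightarrow> (real^'m) set) \<Rightarrow>
     (real^'d \<Rightarrow> real^'m^'m) \<Rightarrow> (real^'d \<Rightarrow> real^'m^'m) \<Rightarrow> (real^'d \<Rightarrow> real^'m^'m) \<Rightarrow> bool" where
  "analytic_splitting Es Ec Eu Ps Pc Pu \<longleftrightarrow>
     (\<forall>\<theta>. splitting_at (Es \<theta>) (Ec \<theta>) (Eu \<theta>) (Ps \<theta>) (Pc \<theta>) (Pu \<theta>)) \<and>
     (\<forall>\<theta> k. Es (\<theta> + ivec k) = Es \<theta> \<and> Ec (\<theta> + ivec k) = Ec \<theta> \<and> Eu (\<theta> + ivec k) = Eu \<theta>) \<and>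
     (\<forall>P\<in>{Ps, Pc, Pu}. \<forall>i j. real_analytic_on (\<lambda>\<theta>. P \<theta> $ i $ j) UNIV)"

definition trichotomy ::
    "real \<Rightarrow> real^'d \<Rightarrow> (real^'d \<Rightarrow> real^'m^'m) \<Rightarrow>
     (real^'d \<Rightarrow> (real^'m) set) \<Rightarrow> (real^'d \<Rightarrow> (real^'m) set) \<Rightarrow> (real^'d \<Rightarrow> (real^'m) set) \<Rightarrow> bool" where
  "trichotomy lam \<omega> \<gamma> Es Ec Eu \<longleftrightarrow>
     (\<exists>C0 l_minus lc_minus lc_plus l_plus :: real.
        C0 > 0 \<and> l_minus < lc_minus \<and> lc_minus \<le> lc_plus \<and> lc_plus < l_plus \<and> l_minus < 1 \<and> 1 < l_plus \<and>
        l_minus < lam * inverse l_plus \<and> lam * inverse l_plus < lc_minus \<and> lc_minus \<le> lam \<and> lam \<le> lc_plus \<and>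
        (\<forall>\<theta> v.
           (v \<in> Es \<theta> \<longleftrightarrow>
              (\<forall>j\<ge>0. norm (cocycle \<gamma> \<omega> j \<theta> *v v) \<le> C0 * l_minus powi j * norm v)) \<and>
           (v \<in> Eu \<theta> \<longleftrightarrow>
              (\<forall>j\<le>0. norm (cocycle \<gamma> \<omega> j \<theta> *v v) \<le> C0 * l_plus powi j * norm v)) \<and>
           (v \<in> Ec \<theta> \<longleftrightarrow>
              (\<forall>j\<ge>0. norm (cocycle \<gamma> \<omega> j \<theta> *v v) \<le> C0 * lc_plus powi j * norm v) \<and>
              (\<forall>j\<le>0. norm (cocycle \<gamma> \<omega> j \<theta> *v v) \<le> C0 * lc_minus powi j * norm v))))"

definition whiskered_torus ::
    "(real^('n::finite+'n) \<Rightarrow> real^('n::finite+'n)) \<Rightarrow> real \<Rightarrow> real^'d \<Rightarrow> (real^'d \<Rightarrow> real^('n::finite+'n)) \<Rightarrow>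
     (real^'d \<Rightarrow> (real^('n::finite+'n)) set) \<Rightarrow> (real^'d \<Rightarrow> (real^('n::finite+'n)) set) \<Rightarrow>
     (real^'d \<Rightarrow> (real^('n::finite+'n)) set) \<Rightarrow>
     (real^'d \<Rightarrow> real^('n::finite+'n)^('n::finite+'n)) \<Rightarrow> (real^'d \<Rightarrow> real^('n::finite+'n)^('n::finite+'n)) \<Rightarrow>
     (real^'d \<Rightarrow> real^('n::finite+'n)^('n::finite+'n)) \<Rightarrow> bool" where
  "whiskered_torus F lam \<omega> K Es Ec Eu Ps Pc Pu \<longleftrightarrow>
     (let \<gamma> = (\<lambda>\<theta>. jacobian F (at (K \<theta>))) in
        analytic_splitting Es Ec Eu Ps Pc Pu \<and>
        (\<forall>E\<in>{Es, Ec, Eu}. \<forall>\<theta>. (\<lambda>v. \<gamma> \<theta> *v v) ` E \<theta> = E (\<theta> + \<omega>)) \<and>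
        (\<forall>\<theta>. dim (Ec \<theta>) = 2 * CARD('d)) \<and>
        trichotomy lam \<omega> \<gamma> Es Ec Eu)"

definition DK :: "(real^'d \<Rightarrow> real^'m) \<Rightarrow> real^'d \<Rightarrow> real^'d^'m" where
  "DK K \<theta> = jacobian K (at \<theta>)"

definition N_mat :: "(real^'d \<Rightarrow> real^'m) \<Rightarrow> real^'d \<Rightarrow> real^'d^'d" where
  "N_mat K \<theta> = matrix_inv (transpose (DK K \<theta>) ** DK K \<theta>)"

definition P_mat :: "(real^'d \<Rightarrow> real^'m) \<Rightarrow> real^'d \<Rightarrow> real^'d^'m" where
  "P_mat K \<theta> = DK K \<theta> ** N_mat K \<theta>"

definition Jc :: "(real^'m \<Rightarrow> real^'m \<Rightarrow> real) \<Rightarrow> (real^'m) set \<Rightarrow> real^'m \<Rightarrow> real^'m" where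
  "Jc w E v = (THE a. a \<in> E \<and> (\<forall>u\<in>E. u \<bullet> a = w u v))"

text \<open>The matrix of $(J^c)^{-1} \Pi^c$; below it only acts on vectors of the center space, where
  the projection is the identity.\<close>

definition Jc_inv ::
    "(real^'m \<Rightarrow> real^'m \<Rightarrow> real^'m \<Rightarrow> real) \<Rightarrow> (real^'d \<Rightarrow> real^'m) \<Rightarrow>
     (real^'d \<Rightarrow> (real^'m) set) \<Rightarrow> (real^'d \<Rightarrow> real^'m^'m) \<Rightarrow> real^'d \<Rightarrow> real^'m^'m" where
  "Jc_inv \<Omega> K Ec Pc \<theta> =
     matrix (\<lambda>v. the_inv_into (Ec \<theta>) (Jc (\<Omega> (K \<theta>)) (Ec \<theta>)) (Pc \<theta> *v v))"

definition chi_mat ::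
    "(real^'m \<Rightarrow> real^'m \<Rightarrow> real^'m \<Rightarrow> real) \<Rightarrow> (real^'d \<Rightarrow> real^'m) \<Rightarrow>
     (real^'d \<Rightarrow> (real^'m) set) \<Rightarrow> (real^'d \<Rightarrow> real^'m^'m) \<Rightarrow> real^'d \<Rightarrow> real^'d^'d" where
  "chi_mat \<Omega> K Ec Pc \<theta> = transpose (DK K \<theta>) ** Jc_inv \<Omega> K Ec Pc \<theta> ** DK K \<theta>"

definition M_mat ::
    "(real^'m \<Rightarrow> real^'m \<Rightarrow> real^'m \<Rightarrow> real) \<Rightarrow> (real^'d \<Rightarrow> real^'m) \<Rightarrow>
     (real^'d \<Rightarrow> (real^'m) set) \<Rightarrow> (real^'d \<Rightarrow> real^'m^'m) \<Rightarrow> real^'d \<Rightarrow> real^('d::finite+'d)^'m" where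
  "M_mat \<Omega> K Ec Pc \<theta> =
     (\<chi> i j. case j of
        Inl a \<Rightarrow> DK K \<theta> $ i $ a
      | Inr b \<Rightarrow> (Jc_inv \<Omega> K Ec Pc \<theta> ** DK K \<theta> ** N_mat K \<theta>) $ i $ b)"

text \<open>The matrix of $M^{-1} \Pi^c$, with $M^{-1}$ the inverse of
  $M : \mathbb{R}^{2d} \to E^c_\theta$.\<close>

definition Minv_Pc ::
    "(real^'m \<Rightarrow> real^'m \<Rightarrow> real^'m \<Rightarrow> real) \<Rightarrow> (real^'d \<Rightarrow> real^'m) \<Rightarrow>
     (real^'d \<Rightarrow> (real^'m) set) \<Rightarrow> (real^'d \<Rightarrow> real^'m^'m) \<Rightarrow> real^'d \<Rightarrow> real^'m^('d::finite+'d)" where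
  "Minv_Pc \<Omega> K Ec Pc \<theta> =
     matrix (\<lambda>v. the_inv_into UNIV (\<lambda>w. M_mat \<Omega> K Ec Pc \<theta> *v w) (Pc \<theta> *v v))"

definition S_mat ::
    "(real^'m \<Rightarrow> real^'m \<Rightarrow> real^'m \<Rightarrow> real) \<Rightarrow> (real^'m \<Rightarrow> real^'m) \<Rightarrow> real \<Rightarrow> real^'d \<Rightarrow>
     (real^'d \<Rightarrow> real^'m) \<Rightarrow> (real^'d \<Rightarrow> (real^'m) set) \<Rightarrow> (real^'d \<Rightarrow> real^'m^'m) \<Rightarrow>
     real^'d \<Rightarrow> real^'d^'d" where
  "S_mat \<Omega> F lam \<omega> K Ec Pc \<theta> =
     transpose (P_mat K (\<theta> + \<omega>)) ** jacobian F (at (K \<theta>)) ** Jc_inv \<Omega> K Ec Pc \<theta> ** P_mat K \<theta>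
     - lam *\<^sub>R (transpose (N_mat K (\<theta> + \<omega>)) ** chi_mat \<Omega> K Ec Pc (\<theta> + \<omega>) ** N_mat K (\<theta> + \<omega>))"

definition A_mat ::
    "(real^'m \<Rightarrow> real^'m \<Rightarrow> real^'m \<Rightarrow> real) \<Rightarrow> (real^'d \<Rightarrow> real^'m \<Rightarrow> real^'m) \<Rightarrow> real^'d \<Rightarrow>
     real^'d \<Rightarrow> (real^'d \<Rightarrow> real^'m) \<Rightarrow> (real^'d \<Rightarrow> (real^'m) set) \<Rightarrow> (real^'d \<Rightarrow> real^'m^'m) \<Rightarrow>
     real^'d \<Rightarrow> real^'d^('d::finite+'d)" where
  "A_mat \<Omega> f \<mu> \<omega> K Ec Pc \<theta> =
     Minv_Pc \<Omega> K Ec Pc (\<theta> + \<omega>) ** jacobian (\<lambda>m. f m (K \<theta>)) (at \<mu>)"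

definition top_rows :: "real^'k^('d::finite+'d) \<Rightarrow> real^'k^'d" where
  "top_rows A = (\<chi> i. A $ Inl i)"

definition bottom_rows :: "real^'k^('d::finite+'d) \<Rightarrow> real^'k^'d" where
  "bottom_rows A = (\<chi> i. A $ Inr i)"

text \<open>The solution is unique among continuous periodic functions, since \<open>0 < lam < 1\<close>.\<close>

definition Wb :: "real \<Rightarrow> real^'d \<Rightarrow> (real^'d \<Rightarrow> real^'d^'d) \<Rightarrow> real^'d \<Rightarrow> real^'d^'d" where
  "Wb lam \<omega> A2 =
     (THE W. continuous_on UNIV W \<and> (\<forall>\<theta> k. W (\<theta> + ivec k) = W \<theta>) \<and> torus_avg W = 0 \<and>
        (\<forall>\<theta>. lam *\<^sub>R W \<theta> - W (\<theta> + \<omega>) = - (A2 \<theta> - torus_avg A2)))"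

definition block_mat ::
    "real^'d^'d \<Rightarrow> real^'d^'d \<Rightarrow> real^'d^'d \<Rightarrow> real^'d^'d \<Rightarrow> real^('d::finite+'d)^('d::finite+'d)" where
  "block_mat A B C D =
     (\<chi> i j. case i of
        Inl a \<Rightarrow> (case j of Inl b \<Rightarrow> A $ a $ b | Inr b \<Rightarrow> B $ a $ b)
      | Inr a \<Rightarrow> (case j of Inl b \<Rightarrow> C $ a $ b | Inr b \<Rightarrow> D $ a $ b))"

definition nondeg_mat ::
    "(real^'m \<Rightarrow> real^'m \<Rightarrow> real^'m \<Rightarrow> real) \<Rightarrow> (real^'d \<Rightarrow> real^'m \<Rightarrow> real^'m) \<Rightarrow> real^'d \<Rightarrow>
     real \<Rightarrow> real^'d \<Rightarrow> (real^'d \<Rightarrow> real^'m) \<Rightarrow> (real^'d \<Rightarrow> (real^'m) set) \<Rightarrow>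
     (real^'d \<Rightarrow> real^'m^'m) \<Rightarrow> real^('d::finite+'d)^('d::finite+'d)" where
  "nondeg_mat \<Omega> f \<mu> lam \<omega> K Ec Pc =
     (let S = S_mat \<Omega> (f \<mu>) lam \<omega> K Ec Pc;
          A1 = (\<lambda>\<theta>. top_rows (A_mat \<Omega> f \<mu> \<omega> K Ec Pc \<theta>));
          A2 = (\<lambda>\<theta>. bottom_rows (A_mat \<Omega> f \<mu> \<omega> K Ec Pc \<theta>));
          W = Wb lam \<omega> A2
      in block_mat (torus_avg S) (torus_avg (\<lambda>\<theta>. S \<theta> ** W \<theta>) + torus_avg A1)
           ((lam - 1) *\<^sub>R mat 1) (torus_avg A2))"

end

theory Submission
  imports Defs "HOL-Complex_Analysis.Cauchy_Integral_Formula"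
begin

text \<open>A direct argument with sup norms on the real torus, in place of small divisor estimates. If
  \<open>K2\<close> is close to \<open>K\<close>, write \<open>K2 \<theta> = K (\<theta> + a \<theta>) + n \<theta>\<close>, where \<open>n\<close> has no component along the torus.
  Since every reparametrized \<open>K\<close> stays on the invariant torus, the error in the linearized equation for
  \<open>n\<close>, the parameter shift \<open>\<sigma>\<close> and the increment \<open>b \<theta> = a (\<theta> + \<omega>) - a \<theta>\<close> is a small multiple of
  \<open>|n| + |\<sigma>| + |b|\<close>, without terms in \<open>a\<close> alone. The stable and unstable components of \<open>n\<close> are
  controlled by hyperbolicity, its remaining center component by the contraction with factor \<open>lam\<close>, and, as
  \<open>b\<close> has mean zero, the nondegeneracy condition controls \<open>\<sigma>\<close> and the mean of the center component. Hence
  \<open>n\<close>, \<open>\<sigma>\<close> and \<open>b\<close> vanish. So \<open>a\<close> is invariant under a nonresonant rotation, thus constant, and the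
  normalization makes it zero.\<close>

text \<open>Small divisors would enter through the equation for the reparametrization
  \<open>a\<close> itself, for which sup norms give no bound. So \<open>a\<close> is never estimated
  from the linearized equation; only its increment is used. The mean of the increment vanishes
  because averages are invariant under translation, and this supplies the d scalar conditions behind
  the first block row of the nondegeneracy matrix. Strip norms serve as upper bounds for sup norms
  at real angles. Three facts presupposed by the matrix \<open>M\<close> are derived from the
  trichotomy and conformality: tangent vectors are center vectors, the torus is isotropic, and the
  form is nondegenerate on the center space. Angles are represented by lifts whose lattice shifts
  may depend on the point and the parameter; periodicity of derived objects such as
  \<open>DK K\<close> or \<open>D\<mu>\<close> rests on the fact that continuous lattice-valued
  functions are constant. The constant \<open>C\<close> comes from compactness around the first
  torus, scaled so that both smallness conditions bound the displacement by one radius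
  \<open>e\<close>.\<close>

section \<open>Vectors, matrices and continuity of matrix operations\<close>

lemma norm_cvec [simp]: "norm (cvec x) = norm x"
  by (simp add: norm_vec_def cvec_def)

lemma cvec_add: "cvec (x + y) = cvec x + cvec y"
  and cvec_diff: "cvec (x - y) = cvec x - cvec y"
  and cvec_scaleR: "cvec (c *\<^sub>R x) = c *\<^sub>R cvec x"
  by (simp_all add: cvec_def vec_eq_iff) (simp add: scaleR_conv_of_real)?

lemma bounded_linear_cvec: "bounded_linear cvec"
  by (rule bounded_linear_intro[of _ 1]) (auto simp: cvec_add cvec_scaleR)

lemma dist_cvec [simp]: "dist (cvec x) (cvec y) = dist x y"
  by (simp add: dist_norm flip: cvec_diff)

text \<open>Matrices carry the Frobenius norm, the Euclidean norm of the vector of row norms;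
  Cauchy-Schwarz in each row gives the bound. All matrix bounds below are in this norm.\<close>

lemma norm_matrix_vector_le:
  fixes A :: "real^'m^'k"
  shows "norm (A *v x) \<le> norm A * norm x"
proof -
  have "norm (A *v x) = L2_set (\<lambda>i. norm ((A *v x) $ i)) UNIV"
    by (simp add: norm_vec_def)
  also have "\<dots> \<le> L2_set (\<lambda>i. norm (A $ i) * norm x) UNIV"
    by (rule L2_set_mono) (auto simp: matrix_vector_mul_component Cauchy_Schwarz_ineq2)
  also have "\<dots> = norm A * norm x"
    by (simp add: norm_vec_def L2_set_left_distrib)
  finally show ?thesis .
qed

lemma bounded_bilinear_matrix_vector:
  "bounded_bilinear ((*v) :: real^'m^'k \<Rightarrow> real^'m \<Rightarrow> real^'k)"
proof (unfold_locales)
  show "\<exists>K. \<forall>(a::real^'m^'k) b. norm (a *v b) \<le> norm a * norm b * K"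
    by (rule exI[of _ 1]) (auto simp: norm_matrix_vector_le)
qed (auto simp: algebra_simps scaleR_matrix_vector_assoc matrix_vector_mult_scaleR)

lemmas continuous_on_mv [continuous_intros] =
  bounded_bilinear.continuous_on[OF bounded_bilinear_matrix_vector]

lemma continuous_on_matrix_mult [continuous_intros]:
  fixes A :: "'a::topological_space \<Rightarrow> real^'m^'k" and B :: "'a \<Rightarrow> real^'l^'m"
  assumes "continuous_on S A" "continuous_on S B"
  shows "continuous_on S (\<lambda>x. A x ** B x)"
  unfolding matrix_matrix_mult_def
  by (intro continuous_intros assms)

lemma continuous_on_transpose [continuous_intros]:
  fixes A :: "'a::topological_space \<Rightarrow> real^'m^'k"
  assumes "continuous_on S A"
  shows "continuous_on S (\<lambda>x. transpose (A x))"
  unfolding transpose_def by (intro continuous_intros assms)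

lemma matrix_inv_left_right:
  fixes A :: "real^'m^'m"
  assumes "invertible A"
  shows "A ** matrix_inv A = mat 1" "matrix_inv A ** A = mat 1"
  using assms someI_ex[of "\<lambda>A'. A ** A' = mat 1 \<and> A' ** A = mat 1"]
  unfolding invertible_def matrix_inv_def by auto

text \<open>\<open>matrix_inv\<close> is a chosen inverse, so continuity is read off from Cramer's
  rule: each entry is a quotient of determinants, and determinants are polynomial in the
  entries.\<close>

lemma continuous_on_matrix_inv [continuous_intros]:
  fixes A :: "'a::topological_space \<Rightarrow> real^'m^'m"
  assumes "continuous_on S A" and "\<And>x. x \<in> S \<Longrightarrow> invertible (A x)"
  shows "continuous_on S (\<lambda>x. matrix_inv (A x))"
proof -
  have eq: "matrix_inv (A x) $ k $ l =
      det (\<chi> i j. if j = k then axis l 1 $ i else A x $ i $ j) / det (A x)" if "x \<in> S" for x k l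
  proof -
    have inv: "invertible (A x)" using assms(2) that .
    have "A x *v (matrix_inv (A x) *v axis l 1) = axis l 1"
      by (simp add: matrix_vector_mul_assoc matrix_inv_left_right[OF inv])
    then have "matrix_inv (A x) *v axis l 1 =
        (\<chi> k. det (\<chi> i j. if j = k then axis l 1 $ i else A x $ i $ j) / det (A x))"
      using cramer[of "A x"] inv by (simp add: invertible_det_nz)
    then show ?thesis
      by (simp add: matrix_vector_mul_component vec_eq_iff inner_axis)
  qed
  have cdet: "continuous_on S (\<lambda>x. det (B x))" if "continuous_on S B" for B :: "'a \<Rightarrow> real^'m^'m"
    unfolding det_def by (intro continuous_intros that)
  have "continuous_on S (\<lambda>x. if j = k then axis l 1 $ i else A x $ i $ j)" for k l i j
    by (cases "j = k") (auto intro!: continuous_intros assms)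
  then have "continuous_on S (\<lambda>x. \<chi> k l. det (\<chi> i j. if j = k then axis l 1 $ i else A x $ i $ j) / det (A x))"
    using assms(2) unfolding invertible_det_nz
    by (intro continuous_on_vec_lambda continuous_on_divide cdet assms(1)) auto
  then show ?thesis
    by (rule continuous_on_eq) (simp add: vec_eq_iff eq)
qed

subsection \<open>Holomorphic functions of several variables are continuously differentiable\<close>

text \<open>Turns the coefficient vector that \<open>holo_on\<close> only asserts to exist into a
  function of the point, whose continuity can then be studied.\<close>

lemma holo_on_has_derivative:
  fixes G :: "complex^'m \<Rightarrow> complex"
  assumes "holo_on G U" "z \<in> U"
  shows "(G has_derivative (\<lambda>h. \<Sum>i\<in>UNIV. frechet_derivative G (at z) (axis i 1) * h $ i)) (at z)"
proof -
  obtain c where c: "(G has_derivative (\<lambda>h. \<Sum>i\<in>UNIV. c $ i * h $ i)) (at z)"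
    using assms unfolding holo_on_def by blast
  have "frechet_derivative G (at z) = (\<lambda>h. \<Sum>i\<in>UNIV. c $ i * h $ i)"
    using frechet_derivative_at[OF c] by simp
  then have "frechet_derivative G (at z) (axis i 1) = c $ i" for i
    by (simp add: axis_def if_distrib cong: if_cong)
  with c show ?thesis by simp
qed

lemma holo_on_imp_continuous_on:
  assumes "holo_on G U"
  shows "continuous_on U G"
  by (intro continuous_at_imp_continuous_on ballI has_derivative_continuous[OF holo_on_has_derivative[OF assms]])

lemma norm_axisc: "norm (axis i (c::complex)) = norm c"
  unfolding norm_vec_def axis_def L2_set_def
  by (simp add: if_distrib[of norm] if_distrib[of "\<lambda>x. x^2"] cong: if_cong)

text \<open>\<open>holo_on\<close> asks for complex differentiability at each point only. The
  difference of the one-variable slices of \<open>G\<close> through \<open>z\<close> and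
  \<open>z0\<close> is small by uniform continuity of \<open>G\<close>, and Cauchy's inequality
  passes this on to its derivative at 0.\<close>

lemma holo_on_partial_continuous:
  fixes G :: "complex^'m \<Rightarrow> complex"
  assumes G: "holo_on G U" and U: "open U"
  shows "continuous_on U (\<lambda>z. frechet_derivative G (at z) (axis i 1))"
proof (rule continuous_at_imp_continuous_on, rule ballI)
  define D where "D = (\<lambda>z. frechet_derivative G (at z) (axis i 1))"
  have line: "((\<lambda>\<zeta>. G (z + axis i \<zeta>)) has_field_derivative D (z + axis i \<zeta>)) (at \<zeta>)"
    if "z + axis i \<zeta> \<in> U" for z \<zeta>
  proof -
    have bl: "bounded_linear (axis i :: complex \<Rightarrow> complex^'m)"
      by (rule bounded_linear_intro[of _ 1]) (auto simp: axis_def vec_eq_iff norm_axisc[unfolded axis_def])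
    have "((\<lambda>\<zeta>. z + axis i \<zeta>) has_derivative (\<lambda>h. axis i h)) (at \<zeta>)"
      using has_derivative_add[OF has_derivative_const bounded_linear_imp_has_derivative[OF bl]] by simp
    from has_derivative_compose[OF this holo_on_has_derivative[OF G that]]
    show ?thesis
      unfolding has_field_derivative_def D_def
      by (rule has_derivative_eq_rhs) (auto simp: axis_def if_distrib fun_eq_iff cong: if_cong)
  qed
  fix z0 assume "z0 \<in> U"
  then obtain e where e: "e > 0" "cball z0 e \<subseteq> U"
    using U open_contains_cball by blast
  \<comment> \<open>Half of the radius is spent on moving the base point from \<open>z0\<close> to
    \<open>z\<close>, the other half on the slice.\<close>
  define r where "r = e / 2"
  have r: "r > 0" using e by (simp add: r_def)
  have uc: "uniformly_continuous_on (cball z0 e) G"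
    by (intro compact_uniformly_continuous continuous_on_subset[OF holo_on_imp_continuous_on[OF G] e(2)]) auto
  show "isCont (\<lambda>z. frechet_derivative G (at z) (axis i 1)) z0"
    unfolding continuous_at_eps_delta D_def[symmetric]
  proof (intro allI impI)
    fix \<epsilon> :: real assume \<epsilon>: "\<epsilon> > 0"
    \<comment> \<open>Cauchy's inequality on the circle of radius \<open>r\<close> divides by
      \<open>r\<close>, which leaves half of \<epsilon>.\<close>
    obtain d where d: "d > 0" "\<And>x x'. x \<in> cball z0 e \<Longrightarrow> x' \<in> cball z0 e \<Longrightarrow> dist x' x < d
        \<Longrightarrow> dist (G x') (G x) < \<epsilon> * r / 2"
      using uc[unfolded uniformly_continuous_on_def, rule_format, of "\<epsilon> * r / 2"] \<epsilon> r by auto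
    have "dist (D z) (D z0) < \<epsilon>" if z: "dist z z0 < min d r" for z
    proof -
      have in1: "z + axis i \<zeta> \<in> cball z0 e" if "norm \<zeta> \<le> r" for \<zeta>
      proof -
        have "norm (z + axis i \<zeta> - z0) \<le> norm (z - z0) + norm (axis i \<zeta> :: complex^'m)"
          by (metis add_diff_eq add.commute norm_triangle_ineq diff_add_eq)
        then show ?thesis using z that by (simp add: r_def dist_norm norm_minus_commute norm_axisc)
      qed
      have in2: "z0 + axis i \<zeta> \<in> cball z0 e" if "norm \<zeta> \<le> r" for \<zeta>
        using that r by (simp add: r_def dist_norm norm_axisc)
      let ?\<phi> = "\<lambda>\<zeta>. G (z + axis i \<zeta>) - G (z0 + axis i \<zeta>)"
      have der: "(?\<phi> has_field_derivative D (z + axis i \<zeta>) - D (z0 + axis i \<zeta>)) (at \<zeta>)"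
        if "norm \<zeta> \<le> r" for \<zeta>
        by (intro DERIV_diff line) (use in1[OF that] in2[OF that] e in auto)
      have hol: "?\<phi> holomorphic_on cball 0 r"
        by (rule holomorphic_onI, rule field_differentiable_at_within,
            unfold field_differentiable_def, rule exI, rule der) simp
      have "norm ((deriv ^^ 1) ?\<phi> 0) \<le> fact 1 * (\<epsilon> * r / 2) / r ^ 1"
      proof (rule Cauchy_inequality)
        show "norm (?\<phi> x) \<le> \<epsilon> * r / 2" if "norm (0 - x) = r" for x
          using d(2)[OF in2 in1, of x x] that z by (simp add: dist_norm)
      qed (use hol r holomorphic_on_subset holomorphic_on_imp_continuous_on in auto)
      moreover have "deriv ?\<phi> 0 = D z - D z0"
        using DERIV_imp_deriv[OF der[of 0]] r by (simp add: axis_def vec_eq_iff zero_vec_def[symmetric])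
      ultimately have "norm (D z - D z0) \<le> \<epsilon> / 2" using r by simp
      with \<epsilon> show ?thesis by (simp add: dist_norm)
    qed
    then show "\<exists>d>0. \<forall>x'. dist x' z0 < d \<longrightarrow> dist (D x') (D z0) < \<epsilon>"
      using d r by (meson min_less_iff_conj)
  qed
qed

text \<open>Near a point of \<open>X\<close>, \<open>g\<close> is the real part of
  \<open>G \<circ> cvec\<close>, so its partial derivatives are real parts of those of
  \<open>G\<close> and inherit their continuity.\<close>

lemma real_analytic_on_C1:
  fixes g :: "real^'m \<Rightarrow> real"
  assumes g: "real_analytic_on g X" and X: "open X"
  shows "x \<in> X \<Longrightarrow> g differentiable (at x)"
    and "continuous_on X (\<lambda>x. frechet_derivative g (at x) (axis i 1))"
proof -
  have *: "\<exists>r>0. \<forall>y\<in>ball x r. y \<in> X \<and>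
      (g has_derivative (\<lambda>h. \<Sum>i\<in>UNIV. p i y * h $ i)) (at y) \<and> continuous_on (ball x r) (p i)"
    if "x \<in> X" and "p = (\<lambda>i x. frechet_derivative g (at x) (axis i 1))" for x p i
  proof -
    obtain r G where r: "r > 0" "holo_on G (ball (cvec x) r)"
        "\<forall>y\<in>X \<inter> ball x r. G (cvec y) = complex_of_real (g y)"
      using g \<open>x \<in> X\<close> unfolding real_analytic_on_def by blast
    \<comment> \<open>The extension matches \<open>g\<close> only at points of \<open>X\<close>; a
      ball inside \<open>X\<close> makes it match on a neighbourhood, as a full derivative
      requires.\<close>
    obtain s where s: "s > 0" "ball x s \<subseteq> X \<inter> ball x r"
      using X \<open>x \<in> X\<close> r(1) by (metis IntI centre_in_ball open_Int open_ball open_contains_ball)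
    define q where "q = (\<lambda>i y. Re (frechet_derivative G (at (cvec y)) (axis i 1)))"
    have der: "(g has_derivative (\<lambda>h. \<Sum>i\<in>UNIV. q i y * h $ i)) (at y)" if y: "y \<in> ball x s" for y
    proof -
      have "cvec y \<in> ball (cvec x) r" using y s by auto
      from has_derivative_compose[OF bounded_linear_imp_has_derivative[OF bounded_linear_cvec]
          holo_on_has_derivative[OF r(2) this]]
      have "((\<lambda>y. Re (G (cvec y))) has_derivative
          (\<lambda>h. Re (\<Sum>i\<in>UNIV. frechet_derivative G (at (cvec y)) (axis i 1) * cvec h $ i))) (at y)"
        by (rule bounded_linear.has_derivative[OF bounded_linear_Re])
      moreover have "(\<lambda>h. Re (\<Sum>i\<in>UNIV. frechet_derivative G (at (cvec y)) (axis i 1) * cvec h $ i))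
          = (\<lambda>h. \<Sum>i\<in>UNIV. q i y * h $ i)"
        by (simp add: q_def cvec_def)
      ultimately have "((\<lambda>y. Re (G (cvec y))) has_derivative (\<lambda>h. \<Sum>i\<in>UNIV. q i y * h $ i)) (at y)"
        by simp
      then show ?thesis
        by (rule has_derivative_transform_within_open[where s="ball x s"]) (use y s r in \<open>auto simp: subset_iff\<close>)
    qed
    have pq: "p i y = q i y" if "y \<in> ball x s" for y i
      unfolding \<open>p = _\<close> frechet_derivative_at[OF der[OF that], symmetric]
      by (simp add: axis_def if_distrib cong: if_cong)
    have "continuous_on (ball x s) (q i)"
      unfolding q_def
      by (intro continuous_on_Re continuous_on_compose2[OF holo_on_partial_continuous[OF r(2) open_ball]]
          linear_continuous_on bounded_linear_cvec) (use s in auto)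
    then have "continuous_on (ball x s) (p i)"
      by (rule continuous_on_eq) (simp add: pq)
    then show ?thesis using der pq s(1) s(2)[THEN subsetD] by (intro exI[of _ s] conjI ballI) auto
  qed
  { assume "x \<in> X"
    from *[OF this refl] show "g differentiable (at x)"
      unfolding differentiable_def by (meson centre_in_ball) }
  show "continuous_on X (\<lambda>x. frechet_derivative g (at x) (axis i 1))"
  proof (rule continuous_at_imp_continuous_on, rule ballI)
    fix x assume "x \<in> X"
    from *[OF this refl, of i] obtain r where "r > 0"
        "continuous_on (ball x r) (\<lambda>x. frechet_derivative g (at x) (axis i 1))"
      by (meson centre_in_ball)
    then show "isCont (\<lambda>x. frechet_derivative g (at x) (axis i 1)) x"
      by (simp add: continuous_on_eq_continuous_at)
  qed
qed

lemma real_analytic_on_jacobian: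
  fixes F :: "real^'m \<Rightarrow> real^'k"
  assumes F: "\<And>i. real_analytic_on (\<lambda>x. F x $ i) X" and X: "open X"
  shows "x \<in> X \<Longrightarrow> (F has_derivative (\<lambda>h. jacobian F (at x) *v h)) (at x)"
    and "continuous_on X (\<lambda>x. jacobian F (at x))"
proof -
  have diff: "F differentiable (at x)" if "x \<in> X" for x
  proof -
    have "((\<lambda>x. F x $ i) has_derivative frechet_derivative (\<lambda>x. F x $ i) (at x)) (at x)" for i
      using real_analytic_on_C1(1)[OF F X that] frechet_derivative_works by blast
    then have "(F has_derivative (\<lambda>h. \<chi> i. frechet_derivative (\<lambda>x. F x $ i) (at x) h)) (at x)"
      by (subst has_derivative_componentwise_within) (auto simp: Basis_vec_def inner_axis)
    then show ?thesis unfolding differentiable_def by blast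
  qed
  then show "x \<in> X \<Longrightarrow> (F has_derivative (\<lambda>h. jacobian F (at x) *v h)) (at x)"
    using jacobian_works by blast
  have comp: "jacobian F (at x) $ i $ j = frechet_derivative (\<lambda>x. F x $ i) (at x) (axis j 1)"
    if "x \<in> X" for x i j
  proof -
    have "(F has_derivative frechet_derivative F (at x)) (at x)"
      using diff[OF that] frechet_derivative_works by blast
    then have "((\<lambda>x. F x $ i) has_derivative (\<lambda>h. frechet_derivative F (at x) h $ i)) (at x)"
      by (rule bounded_linear.has_derivative[OF bounded_linear_vec_nth])
    from frechet_derivative_at[OF this] show ?thesis
      by (simp add: jacobian_def matrix_def fun_eq_iff)
  qed
  have "continuous_on X (\<lambda>x. \<chi> i j. frechet_derivative (\<lambda>x. F x $ i) (at x) (axis j 1))"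
    by (intro continuous_intros real_analytic_on_C1(2)[OF F X])
  then show "continuous_on X (\<lambda>x. jacobian F (at x))"
    by (rule continuous_on_eq) (simp add: comp vec_eq_iff)
qed

lemma real_analytic_on_continuous:
  assumes "real_analytic_on g X" "open X"
  shows "continuous_on X g"
  by (rule continuous_at_imp_continuous_on)
    (use real_analytic_on_C1(1)[OF assms] differentiable_imp_continuous_within in auto)

lemma open_strip_open: "open (open_strip r :: (complex^'d) set)"
proof -
  have "open_strip r = (\<Inter>i. {z::complex^'d. \<bar>Im (z $ i)\<bar> < r})"
    by (auto simp: open_strip_def)
  also have "open \<dots>"
    by (intro open_INT ballI open_Collect_less continuous_intros) auto
  finally show ?thesis .
qed

lemma strip_ext_real_analytic:
  fixes g :: "real^'d \<Rightarrow> real^'m"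
  assumes "strip_ext r g G" "r > 0"
  shows "real_analytic_on (\<lambda>\<theta>. g \<theta> $ i) UNIV"
  unfolding real_analytic_on_def
proof (intro ballI)
  fix x :: "real^'d"
  have "cvec x \<in> open_strip r" using assms by (auto simp: open_strip_def cvec_def)
  then obtain e where e: "e > 0" "ball (cvec x) e \<subseteq> open_strip r"
    using open_strip_open open_contains_ball by blast
  moreover have "holo_on (\<lambda>z. G z $ i) (ball (cvec x) e)"
    using assms e unfolding strip_ext_def holo_on_def by blast
  moreover have "G (cvec y) $ i = complex_of_real (g y $ i)" for y
    using assms unfolding strip_ext_def by (simp add: cvec_def)
  ultimately show "\<exists>r>0. \<exists>G. holo_on G (ball (cvec x) r) \<and>
      (\<forall>y\<in>UNIV \<inter> ball x r. G (cvec y) = complex_of_real (g y $ i))"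
    by (intro exI[of _ e] conjI exI[of _ "\<lambda>z. G z $ i"]) auto
qed

text \<open>Any extension takes the value \<open>cvec (g \<theta>)\<close> at the real point, which
  lies in the strip; if there is none, the infimum is infinite. In this way the smallness conditions
  reach the real torus.\<close>

lemma norm_le_strip_norm:
  assumes "r > 0"
  shows "ennreal (norm (g \<theta>)) \<le> strip_norm r g"
  unfolding strip_norm_def
proof (rule INF_greatest)
  fix G assume "G \<in> {G. strip_ext r g G}"
  then have "G (cvec \<theta>) = cvec (g \<theta>)" by (simp add: strip_ext_def)
  moreover have "cvec \<theta> \<in> open_strip r" using assms by (auto simp: open_strip_def cvec_def)
  ultimately show "ennreal (norm (g \<theta>)) \<le> (SUP z\<in>open_strip r. ennreal (norm (G z)))"
    using SUP_upper[of "cvec \<theta>" "open_strip r" "\<lambda>z. ennreal (norm (G z))"] by simp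
qed

subsection \<open>Uniform linearization near a compact set\<close>

text \<open>The closed neighbourhood is the Minkowski sum of \<open>C\<close> and a closed ball,
  hence compact.\<close>

lemma compact_neighbourhood:
  fixes X :: "'a::euclidean_space set"
  assumes "compact C" "open X" "C \<subseteq> X"
  obtains e where "e > 0" "compact (\<Union>x\<in>C. cball x e)" "(\<Union>x\<in>C. cball x e) \<subseteq> X"
proof -
  obtain e where e: "e > 0" "(\<Union>x\<in>C. cball x e) \<subseteq> X"
    using compact_subset_open_imp_cball_epsilon_subset[OF assms] .
  have "(\<Union>x\<in>C. cball x e) = {x + y |x y. x \<in> C \<and> y \<in> cball 0 e}"
  proof (intro set_eqI iffI)
    fix z assume "z \<in> (\<Union>x\<in>C. cball x e)"
    then obtain x where "x \<in> C" "z \<in> cball x e" by blast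
    then show "z \<in> {x + y |x y. x \<in> C \<and> y \<in> cball 0 e}"
      by (intro CollectI exI[of _ x] exI[of _ "z - x"]) (auto simp: dist_norm norm_minus_commute)
  next
    fix z assume "z \<in> {x + y |x y. x \<in> C \<and> y \<in> cball 0 e}"
    then obtain x y where "x \<in> C" "y \<in> cball 0 e" "z = x + y" by blast
    then show "z \<in> (\<Union>x\<in>C. cball x e)" by (intro UN_I[of x]) (auto simp: dist_norm)
  qed
  then have "compact (\<Union>x\<in>C. cball x e)"
    using compact_sums[OF assms(1) compact_cball, of 0 e] by simp
  with e that show ?thesis by blast
qed

text \<open>Uniform continuity of \<open>J\<close> on a compact neighbourhood and the mean value
  inequality. Both \<open>y\<close> and \<open>y'\<close> vary while the matrix stays at the center
  \<open>x\<close>: the remainder gets a small Lipschitz constant, which allows two displaced points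
  to be compared with each other.\<close>

lemma C1_uniform_linearization:
  fixes F :: "real^'m \<Rightarrow> real^'k"
  assumes C: "compact C" "C \<subseteq> X" and X: "open X"
    and der: "\<And>x. x \<in> X \<Longrightarrow> (F has_derivative (\<lambda>h. J x *v h)) (at x)"
    and J: "continuous_on X J" and "\<eta> > 0"
  shows "\<exists>r>0. \<forall>x\<in>C. \<forall>y\<in>ball x r. \<forall>y'\<in>ball x r.
       norm (F y' - F y - J x *v (y' - y)) \<le> \<eta> * norm (y' - y)"
proof -
  obtain e where e: "e > 0" "compact (\<Union>x\<in>C. cball x e)" "(\<Union>x\<in>C. cball x e) \<subseteq> X"
    using compact_neighbourhood[OF C(1) X C(2)] .
  have "uniformly_continuous_on (\<Union>x\<in>C. cball x e) J"
    using compact_uniformly_continuous continuous_on_subset[OF J e(3)] e(2) by blast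
  then obtain d where d: "d > 0" "\<And>x x'. x \<in> (\<Union>x\<in>C. cball x e) \<Longrightarrow> x' \<in> (\<Union>x\<in>C. cball x e) \<Longrightarrow>
      dist x' x < d \<Longrightarrow> dist (J x') (J x) < \<eta>"
    using \<open>\<eta> > 0\<close> unfolding uniformly_continuous_on_def by meson
  show ?thesis
  proof (intro exI[of _ "min d e"] conjI ballI)
    show "min d e > 0" using d e by simp
    fix x y y' assume x: "x \<in> C" and y: "y \<in> ball x (min d e)" and y': "y' \<in> ball x (min d e)"
    have seg: "y + t *\<^sub>R (y' - y) \<in> ball x (min d e)" if "t \<in> {0..1}" for t
        using convexD_alt[OF convex_ball y y', of t] that by (simp add: algebra_simps)
    have inX: "z \<in> X" if "z \<in> ball x (min d e)" for z
      using e(3) x that by (fastforce simp: subset_iff)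
    have der': "(F has_derivative (\<lambda>h. J z *v h)) (at z within ball x (min d e))"
      if "z \<in> ball x (min d e)" for z
      by (rule has_derivative_at_withinI[OF der[OF inX[OF that]]])
    have bd: "onorm ((*v) (J z) - (*v) (J x)) \<le> \<eta>" if z: "z \<in> ball x (min d e)" for z
    proof -
      have zz: "z \<in> (\<Union>x\<in>C. cball x e)" "x \<in> (\<Union>x\<in>C. cball x e)"
        by (rule UN_I[OF x]; use z e(1) in simp)+
      have "norm (J z - J x) \<le> \<eta>"
        using d(2)[OF zz(2,1)] z by (simp add: dist_norm norm_minus_commute)
      then have "norm ((J z - J x) *v h) \<le> \<eta> * norm h" for h
        using norm_matrix_vector_le[of "J z - J x" h] mult_right_mono[of _ \<eta> "norm h"]
        by (meson norm_ge_zero order_trans)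
      then show ?thesis
        by (intro onorm_bound)
          (use \<open>\<eta> > 0\<close> in \<open>auto simp: matrix_vector_mult_diff_rdistrib fun_diff_def\<close>)
    qed
    have "x \<in> ball x (min d e)" using d e by simp
    from differentiable_bound_linearization[OF seg der' bd this]
    show "norm (F y' - F y - J x *v (y' - y)) \<le> \<eta> * norm (y' - y)"
      by (simp add: mult.commute)
  qed
qed

section \<open>Periodic functions on the universal cover\<close>

definition zperiodic :: "(real^'d \<Rightarrow> 'b) \<Rightarrow> bool" where
  "zperiodic g \<longleftrightarrow> (\<forall>\<theta> k. g (\<theta> + ivec k) = g \<theta>)"

lemma zperiodicD: "zperiodic g \<Longrightarrow> g (\<theta> + ivec k) = g \<theta>"
  by (simp add: zperiodic_def)

lemma zperiodic_shift: "zperiodic g \<Longrightarrow> zperiodic (\<lambda>\<theta>. g (\<theta> + v))"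
  unfolding zperiodic_def by (metis add.assoc add.commute)

lemma reduce_to_unit_cube: obtains k where "\<theta> + ivec k \<in> cbox 0 (1::real^'d)"
proof
  show "\<theta> + ivec (\<chi> i. - \<lfloor>\<theta> $ i\<rfloor>) \<in> cbox 0 1"
    by (auto simp: mem_box_cart ivec_def) linarith+
qed

lemma zperiodic_eq_on_cube:
  assumes "zperiodic g" "zperiodic h" "\<And>\<theta>. \<theta> \<in> cbox 0 1 \<Longrightarrow> P (g \<theta>) (h \<theta>)"
  shows "P (g \<theta>) (h \<theta>)"
proof -
  obtain k where "\<theta> + ivec k \<in> cbox 0 1" using reduce_to_unit_cube .
  from assms(3)[OF this] show ?thesis by (simp add: zperiodicD assms(1,2))
qed

lemma zperiodic_bounded:
  fixes g :: "real^'d \<Rightarrow> 'b::real_normed_vector"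
  assumes "continuous_on UNIV g" "zperiodic g"
  obtains B where "B > 0" "\<And>\<theta>. norm (g \<theta>) \<le> B"
proof -
  have "compact (g ` cbox 0 1)"
    by (rule compact_continuous_image[OF continuous_on_subset[OF assms(1) subset_UNIV] compact_cbox])
  then obtain B where B: "B > 0" "\<forall>y\<in>g ` cbox 0 1. norm y \<le> B"
    using compact_imp_bounded bounded_pos by metis
  have "norm (g \<theta>) \<le> B" for \<theta>
    using zperiodic_eq_on_cube[OF assms(2) assms(2), of "\<lambda>x _. norm x \<le> B"] B(2) by blast
  with B(1) that show ?thesis by blast
qed

subsection \<open>Averages over the torus\<close>

lemma continuous_integrable_cube:
  fixes g :: "real^'d \<Rightarrow> 'b::euclidean_space"
  assumes "continuous_on UNIV g"
  shows "g integrable_on cbox a b"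
  by (rule integrable_continuous[OF continuous_on_subset[OF assms subset_UNIV]])

lemma integral_split_cube:
  fixes g :: "real^'d \<Rightarrow> 'b::euclidean_space"
  assumes g: "continuous_on UNIV g" and k: "k \<in> Basis"
  shows "integral (cbox a b) g =
    integral (cbox a b \<inter> {x. x \<bullet> k \<le> c}) g + integral (cbox a b \<inter> {x. x \<bullet> k \<ge> c}) g"
proof (rule integral_unique, rule has_integral_split[OF _ _ k, where c = c])
  show "(g has_integral integral (cbox a b \<inter> {x. x \<bullet> k \<le> c}) g) (cbox a b \<inter> {x. x \<bullet> k \<le> c})"
    "(g has_integral integral (cbox a b \<inter> {x. x \<bullet> k \<ge> c}) g) (cbox a b \<inter> {x. x \<bullet> k \<ge> c})"
    by (simp_all add: interval_split[OF k] integrable_integral continuous_integrable_cube[OF g])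
qed

lemma content_unit_cube [simp]: "measure lborel (cbox 0 (1::real^'d)) = 1"
  by (subst content_cbox_cart) (auto simp: interval_ne_empty_cart)

lemma torus_avg_const [simp]: "torus_avg (\<lambda>\<theta>. c) = c"
  by (simp add: torus_avg_def)

lemma torus_avg_linear:
  fixes g :: "real^'d \<Rightarrow> 'b::euclidean_space"
  assumes "bounded_linear L" "continuous_on UNIV g"
  shows "torus_avg (\<lambda>\<theta>. L (g \<theta>)) = L (torus_avg g)"
  using integral_linear[OF continuous_integrable_cube[OF assms(2)] assms(1)]
  by (simp add: torus_avg_def o_def)

lemma torus_avg_add:
  fixes g h :: "real^'d \<Rightarrow> 'b::euclidean_space"
  assumes "continuous_on UNIV g" "continuous_on UNIV h"
  shows "torus_avg (\<lambda>\<theta>. g \<theta> + h \<theta>) = torus_avg g + torus_avg h"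
  unfolding torus_avg_def by (intro integral_add continuous_integrable_cube assms)

lemma torus_avg_diff:
  fixes g h :: "real^'d \<Rightarrow> 'b::euclidean_space"
  assumes "continuous_on UNIV g" "continuous_on UNIV h"
  shows "torus_avg (\<lambda>\<theta>. g \<theta> - h \<theta>) = torus_avg g - torus_avg h"
  unfolding torus_avg_def by (intro integral_diff continuous_integrable_cube assms)

lemma norm_torus_avg_le:
  fixes g :: "real^'d \<Rightarrow> 'b::euclidean_space"
  assumes "continuous_on UNIV g" "\<And>\<theta>. norm (g \<theta>) \<le> B"
  shows "norm (torus_avg g) \<le> B"
proof -
  have "(g has_integral torus_avg g) (cbox 0 1)"
    unfolding torus_avg_def using continuous_integrable_cube[OF assms(1)] by (rule integrable_integral)
  moreover have "0 \<le> B" using assms(2)[of 0] norm_ge_zero order_trans by blast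
  ultimately show ?thesis
    using has_integral_bound[of B g "torus_avg g" 0 1] assms(2) by simp
qed

lemma ivec_axis: "ivec (axis i 1) = axis i 1"
  by (simp add: ivec_def axis_def vec_eq_iff)

lemma ivec_minus: "ivec (- k) = - ivec k" and ivec_0 [simp]: "ivec 0 = 0"
  by (auto simp: ivec_def vec_eq_iff)

lemma zperiodicD': "zperiodic g \<Longrightarrow> g (\<theta> - ivec k) = g \<theta>"
  using zperiodicD[of g \<theta> "-k"] by (simp add: ivec_minus)

text \<open>The cube translated by \<open>t\<close> along one axis is cut at the hyperplane where
  that coordinate is 1. The piece beyond it is moved back by one period and fills the slab of the
  unit cube where the coordinate is at most \<open>t\<close>.\<close>

lemma torus_avg_shift_axis01:
  fixes g :: "real^'d \<Rightarrow> 'b::euclidean_space"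
  assumes g: "continuous_on UNIV g" "zperiodic g" and t: "0 \<le> t" "t \<le> 1"
  shows "torus_avg (\<lambda>\<theta>. g (\<theta> + t *\<^sub>R axis i 1)) = torus_avg g"
proof -
  let ?e = "axis i 1 :: real^'d"
  have e: "?e \<in> Basis" by (simp add: axis_in_Basis_iff)
  have comp: "x \<bullet> ?e = x $ i" for x :: "real^'d" by (simp add: inner_axis)
  have box: "x \<in> cbox (a *\<^sub>R ?e) (1 + b *\<^sub>R ?e) \<longleftrightarrow>
      (\<forall>j. j \<noteq> i \<longrightarrow> 0 \<le> x $ j \<and> x $ j \<le> 1) \<and> a \<le> x $ i \<and> x $ i \<le> 1 + b" for x a b
    by (auto simp: mem_box_cart axis_def split: if_splits)
  note box' = box box[of _ 0 0, simplified] box[of _ t 0, simplified] box[of _ 1 t, simplified]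
  define A where "A = cbox (t *\<^sub>R ?e) 1"
  have s1: "cbox (t *\<^sub>R ?e) (1 + t *\<^sub>R ?e) \<inter> {x. x \<bullet> ?e \<le> 1} = A"
    using t by (auto simp: box' A_def comp)
  have s2: "cbox (t *\<^sub>R ?e) (1 + t *\<^sub>R ?e) \<inter> {x. x \<bullet> ?e \<ge> 1} = cbox ?e (1 + t *\<^sub>R ?e)"
    using t by (auto simp: box' comp)
  have s3: "cbox 0 1 \<inter> {x. x \<bullet> ?e \<ge> t} = A"
    using t by (auto simp: box' A_def comp)
  have "x \<in> cbox 0 (1 + t *\<^sub>R ?e - ?e) \<longleftrightarrow>
      (\<forall>j. j \<noteq> i \<longrightarrow> 0 \<le> x $ j \<and> x $ j \<le> 1) \<and> 0 \<le> x $ i \<and> x $ i \<le> t" for x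
    by (auto simp: mem_box_cart axis_def split: if_splits)
  then have s4: "cbox 0 1 \<inter> {x. x \<bullet> ?e \<le> t} = cbox 0 (1 + t *\<^sub>R ?e - ?e)"
    using t by (auto simp: box' comp)
  have "integral (cbox ?e (1 + t *\<^sub>R ?e)) g = integral (cbox 0 (1 + t *\<^sub>R ?e - ?e)) (g \<circ> (+) ?e)"
    using integral_shift_cbox_plus[of 0 "1 + t *\<^sub>R ?e - ?e" g ?e] by simp
  also have "g \<circ> (+) ?e = g"
    using zperiodicD[OF g(2), of _ "axis i 1"] by (auto simp: ivec_axis add.commute)
  finally have B: "integral (cbox ?e (1 + t *\<^sub>R ?e)) g = integral (cbox 0 (1 + t *\<^sub>R ?e - ?e)) g" .
  have "torus_avg (\<lambda>\<theta>. g (\<theta> + t *\<^sub>R ?e)) = integral (cbox 0 1) (g \<circ> (+) (t *\<^sub>R ?e))"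
    by (simp add: torus_avg_def o_def add.commute)
  also have "\<dots> = integral (cbox (t *\<^sub>R ?e) (1 + t *\<^sub>R ?e)) g"
    using integral_shift_cbox_plus[of 0 1 g "t *\<^sub>R ?e"] by simp
  also have "\<dots> = integral A g + integral (cbox ?e (1 + t *\<^sub>R ?e)) g"
    using integral_split_cube[OF g(1) e, of "t *\<^sub>R ?e" "1 + t *\<^sub>R ?e" 1] by (simp add: s1 s2)
  also have "\<dots> = torus_avg g"
    using integral_split_cube[OF g(1) e, of 0 1 t] by (simp add: s3 s4 B torus_avg_def)
  finally show ?thesis .
qed

text \<open>The integer part of the shift disappears by periodicity.\<close>

lemma torus_avg_shift_axis:
  fixes g :: "real^'d \<Rightarrow> 'b::euclidean_space"
  assumes g: "continuous_on UNIV g" "zperiodic g"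
  shows "torus_avg (\<lambda>\<theta>. g (\<theta> + t *\<^sub>R axis i 1)) = torus_avg g"
proof -
  have "t *\<^sub>R axis i 1 = frac t *\<^sub>R axis i 1 + (ivec (axis i \<lfloor>t\<rfloor>) :: real^'d)"
    by (auto simp: vec_eq_iff axis_def ivec_def frac_def)
  then have "g (\<theta> + t *\<^sub>R axis i 1) = g (\<theta> + frac t *\<^sub>R axis i 1)" for \<theta>
    using zperiodicD[OF g(2)] by (simp flip: add.assoc)
  then show ?thesis
    using torus_avg_shift_axis01[OF g, of "frac t" i] frac_lt_1[of t] by simp
qed

lemma torus_avg_shift:
  fixes g :: "real^'d \<Rightarrow> 'b::euclidean_space"
  assumes g: "continuous_on UNIV g" "zperiodic g"
  shows "torus_avg (\<lambda>\<theta>. g (\<theta> + v)) = torus_avg g"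
proof -
  have "torus_avg (\<lambda>\<theta>. g (\<theta> + (\<Sum>i\<in>I. v $ i *\<^sub>R axis i 1))) = torus_avg g" if "finite I" for I
    using that
  proof induction
    case (insert j I)
    let ?h = "\<lambda>\<theta>. g (\<theta> + (\<Sum>i\<in>I. v $ i *\<^sub>R axis i 1))"
    have "continuous_on UNIV ?h"
      by (intro continuous_on_compose2[OF g(1)] continuous_intros) auto
    from torus_avg_shift_axis[OF this zperiodic_shift[OF g(2)], of "v $ j" j] insert
    show ?case by (simp add: ac_simps)
  qed simp
  from this[of UNIV] show ?thesis
    using basis_expansion[of v] by (simp add: scalar_mult_eq_scaleR)
qed

subsection \<open>Ergodicity of non-resonant rotations\<close>

text \<open>Rational independence of 1 and the components of \<omega>, the hypothesis of Kronecker's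
  theorem.\<close>

definition nonresonant :: "real^'d \<Rightarrow> bool" where
  "nonresonant \<omega> \<longleftrightarrow> (\<forall>k. k \<noteq> 0 \<longrightarrow> ivec k \<bullet> \<omega> \<notin> \<int>)"

lemma diophantine_nonresonant:
  assumes "diophantine \<nu> \<tau> (\<omega> :: real^'d)"
  shows "nonresonant \<omega>"
  unfolding nonresonant_def
proof (intro allI impI notI)
  fix k :: "int^'d" assume k: "k \<noteq> 0" "ivec k \<bullet> \<omega> \<in> \<int>"
  then obtain m :: int where "ivec k \<bullet> \<omega> = of_int m" by (auto elim: Ints_cases)
  then have "cis (2 * pi * (ivec k \<bullet> \<omega>)) = 1"
    using cis_multiple_2pi[of "of_int m"] by simp
  with assms k(1) show False by (simp add: diophantine_def Let_def)
qed

text \<open>The quotient at a unit vector is positive and bounded by the supremum. Positivity lets a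
  large \<open>C\<close> compensate the factor \<open>\<nu> * \<delta> powr (- \<tau>)\<close> in
  the theorem.\<close>

lemma diophantine_pos:
  assumes "diophantine \<nu> \<tau> (\<omega> :: real^'d)"
  shows "\<nu> > 0"
proof -
  define den where "den = (\<lambda>k::int^'d. cmod (cis (2 * pi * (ivec k \<bullet> \<omega>)) - 1))"
  define q where "q = (\<lambda>k::int^'d. inverse (den k) * (\<Sum>i\<in>UNIV. \<bar>real_of_int (k $ i)\<bar>) powr (- \<tau>))"
  have *: "\<forall>k. k \<noteq> 0 \<longrightarrow> den k \<noteq> 0" "bdd_above (q ` (UNIV - {0}))" "(SUP k\<in>UNIV - {0}. q k) = \<nu>"
    using assms by (auto simp: diophantine_def Let_def q_def den_def)
  obtain i :: 'd where True by blast
  let ?k = "axis i 1 :: int^'d"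
  have "(\<Sum>j\<in>UNIV. \<bar>real_of_int (?k $ j)\<bar>) = 1"
    by (simp add: axis_def if_distrib cong: if_cong)
  moreover have "den ?k > 0" using *(1) by (simp add: den_def)
  ultimately have "q ?k > 0" by (simp add: q_def)
  also have "q ?k \<le> \<nu>" using *(2,3) cSUP_upper[of ?k "UNIV - {0}" q] by simp
  finally show ?thesis .
qed

text \<open>Kronecker's simultaneous approximation, transported from sequences over an initial
  segment of the natural numbers to vectors.\<close>

lemma nonresonant_dense_orbit:
  fixes \<omega> \<alpha> :: "real^'d"
  assumes \<omega>: "nonresonant \<omega>" and "\<epsilon> > 0"
  obtains j :: int and l :: "int^'d" where "\<And>i. \<bar>of_int j * \<omega> $ i - of_int (l $ i) - \<alpha> $ i\<bar> < \<epsilon>"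
proof -
  define n where "n = CARD('d)"
  obtain h where h: "bij_betw h {..<n} (UNIV :: 'd set)"
    using ex_bij_betw_nat_finite[of "UNIV :: 'd set"] by (auto simp: n_def atLeast0LessThan)
  define h' where "h' = the_inv_into {..<n} h"
  have h': "h' i < n" "h (h' i) = i" for i
    using h the_inv_into_into[of h "{..<n}" i "{..<n}"] f_the_inv_into_f_bij_betw[OF h, of i]
    by (auto simp: h'_def bij_betw_def)
  have h'h: "h' (h i) = i" if "i < n" for i
    using that h by (auto simp: h'_def bij_betw_def the_inv_into_f_f)
  \<comment> \<open>Index \<open>n\<close> carries the extra number 1, so that an integer relation
    among the values of \<open>\<theta>\<close> is a resonance of \<omega>.\<close>
  define \<theta> where "\<theta> = (\<lambda>i. if i < n then \<omega> $ h i else 1)"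
  have res: "c i = 0" if "(\<Sum>i\<le>n. of_int (c i) * \<theta> i) = 0" "i \<le> n" for c :: "nat \<Rightarrow> int" and i
  proof -
    define k where "k = (\<chi> i. c (h' i))"
    have "{..n} = insert n {..<n}" by auto
    then have "(\<Sum>i<n. of_int (c i) * \<omega> $ h i) + of_int (c n) = 0"
      using that(1) by (simp add: \<theta>_def)
    also have "(\<Sum>i<n. of_int (c i) * \<omega> $ h i) = (\<Sum>i<n. of_int (k $ h i) * \<omega> $ h i)"
      by (rule sum.cong) (auto simp: k_def h'h)
    also have "\<dots> = ivec k \<bullet> \<omega>"
      using sum.reindex_bij_betw[OF h, of "\<lambda>i. of_int (k $ i) * \<omega> $ i"]
      by (simp add: inner_vec_def ivec_def)
    finally have *: "ivec k \<bullet> \<omega> = of_int (- c n)" by simp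
    then have "k = 0" using \<omega> by (metis Ints_of_int nonresonant_def)
    then have "c n = 0" using * by simp
    moreover have "c i = 0" if "i < n"
    proof -
      have "k $ h i = 0" using \<open>k = 0\<close> by simp
      then show ?thesis using that by (simp add: k_def h'h)
    qed
    ultimately show ?thesis using \<open>i \<le> n\<close> le_neq_implies_less by blast
  qed
  \<comment> \<open>Two equal values would be a relation with coefficients 1 and -1. Injectivity is
    proved separately because independence speaks of the set of values.\<close>
  have inj: "inj_on \<theta> {..n}"
  proof (rule inj_onI, rule ccontr)
    fix x y assume xy: "x \<in> {..n}" "y \<in> {..n}" "\<theta> x = \<theta> y" "x \<noteq> y"
    define c :: "nat \<Rightarrow> int" where "c = (\<lambda>i. if i = x then 1 else if i = y then -1 else 0)"
    have "of_int (c i) * \<theta> i = (if i = x then \<theta> x else 0) - (if i = y then \<theta> y else 0)" for i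
      using xy(4) by (auto simp: c_def)
    then have "(\<Sum>i\<le>n. of_int (c i) * \<theta> i) = \<theta> x - \<theta> y"
      using xy(1,2) by (simp add: sum_subtractf)
    from res[of c x] this xy show False by (simp add: c_def)
  qed
  interpret Modules.module "\<lambda>r. (*) (real_of_int r)"
    by (simp add: Modules.module.intro distrib_left mult.commute)
  have indep: "module.independent (\<lambda>r. (*) (real_of_int r)) (\<theta> ` {..n})"
    unfolding dependent_explicit
  proof (safe)
    fix t u v assume t: "finite t" "t \<subseteq> \<theta> ` {..n}" "(\<Sum>v\<in>t. real_of_int (u v) * v) = 0" "v \<in> t"
      and nz: "u v \<noteq> 0"
    define c where "c = (\<lambda>i. if \<theta> i \<in> t then u (\<theta> i) else 0)"
    have "(\<Sum>i\<le>n. of_int (c i) * \<theta> i) = (\<Sum>v\<in>\<theta> ` {..n}. real_of_int (if v \<in> t then u v else 0) * v)"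
      by (simp add: sum.reindex[OF inj] c_def)
    also have "\<dots> = (\<Sum>v\<in>\<theta> ` {..n}. if v \<in> t then real_of_int (u v) * v else 0)"
      by (rule sum.cong) auto
    also have "\<dots> = (\<Sum>v\<in>\<theta> ` {..n} \<inter> t. real_of_int (u v) * v)"
      by (simp add: sum.inter_restrict)
    also have "\<theta> ` {..n} \<inter> t = t" using t by blast
    finally have 0: "(\<Sum>i\<le>n. of_int (c i) * \<theta> i) = 0" using t by simp
    obtain i where "i \<le> n" "v = \<theta> i" using t by blast
    with res[OF 0, of i] t nz show False by (simp add: c_def)
  qed
  obtain j m where jm: "\<And>i. i < n \<Longrightarrow> \<bar>of_int j * \<theta> i - of_int (m i) - \<alpha> $ h i\<bar> < \<epsilon>"
    by (rule Kronecker_thm_2[OF indep inj _ \<open>\<epsilon> > 0\<close>, of "\<lambda>i. \<alpha> $ h i"])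
      (auto simp: \<theta>_def)
  show ?thesis
  proof (rule that[of j "\<chi> i. m (h' i)"])
    show "\<bar>of_int j * \<omega> $ i - of_int ((\<chi> i. m (h' i)) $ i) - \<alpha> $ i\<bar> < \<epsilon>" for i
      using jm[OF h'(1), of i] by (simp add: \<theta>_def h')
  qed
qed

lemma invariant_nat: "(\<And>\<theta>. g (\<theta> + \<omega>) = g \<theta>) \<Longrightarrow> g (\<theta> + real j *\<^sub>R \<omega>) = g \<theta>"
  for \<omega> :: "'a::real_vector"
  by (induction j) (auto simp: algebra_simps simp flip: add.assoc, metis add.assoc add.commute)

text \<open>The level set of \<open>g\<close> through 0 is closed and contains the points
  \<open>of_int j *\<^sub>R \<omega> - ivec l\<close>, which are dense.\<close>

lemma rotation_invariant_const:
  fixes g :: "real^'d \<Rightarrow> 'b::t1_space"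
  assumes \<omega>: "nonresonant \<omega>" and g: "continuous_on UNIV g" "zperiodic g"
    and inv: "\<And>\<theta>. g (\<theta> + \<omega>) = g \<theta>"
  shows "g \<alpha> = g 0"
proof -
  have int: "g (of_int j *\<^sub>R \<omega>) = g 0" for j :: int
  proof (cases "j \<ge> 0")
    case True
    then show ?thesis using invariant_nat[of g \<omega> 0 "nat j"] inv by simp
  next
    case False
    then show ?thesis using invariant_nat[of g \<omega> "of_int j *\<^sub>R \<omega>" "nat (-j)"] inv by simp
  qed
  have cl: "closed (g -` {g 0})" by (rule closed_vimage[OF closed_singleton g(1)])
  have "\<alpha> \<in> closure (g -` {g 0})"
    unfolding closure_approachable
  proof (intro allI impI)
    fix e :: real assume e: "e > 0"
    \<comment> \<open>The Euclidean norm is estimated by the sum of the absolute coordinates, hence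
      the accuracy \<open>e / n\<close> in each.\<close>
    define n where "n = real CARD('d)"
    have n: "n > 0" by (simp add: n_def)
    obtain j l where jl: "\<And>i. \<bar>of_int j * \<omega> $ i - of_int (l $ i) - \<alpha> $ i\<bar> < e / n"
      using nonresonant_dense_orbit[OF \<omega>, of "e / n" \<alpha>] e n by auto
    let ?y = "of_int j *\<^sub>R \<omega> - ivec l"
    have "norm (?y - \<alpha>) \<le> (\<Sum>i\<in>UNIV. \<bar>(?y - \<alpha>) $ i\<bar>)" by (rule norm_le_l1_cart)
    also have "\<dots> < (\<Sum>i\<in>(UNIV::'d set). e / n)"
      by (rule sum_strict_mono) (use jl in \<open>auto simp: ivec_def\<close>)
    also have "\<dots> = e" using n by (simp add: n_def)
    finally have "dist ?y \<alpha> < e" by (simp add: dist_norm)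
    moreover have "?y \<in> g -` {g 0}"
      using int zperiodicD'[OF g(2)] by simp
    ultimately show "\<exists>y\<in>g -` {g 0}. dist y \<alpha> < e" by blast
  qed
  then show ?thesis using cl by (simp add: closure_closed)
qed

text \<open>As a simp rule it would turn \<open>transpose A *v x\<close> into a vector-matrix
  product and hide the matrix products used below.\<close>

declare transpose_matrix_vector [simp del]

section \<open>Coordinates split into a tangential and a conjugate half\<close>

definition inl_part :: "real^('d::finite+'d) \<Rightarrow> real^'d" where
  "inl_part x = (\<chi> i. x $ Inl i)"

definition inr_part :: "real^('d::finite+'d) \<Rightarrow> real^'d" where
  "inr_part x = (\<chi> i. x $ Inr i)"

definition join_parts :: "real^'d \<Rightarrow> real^'d \<Rightarrow> real^('d::finite+'d)" where
  "join_parts a b = (\<chi> i. case i of Inl j \<Rightarrow> a $ j | Inr j \<Rightarrow> b $ j)"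

lemma join_parts_simps [simp]:
  "inl_part (join_parts a b) = a" "inr_part (join_parts a b) = b"
  "join_parts (inl_part x) (inr_part x) = x"
  by (auto simp: inl_part_def inr_part_def join_parts_def vec_eq_iff split: sum.splits)

lemma bounded_linear_inl_part: "bounded_linear inl_part"
  and bounded_linear_inr_part: "bounded_linear inr_part"
  unfolding linear_conv_bounded_linear[symmetric]
  by (auto simp: linear_iff inl_part_def inr_part_def vec_eq_iff)

lemma sum_UNIV_sum: "sum f (UNIV :: ('a::finite + 'b::finite) set) =
    (\<Sum>i\<in>UNIV. f (Inl i)) + (\<Sum>i\<in>UNIV. f (Inr i))"
  by (simp add: sum.Plus o_def flip: UNIV_Plus_UNIV)

lemma norm_join_parts_le: "norm x \<le> norm (inl_part x) + norm (inr_part x)"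
proof -
  have "(norm x)\<^sup>2 = (norm (inl_part x))\<^sup>2 + (norm (inr_part x))\<^sup>2"
    unfolding power2_norm_eq_inner
    by (simp add: inner_vec_def sum_UNIV_sum inl_part_def inr_part_def)
  also have "\<dots> \<le> (norm (inl_part x) + norm (inr_part x))\<^sup>2"
    by (simp add: power2_sum)
  finally show ?thesis by (rule power2_le_imp_le) simp
qed

lemma norm_inl_part_le: "norm (inl_part x) \<le> norm x"
  and norm_inr_part_le: "norm (inr_part x) \<le> norm x"
proof -
  have "(norm x)\<^sup>2 = (norm (inl_part x))\<^sup>2 + (norm (inr_part x))\<^sup>2"
    unfolding power2_norm_eq_inner
    by (simp add: inner_vec_def sum_UNIV_sum inl_part_def inr_part_def)
  then have "(norm (inl_part x))\<^sup>2 \<le> (norm x)\<^sup>2" "(norm (inr_part x))\<^sup>2 \<le> (norm x)\<^sup>2" by simp_all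
  then show "norm (inl_part x) \<le> norm x" "norm (inr_part x) \<le> norm x"
    by (auto intro: power2_le_imp_le)
qed

subsection \<open>The symplectic frame of an isotropic subspace\<close>

text \<open>With \<theta> frozen, \<open>Jc_inv\<close>, \<open>M_mat\<close> and
  \<open>Minv_Pc\<close> are linear algebra of one form \<open>w\<close> on one subspace
  \<open>E\<close> with projection \<open>P\<close> and a matrix \<open>L\<close> in place of
  \<open>DK\<close>. These three definitions isolate that pointwise content.\<close>

definition form_inv ::
    "(real^'m \<Rightarrow> real^'m \<Rightarrow> real) \<Rightarrow> (real^'m) set \<Rightarrow> real^'m^'m \<Rightarrow> real^'m^'m" where
  "form_inv w E P = matrix (\<lambda>v. the_inv_into E (Jc w E) (P *v v))"

definition frame ::
    "(real^'m \<Rightarrow> real^'m \<Rightarrow> real) \<Rightarrow> (real^'m) set \<Rightarrow> real^'m^'m \<Rightarrow> real^'d^'m \<Rightarrow> real^('d::finite+'d)^'m" where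
  "frame w E P L = (\<chi> i j. case j of Inl a \<Rightarrow> L $ i $ a
     | Inr b \<Rightarrow> (form_inv w E P ** L ** matrix_inv (transpose L ** L)) $ i $ b)"

definition frame_inv ::
    "(real^'m \<Rightarrow> real^'m \<Rightarrow> real) \<Rightarrow> (real^'m) set \<Rightarrow> real^'m^'m \<Rightarrow> real^'d^'m \<Rightarrow> real^'m^('d::finite+'d)" where
  "frame_inv w E P L = matrix (\<lambda>v. the_inv_into UNIV (\<lambda>x. frame w E P L *v x) (P *v v))"

lemma frame_defs:
  "Jc_inv \<Omega> K Ec Pc \<theta> = form_inv (\<Omega> (K \<theta>)) (Ec \<theta>) (Pc \<theta>)"
  "M_mat \<Omega> K Ec Pc \<theta> = frame (\<Omega> (K \<theta>)) (Ec \<theta>) (Pc \<theta>) (DK K \<theta>)"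
  "Minv_Pc \<Omega> K Ec Pc \<theta> = frame_inv (\<Omega> (K \<theta>)) (Ec \<theta>) (Pc \<theta>) (DK K \<theta>)"
proof -
  show 1: "Jc_inv \<Omega> K Ec Pc \<theta> = form_inv (\<Omega> (K \<theta>)) (Ec \<theta>) (Pc \<theta>)"
    by (simp add: Jc_inv_def form_inv_def)
  show 2: "M_mat \<Omega> K Ec Pc \<theta> = frame (\<Omega> (K \<theta>)) (Ec \<theta>) (Pc \<theta>) (DK K \<theta>)"
    unfolding M_mat_def frame_def N_mat_def 1 ..
  show "Minv_Pc \<Omega> K Ec Pc \<theta> = frame_inv (\<Omega> (K \<theta>)) (Ec \<theta>) (Pc \<theta>) (DK K \<theta>)"
    by (simp add: Minv_Pc_def frame_inv_def 2)
qed

lemma frame_mult: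
  "frame w E P L *v x = L *v inl_part x +
     form_inv w E P *v (L *v (matrix_inv (transpose L ** L) *v inr_part x))"
proof -
  let ?C = "form_inv w E P ** L ** matrix_inv (transpose L ** L)"
  have "frame w E P L *v x = L *v inl_part x + ?C *v inr_part x"
    by (simp add: frame_def matrix_vector_mult_def sum_UNIV_sum vec_eq_iff inl_part_def inr_part_def)
  then show ?thesis by (simp flip: matrix_vector_mul_assoc)
qed

lemma inner_transpose: "x \<bullet> (transpose A *v y) = (A *v x) \<bullet> y" for A :: "real^'k^'l"
  by (metis dot_lmul_matrix inner_commute transpose_matrix_vector)

text \<open>\<open>P\<close> is any projection onto \<open>E\<close>, in general not the orthogonal
  one, and nondegeneracy is asked on \<open>E\<close> alone. The locale serves the center space and
  also, with \<open>E = UNIV\<close>, the whole space.\<close>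

locale nondeg_subspace =
  fixes w :: "real^'m \<Rightarrow> real^'m \<Rightarrow> real" and E :: "(real^'m) set" and P :: "real^'m^'m"
  assumes w: "bilinear w" and antisym: "\<And>u v. w u v = - w v u"
    and E: "subspace E" and P_in: "\<And>v. P *v v \<in> E" and P_id: "\<And>v. v \<in> E \<Longrightarrow> P *v v = v"
    and nondeg: "\<And>x. x \<in> E \<Longrightarrow> (\<And>u. u \<in> E \<Longrightarrow> w u x = 0) \<Longrightarrow> x = 0"
begin

lemma Jc_unique:
  assumes "a \<in> E" "\<And>u. u \<in> E \<Longrightarrow> u \<bullet> a = w u v"
    and "b \<in> E" "\<And>u. u \<in> E \<Longrightarrow> u \<bullet> b = w u v"
  shows "a = b"
proof -
  have "a - b \<in> E" using E assms by (simp add: subspace_diff)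
  then have "(a - b) \<bullet> (a - b) = 0" using assms by (simp add: inner_diff_right)
  then show ?thesis by simp
qed

lemma Jc_eqI:
  assumes "a \<in> E" "\<And>u. u \<in> E \<Longrightarrow> u \<bullet> a = w u v"
  shows "Jc w E v = a"
  unfolding Jc_def by (rule the_equality) (use assms Jc_unique in blast)+

text \<open>Existence behind the definite description: the functional
  \<open>\<lambda>u. w u v\<close> is represented by a vector \<open>b\<close> of the whole space,
  and the orthogonal projection of \<open>b\<close> onto \<open>E\<close> represents it on
  \<open>E\<close>.\<close>

lemma Jc: "Jc w E v \<in> E" "\<And>u. u \<in> E \<Longrightarrow> u \<bullet> Jc w E v = w u v"
proof -
  define b where "b = (\<Sum>i\<in>Basis. w i v *\<^sub>R i)"
  have lin: "linear (\<lambda>u. w u v)" using w by (simp add: bilinear_def)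
  have b: "u \<bullet> b = w u v" for u
  proof -
    have "w u v = w (\<Sum>i\<in>Basis. (u \<bullet> i) *\<^sub>R i) v" by (simp add: euclidean_representation)
    also have "\<dots> = (\<Sum>i\<in>Basis. (u \<bullet> i) *\<^sub>R w i v)"
      using linear_sum[OF lin, of "\<lambda>i. (u \<bullet> i) *\<^sub>R i" Basis] linear_cmul[OF lin] by simp
    also have "\<dots> = u \<bullet> b" by (simp add: b_def inner_sum_right mult.commute)
    finally show ?thesis by simp
  qed
  obtain y z where yz: "y \<in> span E" "\<And>u. u \<in> span E \<Longrightarrow> orthogonal z u" "b = y + z"
    using orthogonal_subspace_decomp_exists[of E b] by blast
  have "Jc w E v = y"
  proof (rule Jc_eqI)
    show "y \<in> E" using yz(1) E by (simp add: span_eq_iff[THEN iffD2])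
    fix u assume "u \<in> E"
    then have "orthogonal z u" using yz(2) span_base by blast
    then have "u \<bullet> y = u \<bullet> b" by (simp add: yz(3) inner_add_right orthogonal_def inner_commute)
    then show "u \<bullet> y = w u v" using b by simp
  qed
  moreover have "y \<in> E" using yz(1) E by (simp add: span_eq_iff[THEN iffD2])
  moreover have "u \<bullet> y = w u v" if "u \<in> E" for u
  proof -
    have "orthogonal z u" using yz(2) span_base that by blast
    then have "u \<bullet> y = u \<bullet> b" by (simp add: yz(3) inner_add_right orthogonal_def inner_commute)
    then show "u \<bullet> y = w u v" using b by simp
  qed
  ultimately show "Jc w E v \<in> E" "\<And>u. u \<in> E \<Longrightarrow> u \<bullet> Jc w E v = w u v" by simp_all
qed

lemma linear_Jc: "linear (Jc w E)"
proof (rule linearI)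
  fix x y show "Jc w E (x + y) = Jc w E x + Jc w E y"
    by (rule Jc_eqI) (use w E Jc in \<open>auto simp: subspace_add inner_add_right bilinear_radd\<close>)
next
  fix c x show "Jc w E (c *\<^sub>R x) = c *\<^sub>R Jc w E x"
    by (rule Jc_eqI) (use w E Jc in \<open>auto simp: subspace_mul bilinear_rmul\<close>)
qed

lemma Jc_inj: "inj_on (Jc w E) E"
proof (rule inj_onI)
  fix x y assume xy: "x \<in> E" "y \<in> E" "Jc w E x = Jc w E y"
  have "x - y = 0"
  proof (rule nondeg)
    show "x - y \<in> E" using E xy by (simp add: subspace_diff)
    show "w u (x - y) = 0" if "u \<in> E" for u
      using Jc(2)[OF that, of x] Jc(2)[OF that, of y] xy(3) w by (simp add: bilinear_rsub)
  qed
  then show "x = y" by simp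
qed

lemma Jc_image: "Jc w E ` E = E"
proof (rule subspace_dim_equal)
  show "subspace (Jc w E ` E)" using linear_Jc E by (rule linear_subspace_image)
  show "Jc w E ` E \<subseteq> E" using Jc by blast
  show "dim E \<le> dim (Jc w E ` E)"
    using dim_image_eq[OF linear_Jc, of E] Jc_inj E by (simp add: span_eq_iff[THEN iffD2])
qed (rule E)

text \<open>From here on the inverse is used through membership in \<open>E\<close> and this
  duality. Linearity has to come first, since \<open>matrix\<close> represents a map only if it is
  linear.\<close>

lemma form_inv_in: "form_inv w E P *v v \<in> E"
  and form_inv_w: "u \<in> E \<Longrightarrow> w u (form_inv w E P *v v) = u \<bullet> (P *v v)"
proof -
  let ?f = "\<lambda>v. the_inv_into E (Jc w E) (P *v v)"
  have f: "?f v \<in> E" "Jc w E (?f v) = P *v v" for v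
    using the_inv_into_into[OF Jc_inj, of "P *v v" E] f_the_inv_into_f[OF Jc_inj, of "P *v v"]
    by (auto simp: Jc_image P_in)
  have uniq: "x = y" if "x \<in> E" "y \<in> E" "Jc w E x = Jc w E y" for x y
    using that Jc_inj by (meson inj_onD)
  have "linear ?f"
  proof (rule linearI)
    show "?f (x + y) = ?f x + ?f y" for x y
      by (rule uniq)
        (use f linear_add[OF linear_Jc] in \<open>simp_all only: subspace_add[OF E] matrix_vector_right_distrib[symmetric]\<close>)
    show "?f (c *\<^sub>R x) = c *\<^sub>R ?f x" for c x
      by (rule uniq)
        (use f linear_cmul[OF linear_Jc] in \<open>simp_all only: subspace_mul[OF E] matrix_vector_mult_scaleR[symmetric]\<close>)
  qed
  then have eq: "form_inv w E P *v v = ?f v" for v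
    by (simp add: form_inv_def)
  show "form_inv w E P *v v \<in> E" by (simp add: eq f)
  show "w u (form_inv w E P *v v) = u \<bullet> (P *v v)" if "u \<in> E"
    using Jc(2)[OF that, of "form_inv w E P *v v"] by (simp add: eq f)
qed

definition form_matrix :: "real^'m^'m" where
  "form_matrix = (\<chi> i j. w (axis i 1) (axis j 1))"

lemma form_matrix: "u \<bullet> (form_matrix *v v) = w u v"
proof -
  have "w u v = w (\<Sum>i\<in>UNIV. u $ i *\<^sub>R axis i 1) (\<Sum>j\<in>UNIV. v $ j *\<^sub>R axis j 1)"
    using basis_expansion[of u] basis_expansion[of v] by (simp add: scalar_mult_eq_scaleR)
  also have "\<dots> = (\<Sum>(i, j)\<in>UNIV \<times> UNIV. w (u $ i *\<^sub>R axis i 1) (v $ j *\<^sub>R axis j 1))"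
    using w by (rule bilinear_sum)
  also have "\<dots> = (\<Sum>i\<in>UNIV. \<Sum>j\<in>UNIV. u $ i * v $ j * w (axis i 1) (axis j 1))"
    using w by (simp add: sum.cartesian_product bilinear_lmul bilinear_rmul mult.assoc)
  also have "\<dots> = u \<bullet> (form_matrix *v v)"
    by (simp add: inner_vec_def form_matrix_def matrix_vector_mult_def sum_distrib_left ac_simps)
  finally show ?thesis by simp
qed

text \<open>The form on \<open>E\<close> is completed by the Euclidean product on the kernel of
  \<open>P\<close>, which makes the matrix invertible on the whole space. So \<open>form_inv\<close>
  becomes an expression in \<open>P\<close> and the form with a genuine matrix inverse, and its
  continuity in \<theta> becomes visible.\<close>

definition form_system :: "real^'m^'m" where
  "form_system = transpose P ** form_matrix ** P + transpose (mat 1 - P) ** (mat 1 - P)"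


lemma form_system_inner:
  "u \<bullet> (form_system *v x) = w (P *v u) (P *v x) + (u - P *v u) \<bullet> (x - P *v x)"
  by (simp add: form_system_def matrix_vector_mult_add_rdistrib inner_add_right inner_transpose
      form_matrix matrix_vector_mult_diff_rdistrib flip: matrix_vector_mul_assoc)

text \<open>Testing a kernel vector against \<open>E\<close> kills the Euclidean part and gives
  \<open>P *v x = 0\<close> by nondegeneracy; testing it against itself then gives
  \<open>x = 0\<close>.\<close>

lemma invertible_form_system: "invertible form_system"
proof -
  have "x = 0" if "form_system *v x = 0" for x
  proof -
    have 0: "w (P *v u) (P *v x) + (u - P *v u) \<bullet> (x - P *v x) = 0" for u
      using form_system_inner[of u x] that by simp
    have "P *v x = 0"
    proof (rule nondeg)
      show "w u (P *v x) = 0" if "u \<in> E" for u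
        using 0[of u] P_id[OF that] by simp
    qed (rule P_in)
    then have "x \<bullet> x = 0" using 0[of x] w by (simp add: bilinear_rzero)
    then show ?thesis by simp
  qed
  then show ?thesis
    using invertible_left_inverse matrix_left_invertible_ker by blast
qed

lemma form_inv_eq: "form_inv w E P = matrix_inv form_system ** transpose P ** P"
proof (rule matrix_eq[THEN iffD2], rule allI)
  fix v
  have "form_system *v (form_inv w E P *v v) = transpose P *v (P *v v)"
  proof (rule vector_eq_rdot[THEN iffD1], rule allI)
    fix u
    have "u \<bullet> (form_system *v (form_inv w E P *v v)) = u \<bullet> (transpose P *v (P *v v))"
      using form_inv_in[of v] P_in[of u]
      by (simp add: form_system_inner P_id form_inv_w inner_transpose)
    then show "(form_system *v (form_inv w E P *v v)) \<bullet> u = (transpose P *v (P *v v)) \<bullet> u"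
      by (simp add: inner_commute)
  qed
  then have "matrix_inv form_system *v (form_system *v (form_inv w E P *v v))
      = matrix_inv form_system *v (transpose P *v (P *v v))" by simp
  moreover have "matrix_inv form_system *v (form_system *v x) = x" for x
    using matrix_inv_left_right(2)[OF invertible_form_system] by (simp add: matrix_vector_mul_assoc)
  ultimately show "form_inv w E P *v v = (matrix_inv form_system ** transpose P ** P) *v v"
    by (simp flip: matrix_vector_mul_assoc)
qed

end

text \<open>\<open>L\<close> stands for \<open>DK\<close>: its range is isotropic and has half the
  dimension of \<open>E\<close>, so it is Lagrangian there.\<close>

locale symplectic_frame = nondeg_subspace w E P
  for w :: "real^'m \<Rightarrow> real^'m \<Rightarrow> real" and E P +
  fixes L :: "real^'d^'m"
  assumes L_in: "\<And>u. L *v u \<in> E" and L_gram: "invertible (transpose L ** L)"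
    and isotropic: "\<And>u v. w (L *v u) (L *v v) = 0" and dim_E: "dim E = 2 * CARD('d)"
begin

abbreviation "gram_inv \<equiv> matrix_inv (transpose L ** L)"

lemma gram_inv: "transpose L *v (L *v (gram_inv *v v)) = v"
  using matrix_inv_left_right(1)[OF L_gram] by (simp add: matrix_vector_mul_assoc matrix_mul_assoc)

lemma L_inj: "L *v u = 0 \<Longrightarrow> u = 0"
proof -
  assume "L *v u = 0"
  then have "gram_inv *v (transpose L *v (L *v u)) = 0" by simp
  then show "u = 0"
    using matrix_inv_left_right(2)[OF L_gram] by (simp add: matrix_vector_mul_assoc)
qed

lemma w_dual: "w (L *v u) (form_inv w E P *v (L *v (gram_inv *v v))) = u \<bullet> v"
  using inner_transpose[of u L "L *v (gram_inv *v v)"] by (simp add: form_inv_w L_in P_id gram_inv)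

text \<open>Isotropy removes the first block, so pairing with the range of \<open>L\<close> reads
  off the second half of the coordinates. Injectivity of the frame and the second block row of the
  reduced cocycle both come from this.\<close>

lemma w_frame: "w (L *v u) (frame w E P L *v x) = u \<bullet> inr_part x"
  using w by (simp add: frame_mult bilinear_radd isotropic w_dual)

lemma frame_in: "frame w E P L *v x \<in> E"
  using E by (simp add: frame_mult subspace_add L_in form_inv_in)

lemma frame_ker: "frame w E P L *v x = 0 \<Longrightarrow> x = 0"
proof -
  assume *: "frame w E P L *v x = 0"
  then have "inr_part x \<bullet> inr_part x = 0"
    using w_frame[of "inr_part x" x] w by (simp add: bilinear_rzero)
  then have "inr_part x = 0" by simp
  moreover from this * have "inl_part x = 0" by (simp add: frame_mult L_inj)
  ultimately have "x = join_parts 0 0"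
    using join_parts_simps(3)[of x] by simp
  then show "x = 0" by (simp add: join_parts_def vec_eq_iff split: sum.splits)
qed

lemma frame_inj: "inj (\<lambda>x. frame w E P L *v x)"
proof (rule injI)
  fix x y assume "frame w E P L *v x = frame w E P L *v y"
  then have "frame w E P L *v (x - y) = 0" by (simp add: algebra_simps)
  from frame_ker[OF this] show "x = y" by simp
qed

lemma frame_range: "range (\<lambda>x. frame w E P L *v x) = E"
proof (rule subspace_dim_equal)
  show "subspace (range (\<lambda>x. frame w E P L *v x))"
    by (intro linear_subspace_image matrix_vector_mul_linear subspace_UNIV)
  show "range (\<lambda>x. frame w E P L *v x) \<subseteq> E" using frame_in by blast
  have "dim (range (\<lambda>x. frame w E P L *v x)) = dim (UNIV :: (real^('d+'d)) set)"
    using frame_inj by (intro dim_image_eq matrix_vector_mul_linear) simp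
  then show "dim E \<le> dim (range (\<lambda>x. frame w E P L *v x))"
    using dim_E by (simp add: dim_UNIV)
qed (rule E)

lemma frame_frame_inv: "frame w E P L *v (frame_inv w E P L *v v) = P *v v"
  and frame_inv_frame: "frame_inv w E P L *v (frame w E P L *v x) = x"
proof -
  let ?f = "\<lambda>v. the_inv_into UNIV (\<lambda>x. frame w E P L *v x) (P *v v)"
  have f: "frame w E P L *v (?f v) = P *v v" for v
    by (rule f_the_inv_into_f[OF frame_inj]) (simp add: frame_range P_in)
  have "linear ?f"
  proof (rule linearI)
    show "?f (x + y) = ?f x + ?f y" for x y
    proof (rule injD[OF frame_inj])
      have "frame w E P L *v ?f (x + y) = P *v x + P *v y"
        unfolding f by (rule matrix_vector_right_distrib)
      also have "\<dots> = frame w E P L *v (?f x + ?f y)"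
        by (simp only: f matrix_vector_right_distrib)
      finally show "frame w E P L *v ?f (x + y) = frame w E P L *v (?f x + ?f y)" .
    qed
    show "?f (c *\<^sub>R x) = c *\<^sub>R ?f x" for c x
    proof (rule injD[OF frame_inj])
      have "frame w E P L *v ?f (c *\<^sub>R x) = c *\<^sub>R (P *v x)"
        unfolding f by (rule matrix_vector_mult_scaleR)
      also have "\<dots> = frame w E P L *v (c *\<^sub>R ?f x)"
        by (simp only: f matrix_vector_mult_scaleR)
      finally show "frame w E P L *v ?f (c *\<^sub>R x) = frame w E P L *v (c *\<^sub>R ?f x)" .
    qed
  qed
  then have eq: "frame_inv w E P L *v v = ?f v" for v
    by (simp add: frame_inv_def)
  show "frame w E P L *v (frame_inv w E P L *v v) = P *v v" by (simp add: eq f)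
  show "frame_inv w E P L *v (frame w E P L *v x) = x"
    using the_inv_into_f_f[OF frame_inj, of x] by (simp add: eq P_id frame_in)
qed

lemma frame_inv_P: "frame_inv w E P L *v (P *v v) = frame_inv w E P L *v v"
  by (rule injD[OF frame_inj]) (simp add: frame_frame_inv P_id P_in)

lemma frame_join_0: "frame w E P L *v (join_parts u 0) = L *v u"
  by (simp add: frame_mult)

lemma frame_inv_L: "frame_inv w E P L *v (L *v u) = join_parts u 0"
  using frame_inv_frame[of "join_parts u 0"] by (simp add: frame_join_0)

lemma invertible_frame_gram: "invertible (transpose (frame w E P L) ** frame w E P L)"
proof -
  have "x = 0" if "(transpose (frame w E P L) ** frame w E P L) *v x = 0" for x
  proof -
    have "x \<bullet> ((transpose (frame w E P L) ** frame w E P L) *v x) = 0" using that by simp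
    then have "frame w E P L *v x = 0"
      by (simp add: inner_transpose flip: matrix_vector_mul_assoc)
    then show ?thesis by (rule frame_ker)
  qed
  then show ?thesis
    using invertible_left_inverse matrix_left_invertible_ker by blast
qed

text \<open>The left inverse of an injective matrix, written with its Gram matrix. As for
  \<open>form_inv\<close>, the purpose is continuity: the definition by \<open>the_inv_into\<close>
  does not show how the inverse depends on \<theta>.\<close>

lemma frame_inv_eq:
  "frame_inv w E P L =
     matrix_inv (transpose (frame w E P L) ** frame w E P L) ** transpose (frame w E P L) ** P"
proof (rule matrix_eq[THEN iffD2], rule allI)
  fix v
  have *: "matrix_inv (transpose (frame w E P L) ** frame w E P L) *v
      (transpose (frame w E P L) *v (frame w E P L *v (frame_inv w E P L *v v)))
    = frame_inv w E P L *v v"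
    using matrix_inv_left_right(2)[OF invertible_frame_gram]
    by (simp add: matrix_vector_mul_assoc) (simp add: matrix_mul_assoc)?
  then show "frame_inv w E P L *v v = (matrix_inv (transpose (frame w E P L) ** frame w E P L) **
      transpose (frame w E P L) ** P) *v v"
    by (simp add: frame_frame_inv flip: matrix_vector_mul_assoc)
qed

end

lemma transpose_gram_inv:
  fixes L :: "real^'d^'m"
  assumes "invertible (transpose L ** L)"
  shows "transpose (matrix_inv (transpose L ** L)) = matrix_inv (transpose L ** L)" (is "transpose ?N = ?N")
proof -
  let ?G = "transpose L ** L"
  have G: "transpose ?G = ?G" by (simp add: matrix_transpose_mul transpose_transpose)
  have "?G ** transpose ?N = mat 1"
    using matrix_inv_left_right(2)[OF assms] G by (metis matrix_transpose_mul transpose_mat)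
  then have "?N ** (?G ** transpose ?N) = ?N" by simp
  then show ?thesis
    using matrix_inv_left_right(2)[OF assms] by (simp add: matrix_mul_assoc)
qed

text \<open>The duality \<open>w (L u) (J\<inverse> L N v) = u \<bullet> v\<close> gives the second block row, and applying
  \<open>(L' N')\<^sup>T\<close> then yields the corner.\<close>

lemma frame_reducibility:
  fixes A :: "real^'m^'m" and L L' :: "real^'d^'m"
  assumes "symplectic_frame w E P L" and "symplectic_frame w' E' P' L'"
    and AE: "\<And>v. v \<in> E \<Longrightarrow> A *v v \<in> E'"
    and conf: "\<And>u v. w' (A *v u) (A *v v) = lam * w u v"
    and AL: "\<And>u. A *v (L *v u) = L' *v u"
  shows "frame_inv w' E' P' L' *v (A *v (frame w E P L *v x)) =
    join_parts (inl_part x +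
      (transpose (L' ** matrix_inv (transpose L' ** L')) ** A ** form_inv w E P **
         (L ** matrix_inv (transpose L ** L))
       - lam *\<^sub>R (transpose (matrix_inv (transpose L' ** L')) **
         (transpose L' ** form_inv w' E' P' ** L') ** matrix_inv (transpose L' ** L'))) *v inr_part x)
      (lam *\<^sub>R inr_part x)"
proof -
  interpret F: symplectic_frame w E P L by fact
  interpret F': symplectic_frame w' E' P' L' by fact
  let ?N = "matrix_inv (transpose L ** L)" and ?N' = "matrix_inv (transpose L' ** L')"
  let ?J = "form_inv w E P" and ?J' = "form_inv w' E' P'"
  let ?S = "transpose (L' ** ?N') ** A ** ?J ** (L ** ?N)
       - lam *\<^sub>R (transpose ?N' ** (transpose L' ** ?J' ** L') ** ?N')"
  define b where "b = inr_part x"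
  define v where "v = A *v (?J *v (L *v (?N *v b)))"
  have "v \<in> E'" by (simp add: v_def AE F.form_inv_in)
  then obtain y where y: "v = frame w' E' P' L' *v y" using F'.frame_range by blast
  have "w' (L' *v u) v = lam * (u \<bullet> b)" for u
    using conf[of "L *v u" "?J *v (L *v (?N *v b))"] by (simp add: v_def AL F.w_dual)
  then have "u \<bullet> inr_part y = u \<bullet> (lam *\<^sub>R b)" for u by (simp add: y F'.w_frame)
  then have y2: "inr_part y = lam *\<^sub>R b" using vector_eq_ldot by blast
  \<comment> \<open>Symmetry of the inverse Gram matrix makes the transpose of
    \<open>L' ** ?N'\<close> a left inverse of \<open>L'\<close>.\<close>
  have NL: "transpose (L' ** ?N') *v (L' *v u) = u" for u
    using matrix_inv_left_right(2)[OF F'.L_gram] transpose_gram_inv[OF F'.L_gram]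
    by (simp add: matrix_transpose_mul matrix_vector_mul_assoc matrix_mul_assoc)
  have "transpose (L' ** ?N') *v v = inl_part y +
      lam *\<^sub>R (transpose (L' ** ?N') *v (?J' *v (L' *v (?N' *v b))))"
    by (simp add: y frame_mult y2 NL matrix_vector_right_distrib matrix_vector_mult_scaleR)
  then have y1: "inl_part y = ?S *v b"
    by (simp add: v_def matrix_transpose_mul matrix_vector_mul_assoc matrix_mul_assoc
        matrix_vector_mult_diff_rdistrib scaleR_matrix_vector_assoc[symmetric] algebra_simps)
  have "A *v (frame w E P L *v x) = frame w' E' P' L' *v (join_parts (inl_part x) 0 + y)"
    by (simp add: frame_mult[of w E] matrix_vector_right_distrib AL F'.frame_join_0
        flip: b_def v_def y)
  moreover have "join_parts (inl_part x) 0 + y = join_parts (inl_part x + ?S *v b) (lam *\<^sub>R b)"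
    using join_parts_simps(3)[of y, unfolded y1 y2]
    by (metis (no_types, lifting) add.right_neutral inl_part_def inr_part_def join_parts_simps
        vec_lambda_beta vector_add_component add_0 vec_eq_iff)
  ultimately show ?thesis by (simp add: F'.frame_inv_frame b_def)
qed

section \<open>Quantities bounded by geometric sequences\<close>

lemma geometric_null:
  fixes a :: real
  assumes "\<And>j::nat. a \<le> C * q ^ j + C' * q' ^ j + C'' * q'' ^ j"
    and "0 \<le> q" "q < 1" "0 \<le> q'" "q' < 1" "0 \<le> q''" "q'' < 1"
  shows "a \<le> 0"
proof (rule LIMSEQ_le_const)
  show "(\<lambda>j. C * q ^ j + C' * q' ^ j + C'' * q'' ^ j) \<longlonglongrightarrow> 0"
    using assms(2-) by (auto intro!: tendsto_eq_intros LIMSEQ_power_zero)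
qed (use assms(1) in blast)

lemma geometric_null1:
  fixes a :: real
  assumes "\<And>j::nat. a \<le> C * q ^ j" "0 \<le> q" "q < 1"
  shows "a \<le> 0"
  using geometric_null[of a C q 0 0 0 0] assms by simp

text \<open>The bound \<open>X\<close> only has to exist: it multiplies a power tending to 0 and
  does not enter the conclusion. This turns mere boundedness of a solution into an estimate by its
  forcing term.\<close>

lemma geometric_telescope:
  fixes z :: "nat \<Rightarrow> 'a::real_normed_vector"
  assumes z: "\<And>j. norm (z j) \<le> X * q ^ j" and d: "\<And>j. norm (z j - z (Suc j)) \<le> D * q ^ j"
    and q: "0 \<le> q" "q < 1"
  shows "norm (z 0) \<le> D / (1 - q)"
proof -
  have "D \<ge> 0" using order_trans[OF norm_ge_zero d[of 0]] by simp
  have sum: "(\<Sum>i<j. D * q ^ i) \<le> D / (1 - q)" for j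
  proof -
    have "(\<Sum>i<j. D * q ^ i) = D * ((1 - q ^ j) / (1 - q))"
      using q by (simp add: sum_gp_strict flip: sum_distrib_left)
    also have "\<dots> \<le> D * (1 / (1 - q))"
      using q \<open>D \<ge> 0\<close> by (intro mult_left_mono divide_right_mono) auto
    finally show ?thesis by simp
  qed
  have "norm (z 0) - D / (1 - q) \<le> X * q ^ j" for j
  proof -
    have "z 0 = z j + (\<Sum>i<j. z i - z (Suc i))" by (induction j) auto
    then have "norm (z 0) = norm (z j + (\<Sum>i<j. z i - z (Suc i)))" by (rule arg_cong)
    also have "\<dots> \<le> norm (z j) + (\<Sum>i<j. norm (z i - z (Suc i)))"
      by (rule order_trans[OF norm_triangle_ineq add_left_mono[OF norm_sum]])
    also have "\<dots> \<le> X * q ^ j + (\<Sum>i<j. D * q ^ i)"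
      by (intro add_mono z sum_mono d)
    also have "\<dots> \<le> X * q ^ j + D / (1 - q)" using sum by simp
    finally show ?thesis by simp
  qed
  from geometric_null1[OF this q] show ?thesis by simp
qed

subsection \<open>Invariant splittings of a cocycle\<close>

lemma invertible_mat_1: "invertible (mat 1 :: real^'m^'m)"
  unfolding invertible_def by (rule exI[of _ "mat 1"]) simp

text \<open>The definition adds the last factor of the product; iteration from preimages needs the
  first one split off.\<close>

lemma cocycle_nat_Suc2:
  "cocycle_nat \<gamma> \<omega> (Suc j) \<theta> = cocycle_nat \<gamma> \<omega> j (\<theta> + \<omega>) ** \<gamma> \<theta>"
proof (induction j)
  case (Suc j)
  have "\<theta> + real (Suc j) *\<^sub>R \<omega> = \<theta> + \<omega> + real j *\<^sub>R \<omega>"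
    by (simp add: algebra_simps)
  then have "cocycle_nat \<gamma> \<omega> (Suc (Suc j)) \<theta> = \<gamma> (\<theta> + \<omega> + real j *\<^sub>R \<omega>) ** cocycle_nat \<gamma> \<omega> (Suc j) \<theta>"
    by (simp only: cocycle_nat.simps(2)[of \<gamma> \<omega> "Suc j"])
  then show ?case
    unfolding Suc cocycle_nat.simps(2)[of \<gamma> \<omega> j "\<theta> + \<omega>"] by (simp only: matrix_mul_assoc)
qed simp

locale split_cocycle =
  fixes \<gamma> :: "real^'d \<Rightarrow> real^'m^'m" and \<omega> :: "real^'d" and lam :: real
    and Es Ec Eu :: "real^'d \<Rightarrow> (real^'m) set" and Ps Pc Pu :: "real^'d \<Rightarrow> real^'m^'m"
  assumes inv: "\<And>\<theta>. invertible (\<gamma> \<theta>)"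
    and split: "\<And>\<theta>. splitting_at (Es \<theta>) (Ec \<theta>) (Eu \<theta>) (Ps \<theta>) (Pc \<theta>) (Pu \<theta>)"
    and invar: "\<And>E \<theta>. E \<in> {Es, Ec, Eu} \<Longrightarrow> (\<lambda>v. \<gamma> \<theta> *v v) ` E \<theta> = E (\<theta> + \<omega>)"
    and trich: "trichotomy lam \<omega> \<gamma> Es Ec Eu"
    and lam: "0 < lam" "lam < 1"
begin

abbreviation "G j \<theta> \<equiv> cocycle_nat \<gamma> \<omega> j \<theta>"

lemma G_inv: "invertible (G j \<theta>)"
  by (induction j arbitrary: \<theta>) (auto simp: invertible_mat_1 intro!: invertible_mult inv)

lemma G_inv_cancel: "matrix_inv (G j \<theta>) *v (G j \<theta> *v v) = v" "G j \<theta> *v (matrix_inv (G j \<theta>) *v v) = v"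
  using matrix_inv_left_right[OF G_inv, of j \<theta>] by (simp_all add: matrix_vector_mul_assoc)

lemma G_invar: "E \<in> {Es, Ec, Eu} \<Longrightarrow> (\<lambda>v. G j \<theta> *v v) ` E \<theta> = E (\<theta> + real j *\<^sub>R \<omega>)"
proof (induction j)
  case (Suc j)
  have "(\<lambda>v. G (Suc j) \<theta> *v v) ` E \<theta> = (\<lambda>v. \<gamma> (\<theta> + real j *\<^sub>R \<omega>) *v v) ` (\<lambda>v. G j \<theta> *v v) ` E \<theta>"
    by (simp add: image_image matrix_vector_mul_assoc)
  also have "\<dots> = E (\<theta> + real j *\<^sub>R \<omega> + \<omega>)"
    using Suc invar by simp
  finally show ?case by (simp add: algebra_simps)
qed simp

lemma G_in: "E \<in> {Es, Ec, Eu} \<Longrightarrow> v \<in> E \<theta> \<Longrightarrow> G j \<theta> *v v \<in> E (\<theta> + real j *\<^sub>R \<omega>)"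
  using G_invar by blast

lemma G_inv_in: "E \<in> {Es, Ec, Eu} \<Longrightarrow> v \<in> E (\<theta> + real j *\<^sub>R \<omega>) \<Longrightarrow> matrix_inv (G j \<theta>) *v v \<in> E \<theta>"
  using G_invar[of E j \<theta>] G_inv_cancel(1)[of j \<theta>] by (metis (no_types, lifting) imageE)

lemma splitD:
  "subspace (Es \<theta>)" "subspace (Ec \<theta>)" "subspace (Eu \<theta>)"
  "Ps \<theta> *v v \<in> Es \<theta>" "Pc \<theta> *v v \<in> Ec \<theta>" "Pu \<theta> *v v \<in> Eu \<theta>"
  "Ps \<theta> *v v + Pc \<theta> *v v + Pu \<theta> *v v = v"
  "v \<in> Es \<theta> \<Longrightarrow> Ps \<theta> *v v = v" "v \<in> Es \<theta> \<Longrightarrow> Pc \<theta> *v v = 0" "v \<in> Es \<theta> \<Longrightarrow> Pu \<theta> *v v = 0"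
  "v \<in> Ec \<theta> \<Longrightarrow> Ps \<theta> *v v = 0" "v \<in> Ec \<theta> \<Longrightarrow> Pc \<theta> *v v = v" "v \<in> Ec \<theta> \<Longrightarrow> Pu \<theta> *v v = 0"
  "v \<in> Eu \<theta> \<Longrightarrow> Ps \<theta> *v v = 0" "v \<in> Eu \<theta> \<Longrightarrow> Pc \<theta> *v v = 0" "v \<in> Eu \<theta> \<Longrightarrow> Pu \<theta> *v v = v"
  using split[of \<theta>] unfolding splitting_at_def by blast+

text \<open>Invariance places the images of the three components of \<open>v\<close> in the three
  spaces over \<theta> + \<omega>, where the decomposition is unique.\<close>

lemma projections_equivariant:
  "Ps (\<theta> + \<omega>) *v (\<gamma> \<theta> *v v) = \<gamma> \<theta> *v (Ps \<theta> *v v)"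
  "Pc (\<theta> + \<omega>) *v (\<gamma> \<theta> *v v) = \<gamma> \<theta> *v (Pc \<theta> *v v)"
  "Pu (\<theta> + \<omega>) *v (\<gamma> \<theta> *v v) = \<gamma> \<theta> *v (Pu \<theta> *v v)"
proof -
  have in': "\<gamma> \<theta> *v (Ps \<theta> *v v) \<in> Es (\<theta> + \<omega>)" "\<gamma> \<theta> *v (Pc \<theta> *v v) \<in> Ec (\<theta> + \<omega>)"
    "\<gamma> \<theta> *v (Pu \<theta> *v v) \<in> Eu (\<theta> + \<omega>)"
    using invar[of Es \<theta>] invar[of Ec \<theta>] invar[of Eu \<theta>] splitD(4-6)[of \<theta> v] by auto
  have v: "\<gamma> \<theta> *v v = \<gamma> \<theta> *v (Ps \<theta> *v v) + \<gamma> \<theta> *v (Pc \<theta> *v v) + \<gamma> \<theta> *v (Pu \<theta> *v v)"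
    by (simp add: splitD(7) flip: matrix_vector_right_distrib)
  show "Ps (\<theta> + \<omega>) *v (\<gamma> \<theta> *v v) = \<gamma> \<theta> *v (Ps \<theta> *v v)"
    "Pc (\<theta> + \<omega>) *v (\<gamma> \<theta> *v v) = \<gamma> \<theta> *v (Pc \<theta> *v v)"
    "Pu (\<theta> + \<omega>) *v (\<gamma> \<theta> *v v) = \<gamma> \<theta> *v (Pu \<theta> *v v)"
    by (subst v, simp only: matrix_vector_right_distrib splitD(8-10)[OF in'(1)]
        splitD(11-13)[OF in'(2)] splitD(14-16)[OF in'(3)] add_0 add_0_right)+
qed

text \<open>The stable rate of the trichotomy may be nonpositive (then the stable space is trivial); it is
  replaced here by a positive one.\<close>

lemma rates:
  obtains C lm lp cm cp where "C > 0" "0 < lm" "lm < 1" "1 < lp" "lm < lam / lp" "lam / lp < cm"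
    "cm \<le> lam" "lam \<le> cp" "cp < lp"
    "\<forall>\<theta> v j. v \<in> Es \<theta> \<longrightarrow> norm (G j \<theta> *v v) \<le> C * lm ^ j * norm v"
    "\<forall>\<theta> v j. v \<in> Eu (\<theta> + real j *\<^sub>R \<omega>) \<longrightarrow> norm (matrix_inv (G j \<theta>) *v v) \<le> C * (1 / lp) ^ j * norm v"
    "\<forall>\<theta> v j. v \<in> Ec \<theta> \<longrightarrow> norm (G j \<theta> *v v) \<le> C * cp ^ j * norm v"
    "\<forall>\<theta> v j. v \<in> Ec (\<theta> + real j *\<^sub>R \<omega>) \<longrightarrow> norm (matrix_inv (G j \<theta>) *v v) \<le> C * (1 / cm) ^ j * norm v"
proof -
  obtain C lm cm cp lp :: real where t: "C > 0 \<and> lm < cm \<and> cm \<le> cp \<and> cp < lp \<and> lm < 1 \<and> 1 < lp \<and>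
        lm < lam * inverse lp \<and> lam * inverse lp < cm \<and> cm \<le> lam \<and> lam \<le> cp \<and>
        (\<forall>\<theta> v.
           (v \<in> Es \<theta> \<longleftrightarrow>
              (\<forall>j\<ge>0. norm (cocycle \<gamma> \<omega> j \<theta> *v v) \<le> C * lm powi j * norm v)) \<and>
           (v \<in> Eu \<theta> \<longleftrightarrow>
              (\<forall>j\<le>0. norm (cocycle \<gamma> \<omega> j \<theta> *v v) \<le> C * lp powi j * norm v)) \<and>
           (v \<in> Ec \<theta> \<longleftrightarrow>
              (\<forall>j\<ge>0. norm (cocycle \<gamma> \<omega> j \<theta> *v v) \<le> C * cp powi j * norm v) \<and>
              (\<forall>j\<le>0. norm (cocycle \<gamma> \<omega> j \<theta> *v v) \<le> C * cm powi j * norm v)))"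
    using trich unfolding trichotomy_def by (elim exE) (rule that)
  define T where "T = (\<forall>\<theta> v.
           (v \<in> Es \<theta> \<longleftrightarrow>
              (\<forall>j\<ge>0. norm (cocycle \<gamma> \<omega> j \<theta> *v v) \<le> C * lm powi j * norm v)) \<and>
           (v \<in> Eu \<theta> \<longleftrightarrow>
              (\<forall>j\<le>0. norm (cocycle \<gamma> \<omega> j \<theta> *v v) \<le> C * lp powi j * norm v)) \<and>
           (v \<in> Ec \<theta> \<longleftrightarrow>
              (\<forall>j\<ge>0. norm (cocycle \<gamma> \<omega> j \<theta> *v v) \<le> C * cp powi j * norm v) \<and>
              (\<forall>j\<le>0. norm (cocycle \<gamma> \<omega> j \<theta> *v v) \<le> C * cm powi j * norm v)))"
  have t': "C > 0 \<and> lm < cm \<and> cm \<le> cp \<and> cp < lp \<and> lm < 1 \<and> 1 < lp \<and> lm < lam * inverse lp \<and> lam * inverse lp < cm \<and> cm \<le> lam \<and> lam \<le> cp \<and> T"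
    using t unfolding T_def .
  have c: "C > 0" "lm < cm" "cm \<le> cp" "cp < lp" "lm < 1" "1 < lp" "lm < lam * inverse lp" "lam * inverse lp < cm" "cm \<le> lam" "lam \<le> cp"
    using t' by simp_all
  have T using t' by simp
  note all = this[unfolded T_def]
  note s = all[THEN spec, THEN spec, THEN conjunct1]
    and u = all[THEN spec, THEN spec, THEN conjunct2, THEN conjunct1]
    and cc = all[THEN spec, THEN spec, THEN conjunct2, THEN conjunct2]
  have pos: "cocycle \<gamma> \<omega> (int j) \<theta> = G j \<theta>" for j \<theta> by (simp add: cocycle_def)
  have neg: "cocycle \<gamma> \<omega> (- int j) (\<theta> + real j *\<^sub>R \<omega>) = matrix_inv (G j \<theta>)" for j \<theta>
  proof (cases "j = 0")
    case True
    have "matrix_inv (mat 1 :: real^'m^'m) = mat 1"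
      using matrix_inv_left_right(1)[OF invertible_mat_1] by simp
    with True show ?thesis by (simp add: cocycle_def)
  qed (simp add: cocycle_def)
  have s': "norm (G j \<theta> *v v) \<le> C * lm ^ j * norm v" if "v \<in> Es \<theta>" for \<theta> v j
  proof -
    have "norm (cocycle \<gamma> \<omega> (int j) \<theta> *v v) \<le> C * lm powi (int j) * norm v"
      using that unfolding s by (auto dest: spec[of _ "int j"] simp del: power_int_of_nat)
    then show ?thesis unfolding pos by simp
  qed
  have lp: "0 < lam / lp" using c lam by simp
  have lp1: "lam / lp < 1" using c lam by simp
  \<comment> \<open>A positive number below the threshold, so that \<open>max lm h\<close> is
    positive and still satisfies the gap condition.\<close>
  obtain h where h: "0 < h" "h < lam / lp" using dense[OF lp] by blast
  define lm' where "lm' = max lm h"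
  show ?thesis
  proof (rule that[of C lm' lp cm cp])
    have "norm (G j \<theta> *v v) \<le> C * lm' ^ j * norm v" if v: "v \<in> Es \<theta>" for \<theta> v j
    proof (cases "lm > 0")
      case True
      have "norm (G j \<theta> *v v) \<le> C * lm ^ j * norm v" by (rule s'[OF v])
      also have "\<dots> \<le> C * lm' ^ j * norm v"
        using True c(1) by (intro mult_right_mono mult_left_mono power_mono) (auto simp: lm'_def)
      finally show ?thesis .
    next
      case False
      \<comment> \<open>With a nonpositive rate one iterate already vanishes, and the cocycle is
        invertible.\<close>
      have "norm (G 1 \<theta> *v v) \<le> C * lm * norm v" using s'[OF v, of 1] by simp
      also have "\<dots> \<le> 0" using False c(1) by (simp add: mult_nonneg_nonpos mult_nonpos_nonneg)
      finally have "G 1 \<theta> *v v = 0" by simp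
      then have "v = 0" using G_inv_cancel(1)[of 1 \<theta> v] by (simp del: cocycle_nat.simps)
      then show ?thesis by simp
    qed
    then show "\<forall>\<theta> v j. v \<in> Es \<theta> \<longrightarrow> norm (G j \<theta> *v v) \<le> C * lm' ^ j * norm v"
      by blast
    show "\<forall>\<theta> v j. v \<in> Eu (\<theta> + real j *\<^sub>R \<omega>) \<longrightarrow>
        norm (matrix_inv (G j \<theta>) *v v) \<le> C * (1 / lp) ^ j * norm v"
    proof (intro allI impI)
      fix \<theta> v j assume "v \<in> Eu (\<theta> + real j *\<^sub>R \<omega>)"
      then have "norm (cocycle \<gamma> \<omega> (- int j) (\<theta> + real j *\<^sub>R \<omega>) *v v) \<le> C * lp powi (- int j) * norm v"
        unfolding u by (rule allE[of _ "- int j"]) simp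
      then show "norm (matrix_inv (G j \<theta>) *v v) \<le> C * (1 / lp) ^ j * norm v"
        unfolding neg by (simp add: power_int_minus power_one_over inverse_eq_divide)
    qed
    show "\<forall>\<theta> v j. v \<in> Ec \<theta> \<longrightarrow> norm (G j \<theta> *v v) \<le> C * cp ^ j * norm v"
    proof (intro allI impI)
      fix \<theta> v j assume "v \<in> Ec \<theta>"
      then have "norm (cocycle \<gamma> \<omega> (int j) \<theta> *v v) \<le> C * cp powi (int j) * norm v"
        unfolding cc by (auto dest: spec[of _ "int j"] simp del: power_int_of_nat)
      then show "norm (G j \<theta> *v v) \<le> C * cp ^ j * norm v" unfolding pos by simp
    qed
    show "\<forall>\<theta> v j. v \<in> Ec (\<theta> + real j *\<^sub>R \<omega>) \<longrightarrow>
        norm (matrix_inv (G j \<theta>) *v v) \<le> C * (1 / cm) ^ j * norm v"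
    proof (intro allI impI)
      fix \<theta> v j assume "v \<in> Ec (\<theta> + real j *\<^sub>R \<omega>)"
      then have "norm (cocycle \<gamma> \<omega> (- int j) (\<theta> + real j *\<^sub>R \<omega>) *v v) \<le> C * cm powi (- int j) * norm v"
        unfolding cc by (auto dest: spec[of _ "- int j"] simp del: power_int_of_nat power_int_minus)
      then show "norm (matrix_inv (G j \<theta>) *v v) \<le> C * (1 / cm) ^ j * norm v"
        unfolding neg by (simp add: power_int_minus power_one_over inverse_eq_divide)
    qed
  qed (use c[unfolded divide_inverse[symmetric]] lp lam lp1 h in \<open>auto simp: lm'_def\<close>)
qed

text \<open>The trichotomy describes \<open>Ec\<close> by rates with a fixed constant, which a
  bounded orbit need not meet as it stands. Instead the other components are excluded. Forward
  iteration followed by the return along \<open>Eu\<close> leaves the rates \<open>1 / lp\<close>,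
  \<open>cp / lp\<close> and \<open>lm / lp\<close>; backward iteration followed by the return along
  \<open>Es\<close> leaves \<open>lm\<close>, \<open>lm / cm\<close> and \<open>lm / lp\<close>. All
  are below 1.\<close>

lemma bounded_orbit_in_center:
  assumes fwd: "\<And>j. norm (G j \<theta> *v v) \<le> X"
    and bwd: "\<And>j. norm (matrix_inv (G j (\<theta> - real j *\<^sub>R \<omega>)) *v v) \<le> X"
  shows "v \<in> Ec \<theta>"
proof -
  obtain C lm lp cm cp where r: "C > 0" "0 < lm" "lm < 1" "1 < lp" "lm < lam / lp" "lam / lp < cm"
      "cm \<le> lam" "lam \<le> cp" "cp < lp"
    and s0: "\<forall>\<theta> v j. v \<in> Es \<theta> \<longrightarrow> norm (G j \<theta> *v v) \<le> C * lm ^ j * norm v"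
    and u0: "\<forall>\<theta> v j. v \<in> Eu (\<theta> + real j *\<^sub>R \<omega>) \<longrightarrow> norm (matrix_inv (G j \<theta>) *v v) \<le> C * (1 / lp) ^ j * norm v"
    and cp0: "\<forall>\<theta> v j. v \<in> Ec \<theta> \<longrightarrow> norm (G j \<theta> *v v) \<le> C * cp ^ j * norm v"
    and cm0: "\<forall>\<theta> v j. v \<in> Ec (\<theta> + real j *\<^sub>R \<omega>) \<longrightarrow> norm (matrix_inv (G j \<theta>) *v v) \<le> C * (1 / cm) ^ j * norm v"
    by (rule rates)
  note s = s0[rule_format] and u = u0[rule_format] and cp = cp0[rule_format] and cm = cm0[rule_format]
  have cmlm: "0 < cm" "lm < cm" using r lam by (auto intro: order.strict_trans[of 0 "lam / lp" cm])
  define vs vc vu where "vs = Ps \<theta> *v v" and "vc = Pc \<theta> *v v" and "vu = Pu \<theta> *v v"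
  have mem: "vs \<in> Es \<theta>" "vc \<in> Ec \<theta>" "vu \<in> Eu \<theta>" and v: "v = vs + vc + vu"
    using splitD(4-7)[of \<theta> v] by (auto simp: vs_def vc_def vu_def)
  have "norm vu \<le> 0"
  proof (rule geometric_null)
    fix j
    let ?g = "\<lambda>x. G j \<theta> *v x"
    have "norm vu = norm (matrix_inv (G j \<theta>) *v ?g vu)" by (simp add: G_inv_cancel)
    also have "\<dots> \<le> C * (1 / lp) ^ j * norm (?g vu)"
      by (rule u) (use G_in[of Eu] mem in auto)
    also have "?g vu = ?g v - ?g vc - ?g vs" by (simp add: v matrix_vector_right_distrib)
    also have "C * (1 / lp) ^ j * norm (?g v - ?g vc - ?g vs)
        \<le> C * (1 / lp) ^ j * (X + C * cp ^ j * norm vc + C * lm ^ j * norm vs)"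
      using fwd[of j] cp[OF mem(2), of j] s[OF mem(1), of j] r
        norm_triangle_ineq4[of "?g v - ?g vc" "?g vs"] norm_triangle_ineq4[of "?g v" "?g vc"]
      by (intro mult_left_mono) auto
    also have "\<dots> = (C * X) * (1 / lp) ^ j + (C * C * norm vc) * (cp / lp) ^ j + (C * C * norm vs) * (lm / lp) ^ j"
      by (simp add: algebra_simps power_divide)
    finally show "norm vu \<le> \<dots>" .
  qed (use r lam less_trans[OF r(3,4)] in \<open>auto simp: field_simps\<close>)
  moreover have "norm vs \<le> 0"
  proof (rule geometric_null)
    fix j
    define \<theta>' where "\<theta>' = \<theta> - real j *\<^sub>R \<omega>"
    have \<theta>: "\<theta> = \<theta>' + real j *\<^sub>R \<omega>" by (simp add: \<theta>'_def)
    let ?g = "\<lambda>x. matrix_inv (G j \<theta>') *v x"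
    have "norm vs = norm (G j \<theta>' *v ?g vs)" by (simp add: G_inv_cancel)
    also have "\<dots> \<le> C * lm ^ j * norm (?g vs)"
      by (rule s) (use G_inv_in[of Es] mem \<theta> in auto)
    also have "?g vs = ?g v - ?g vc - ?g vu" by (simp add: v matrix_vector_right_distrib)
    also have "C * lm ^ j * norm (?g v - ?g vc - ?g vu)
        \<le> C * lm ^ j * (X + C * (1 / cm) ^ j * norm vc + C * (1 / lp) ^ j * norm vu)"
      using bwd[of j] cm[of vc \<theta>' j] u[of vu \<theta>' j] mem r
        norm_triangle_ineq4[of "?g v - ?g vc" "?g vu"] norm_triangle_ineq4[of "?g v" "?g vc"]
      by (intro mult_left_mono) (auto simp flip: \<theta>'_def \<theta>)
    also have "\<dots> = (C * X) * lm ^ j + (C * C * norm vc) * (lm / cm) ^ j + (C * C * norm vu) * (lm / lp) ^ j"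
      by (simp add: algebra_simps power_divide)
    finally show "norm vs \<le> \<dots>" .
  qed (use r lam cmlm less_trans[OF r(3,4)] in \<open>auto simp: field_simps\<close>)
  ultimately show ?thesis using mem v by simp
qed

text \<open>Pushing the values at preimages of \<theta> forward to \<theta> gives a telescoping sum
  of forcing terms. These are differences of stable vectors, hence stable, and decay under the
  cocycle.\<close>

lemma stable_estimate:
  "\<exists>C>0. \<forall>x g X D. (\<forall>\<theta>. x \<theta> \<in> Es \<theta>) \<longrightarrow> (\<forall>\<theta>. x (\<theta> + \<omega>) = \<gamma> \<theta> *v x \<theta> + g \<theta>) \<longrightarrow>
      (\<forall>\<theta>. norm (x \<theta>) \<le> X) \<longrightarrow> (\<forall>\<theta>. norm (g \<theta>) \<le> D) \<longrightarrow> (\<forall>\<theta>. norm (x \<theta>) \<le> C * D)"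
proof -
  obtain C lm lp cm cp where r: "C > 0" "0 < lm" "lm < 1" "1 < lp" "lm < lam / lp" "lam / lp < cm"
      "cm \<le> lam" "lam \<le> cp" "cp < lp"
    and s0: "\<forall>\<theta> v j. v \<in> Es \<theta> \<longrightarrow> norm (G j \<theta> *v v) \<le> C * lm ^ j * norm v"
    and u0: "\<forall>\<theta> v j. v \<in> Eu (\<theta> + real j *\<^sub>R \<omega>) \<longrightarrow> norm (matrix_inv (G j \<theta>) *v v) \<le> C * (1 / lp) ^ j * norm v"
    and cp0: "\<forall>\<theta> v j. v \<in> Ec \<theta> \<longrightarrow> norm (G j \<theta> *v v) \<le> C * cp ^ j * norm v"
    and cm0: "\<forall>\<theta> v j. v \<in> Ec (\<theta> + real j *\<^sub>R \<omega>) \<longrightarrow> norm (matrix_inv (G j \<theta>) *v v) \<le> C * (1 / cm) ^ j * norm v"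
    by (rule rates)
  note s = s0[rule_format] and u = u0[rule_format] and cp = cp0[rule_format] and cm = cm0[rule_format]
  show ?thesis
  proof (intro exI[of _ "C / (1 - lm)"] conjI allI impI)
    fix x g X D \<theta>
    assume hyps: "\<forall>\<theta>. x \<theta> \<in> Es \<theta>" "\<forall>\<theta>. x (\<theta> + \<omega>) = \<gamma> \<theta> *v x \<theta> + g \<theta>"
      "\<forall>\<theta>. norm (x \<theta>) \<le> X" "\<forall>\<theta>. norm (g \<theta>) \<le> D"
    note x = hyps(1)[rule_format] and rec = hyps(2)[rule_format]
      and X = hyps(3)[rule_format] and D = hyps(4)[rule_format]
    define p where "p = (\<lambda>j. \<theta> - real j *\<^sub>R \<omega>)"
    have p: "p j = p (Suc j) + \<omega>" for j by (simp add: p_def algebra_simps)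
    define z where "z = (\<lambda>j. G j (p j) *v x (p j))"
    have "norm (z 0) \<le> (C * D) / (1 - lm)"
    proof (rule geometric_telescope)
      show "norm (z j) \<le> (C * X) * lm ^ j" for j
      proof -
        have "norm (z j) \<le> C * lm ^ j * norm (x (p j))" unfolding z_def by (rule s[OF x])
        also have "\<dots> \<le> C * lm ^ j * X" using X r by (intro mult_left_mono) auto
        finally show ?thesis by (simp add: ac_simps)
      qed
      show "norm (z j - z (Suc j)) \<le> (C * D) * lm ^ j" for j
      proof -
        have g: "g (p (Suc j)) = x (p j) - \<gamma> (p (Suc j)) *v x (p (Suc j))"
          using rec[of "p (Suc j)"] p[of j] by simp
        have gin: "g (p (Suc j)) \<in> Es (p j)"
          unfolding g using invar[of Es "p (Suc j)"] x p[of j]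
          by (intro subspace_diff splitD(1) x) auto
        have "z j - z (Suc j) = G j (p j) *v g (p (Suc j))"
          unfolding z_def g cocycle_nat_Suc2 p[of j, symmetric]
          by (simp add: matrix_vector_mult_diff_distrib matrix_vector_mul_assoc)
        then have "norm (z j - z (Suc j)) \<le> C * lm ^ j * norm (g (p (Suc j)))"
          using s[OF gin] by simp
        also have "\<dots> \<le> C * lm ^ j * D" using D r by (intro mult_left_mono) auto
        finally show ?thesis by (simp add: ac_simps)
      qed
    qed (use r in auto)
    then show "norm (x \<theta>) \<le> C / (1 - lm) * D" by (simp add: z_def p_def)
  qed (use r in auto)
qed

text \<open>The mirror image of the stable case: values at forward iterates are pulled back with the
  inverse cocycle, which contracts \<open>Eu\<close> at the rate \<open>1 / lp\<close>.\<close>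

lemma unstable_estimate:
  "\<exists>C>0. \<forall>x g X D. (\<forall>\<theta>. x \<theta> \<in> Eu \<theta>) \<longrightarrow> (\<forall>\<theta>. x (\<theta> + \<omega>) = \<gamma> \<theta> *v x \<theta> + g \<theta>) \<longrightarrow>
      (\<forall>\<theta>. norm (x \<theta>) \<le> X) \<longrightarrow> (\<forall>\<theta>. norm (g \<theta>) \<le> D) \<longrightarrow> (\<forall>\<theta>. norm (x \<theta>) \<le> C * D)"
proof -
  obtain C lm lp cm cp where r: "C > 0" "0 < lm" "lm < 1" "1 < lp" "lm < lam / lp" "lam / lp < cm"
      "cm \<le> lam" "lam \<le> cp" "cp < lp"
    and s0: "\<forall>\<theta> v j. v \<in> Es \<theta> \<longrightarrow> norm (G j \<theta> *v v) \<le> C * lm ^ j * norm v"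
    and u0: "\<forall>\<theta> v j. v \<in> Eu (\<theta> + real j *\<^sub>R \<omega>) \<longrightarrow> norm (matrix_inv (G j \<theta>) *v v) \<le> C * (1 / lp) ^ j * norm v"
    and cp0: "\<forall>\<theta> v j. v \<in> Ec \<theta> \<longrightarrow> norm (G j \<theta> *v v) \<le> C * cp ^ j * norm v"
    and cm0: "\<forall>\<theta> v j. v \<in> Ec (\<theta> + real j *\<^sub>R \<omega>) \<longrightarrow> norm (matrix_inv (G j \<theta>) *v v) \<le> C * (1 / cm) ^ j * norm v"
    by (rule rates)
  note s = s0[rule_format] and u = u0[rule_format] and cp = cp0[rule_format] and cm = cm0[rule_format]
  show ?thesis
  proof (intro exI[of _ "C / (1 - 1 / lp)"] conjI allI impI)
    fix x g X D \<theta>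
    assume hyps: "\<forall>\<theta>. x \<theta> \<in> Eu \<theta>" "\<forall>\<theta>. x (\<theta> + \<omega>) = \<gamma> \<theta> *v x \<theta> + g \<theta>"
      "\<forall>\<theta>. norm (x \<theta>) \<le> X" "\<forall>\<theta>. norm (g \<theta>) \<le> D"
    note x = hyps(1)[rule_format] and rec = hyps(2)[rule_format]
      and X = hyps(3)[rule_format] and D = hyps(4)[rule_format]
    have "D \<ge> 0" using D norm_ge_zero order_trans by blast
    define p where "p = (\<lambda>j. \<theta> + real j *\<^sub>R \<omega>)"
    have p: "p (Suc j) = p j + \<omega>" for j by (simp add: p_def algebra_simps)
    define z where "z = (\<lambda>j. matrix_inv (G j \<theta>) *v x (p j))"
    have "norm (z 0) \<le> (C * D) / (1 - 1 / lp)"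
    proof (rule geometric_telescope)
      show "norm (z j) \<le> (C * X) * (1 / lp) ^ j" for j
      proof -
        have "norm (z j) \<le> C * (1 / lp) ^ j * norm (x (p j))"
          unfolding z_def by (rule u) (use x p_def in auto)
        also have "\<dots> \<le> C * (1 / lp) ^ j * X" using X r by (intro mult_left_mono) auto
        finally show ?thesis by (simp add: ac_simps)
      qed
      show "norm (z j - z (Suc j)) \<le> (C * D) * (1 / lp) ^ j" for j
      proof -
        have g: "g (p j) = x (p (Suc j)) - \<gamma> (p j) *v x (p j)"
          using rec[of "p j"] p[of j] by simp
        have gin: "g (p j) \<in> Eu (p (Suc j))"
          unfolding g using invar[of Eu "p j"] x p[of j]
          by (intro subspace_diff splitD(3) x) auto
        have "G (Suc j) \<theta> *v z j = \<gamma> (p j) *v x (p j)"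
          by (simp add: z_def p_def G_inv_cancel flip: matrix_vector_mul_assoc)
        then have "z j = matrix_inv (G (Suc j) \<theta>) *v (\<gamma> (p j) *v x (p j))"
          using G_inv_cancel(1)[of "Suc j" \<theta> "z j"] by simp
        then have "z (Suc j) - z j = matrix_inv (G (Suc j) \<theta>) *v g (p j)"
          unfolding g by (simp add: z_def matrix_vector_mult_diff_distrib del: cocycle_nat.simps)
        then have "norm (z j - z (Suc j)) \<le> C * (1 / lp) ^ Suc j * norm (g (p j))"
          using u[of "g (p j)" \<theta> "Suc j"] gin
          by (simp add: p_def norm_minus_commute[of "z j"] del: cocycle_nat.simps power_Suc)
        \<comment> \<open>The pullback runs over \<open>Suc j\<close> steps; the surplus factor
          \<open>1 / lp\<close> is at most 1 and is dropped.\<close>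
        also have "\<dots> \<le> C * (1 / lp) ^ j * D"
          using D[of "p j"] r \<open>D \<ge> 0\<close> power_decreasing[of j "Suc j" "1 / lp"]
          by (intro mult_mono mult_left_mono) (auto simp del: power_Suc)
        finally show ?thesis by (simp add: ac_simps)
      qed
    qed (use r in auto)
    then have "norm (x \<theta>) \<le> (C * D) / (1 - 1 / lp)"
      by (simp add: z_def p_def) (metis G_inv_cancel(1) cocycle_nat.simps(1) matrix_vector_mul_lid)
    then show "norm (x \<theta>) \<le> C / (1 - 1 / lp) * D" by simp
  qed (use r in auto)
qed

text \<open>By conformality \<open>w \<theta> u v\<close> is the pairing of the j-th iterates
  divided by \<open>lam ^ j\<close>. For stable \<open>u\<close> forward iteration gives the rate
  \<open>lm * cp / lam\<close>; for unstable \<open>u\<close> backward iteration gives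
  \<open>lam / lp / cm\<close>. The gap conditions put both below 1.\<close>

lemma center_orthogonal:
  assumes conf: "\<And>\<theta> u v. w (\<theta> + \<omega>) (\<gamma> \<theta> *v u) (\<gamma> \<theta> *v v) = lam * w \<theta> u v"
    and W: "\<And>\<theta> u v. \<bar>w \<theta> u v\<bar> \<le> W * norm u * norm v"
    and v: "v \<in> Ec \<theta>" and su: "u \<in> Es \<theta> \<or> u \<in> Eu \<theta>"
  shows "w \<theta> u v = 0"
proof -
  obtain C lm lp cm cp where r: "C > 0" "0 < lm" "lm < 1" "1 < lp" "lm < lam / lp" "lam / lp < cm"
      "cm \<le> lam" "lam \<le> cp" "cp < lp"
    and s0: "\<forall>\<theta> v j. v \<in> Es \<theta> \<longrightarrow> norm (G j \<theta> *v v) \<le> C * lm ^ j * norm v"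
    and u0: "\<forall>\<theta> v j. v \<in> Eu (\<theta> + real j *\<^sub>R \<omega>) \<longrightarrow> norm (matrix_inv (G j \<theta>) *v v) \<le> C * (1 / lp) ^ j * norm v"
    and cp0: "\<forall>\<theta> v j. v \<in> Ec \<theta> \<longrightarrow> norm (G j \<theta> *v v) \<le> C * cp ^ j * norm v"
    and cm0: "\<forall>\<theta> v j. v \<in> Ec (\<theta> + real j *\<^sub>R \<omega>) \<longrightarrow> norm (matrix_inv (G j \<theta>) *v v) \<le> C * (1 / cm) ^ j * norm v"
    by (rule rates)
  note s = s0[rule_format] and u = u0[rule_format] and cp = cp0[rule_format] and cm = cm0[rule_format]
  have cmp: "0 < cm" using r lam by (auto intro: order.strict_trans[of 0 "lam / lp" cm])
  have W0: "W \<ge> 0"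
  proof -
    obtain a :: "real^'m" where "norm a = 1" using vector_choose_size[of 1] by auto
    then show ?thesis using W[of \<theta> a a] by (simp add: abs_ge_zero order_trans)
  qed
  have conf': "w (\<theta> + real j *\<^sub>R \<omega>) (G j \<theta> *v a) (G j \<theta> *v b) = lam ^ j * w \<theta> a b" for j \<theta> a b
  proof (induction j)
    case (Suc j)
    have "\<theta> + real (Suc j) *\<^sub>R \<omega> = \<theta> + real j *\<^sub>R \<omega> + \<omega>" by (simp add: algebra_simps)
    then show ?case
      using conf[of "\<theta> + real j *\<^sub>R \<omega>" "G j \<theta> *v a" "G j \<theta> *v b"] Suc
      by (simp only: cocycle_nat.simps matrix_vector_mul_assoc power_Suc mult.assoc)
  qed simp
  from su show ?thesis
  proof
    assume u: "u \<in> Es \<theta>"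
    have "\<bar>w \<theta> u v\<bar> \<le> 0"
    proof (rule geometric_null1)
      fix j
      have "\<bar>w \<theta> u v\<bar> = \<bar>w (\<theta> + real j *\<^sub>R \<omega>) (G j \<theta> *v u) (G j \<theta> *v v)\<bar> / lam ^ j"
        using lam by (simp add: conf' abs_mult)
      also have "\<dots> \<le> (W * (C * lm ^ j * norm u) * (C * cp ^ j * norm v)) / lam ^ j"
        using s[OF u, of j] cp[OF v, of j] W0 lam r
        by (intro divide_right_mono order_trans[OF W] mult_mono) auto
      also have "\<dots> = (W * C * C * norm u * norm v) * (lm * cp / lam) ^ j"
        by (simp add: power_divide power_mult_distrib ac_simps)
      finally show "\<bar>w \<theta> u v\<bar> \<le> \<dots>" .
    next
      \<comment> \<open>The conditions \<open>lm < lam / lp\<close> and \<open>cp < lp\<close> act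
        together here.\<close>
      have "lm * cp < lam / lp * lp" using r by (intro mult_strict_mono) auto
      then show "lm * cp / lam < 1" using lam r by simp
    qed (use r lam in auto)
    then show ?thesis by simp
  next
    assume u: "u \<in> Eu \<theta>"
    have "\<bar>w \<theta> u v\<bar> \<le> 0"
    proof (rule geometric_null1)
      fix j
      define \<theta>' where "\<theta>' = \<theta> - real j *\<^sub>R \<omega>"
      have \<theta>: "\<theta>' + real j *\<^sub>R \<omega> = \<theta>" by (simp add: \<theta>'_def)
      let ?u = "matrix_inv (G j \<theta>') *v u" and ?v = "matrix_inv (G j \<theta>') *v v"
      have "\<bar>w \<theta> u v\<bar> = lam ^ j * \<bar>w \<theta>' ?u ?v\<bar>"
        using conf'[of \<theta>' j ?u ?v] lam by (simp add: G_inv_cancel \<theta> abs_mult)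
      also have "\<dots> \<le> lam ^ j * (W * (C * (1 / lp) ^ j * norm u) * (C * (1 / cm) ^ j * norm v))"
        using u0[rule_format, of u \<theta>' j] cm[of v \<theta>' j] u v W0 lam r
        by (intro mult_left_mono order_trans[OF W] mult_mono) (auto simp: \<theta>)
      also have "\<dots> = (W * C * C * norm u * norm v) * (lam / lp / cm) ^ j"
        by (simp add: power_divide power_mult_distrib ac_simps)
      finally show "\<bar>w \<theta> u v\<bar> \<le> \<dots>" .
    qed (use r lam cmp in \<open>auto simp: field_simps\<close>)
    then show ?thesis by simp
  qed
qed

end

subsection \<open>The contracting cohomological equation\<close>

text \<open>Each step back along the rotation contributes a factor \<open>lam\<close>, so a bounded
  solution is controlled by its forcing term with the constant \<open>1 / (1 - lam)\<close>.\<close>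

lemma contraction_recurrence_bound:
  fixes x g :: "real^'d \<Rightarrow> 'b::real_normed_vector"
  assumes rec: "\<And>\<theta>. x (\<theta> + \<omega>) = lam *\<^sub>R x \<theta> + g \<theta>" and lam: "0 < lam" "lam < 1"
    and X: "\<And>\<theta>. norm (x \<theta>) \<le> X" and D: "\<And>\<theta>. norm (g \<theta>) \<le> D"
  shows "norm (x \<theta>) \<le> D / (1 - lam)"
proof -
  define p where "p = (\<lambda>j. \<theta> - real j *\<^sub>R \<omega>)"
  have p: "p j = p (Suc j) + \<omega>" for j by (simp add: p_def algebra_simps)
  have "norm ((\<lambda>j. lam ^ j *\<^sub>R x (p j)) 0) \<le> D / (1 - lam)"
  proof (rule geometric_telescope[where X = X])
    show "norm (lam ^ j *\<^sub>R x (p j)) \<le> X * lam ^ j" for j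
      using X[of "p j"] lam by (simp add: mult.commute)
    show "norm (lam ^ j *\<^sub>R x (p j) - lam ^ Suc j *\<^sub>R x (p (Suc j))) \<le> D * lam ^ j" for j
    proof -
      have "lam ^ j *\<^sub>R x (p j) - lam ^ Suc j *\<^sub>R x (p (Suc j)) = lam ^ j *\<^sub>R g (p (Suc j))"
        using rec[of "p (Suc j)"] p[of j] by (simp add: algebra_simps)
      then show ?thesis using D[of "p (Suc j)"] lam by (simp add: mult.commute)
    qed
  qed (use lam in auto)
  then show ?thesis by (simp add: p_def)
qed

text \<open>The solution is the series of the terms \<open>lam ^ k *\<^sub>R g (\<theta> - real (Suc
  k) *\<^sub>R \<omega>)\<close>, uniformly convergent by comparison with a geometric
  series.\<close>

lemma contraction_recurrence_solution:
  fixes g :: "real^'d \<Rightarrow> 'b::euclidean_space"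
  assumes g: "continuous_on UNIV g" "zperiodic g" and lam: "0 < lam" "lam < 1"
  obtains x where "continuous_on UNIV x" "zperiodic x" "\<And>\<theta>. x (\<theta> + \<omega>) = lam *\<^sub>R x \<theta> + g \<theta>"
proof -
  obtain B where B: "\<And>\<theta>. norm (g \<theta>) \<le> B" using zperiodic_bounded[OF g] by blast
  define h where "h = (\<lambda>k \<theta>. lam ^ k *\<^sub>R g (\<theta> - real (Suc k) *\<^sub>R \<omega>))"
  define x where "x = (\<lambda>\<theta>. \<Sum>k. h k \<theta>)"
  have h: "norm (h k \<theta>) \<le> B * lam ^ k" for k \<theta>
    using B lam by (simp add: h_def mult.commute mult_left_mono)
  have sB: "summable (\<lambda>k. B * lam ^ k)"
    using lam by (intro summable_mult summable_geometric) auto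
  have sh: "summable (\<lambda>k. h k \<theta>)" for \<theta>
    by (rule summable_comparison_test'[OF sB]) (rule h)
  have cont: "continuous_on UNIV (h k)" for k
    unfolding h_def by (intro continuous_intros continuous_on_compose2[OF g(1)]) auto
  have "uniform_limit UNIV (\<lambda>n \<theta>. \<Sum>k<n. h k \<theta>) x sequentially"
    unfolding x_def by (rule Weierstrass_m_test[OF h sB])
  then have "continuous_on UNIV x"
    by (rule uniform_limit_theorem[rotated])
      (auto intro!: always_eventually continuous_on_sum cont)
  moreover have "g (\<theta> + ivec k - s) = g (\<theta> - s)" for \<theta> k s
    using zperiodicD[OF g(2), of "\<theta> - s" k] by (simp add: algebra_simps)
  then have "zperiodic x"
    unfolding zperiodic_def x_def h_def by simp
  moreover have "x (\<theta> + \<omega>) = lam *\<^sub>R x \<theta> + g \<theta>" for \<theta>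
  proof -
    have "h (Suc k) (\<theta> + \<omega>) = lam *\<^sub>R h k \<theta>" for k
      by (simp add: h_def algebra_simps)
    then have "lam *\<^sub>R x \<theta> = (\<Sum>k. h (Suc k) (\<theta> + \<omega>))"
      using suminf_scaleR_right[OF sh, of lam \<theta>] by (simp add: x_def)
    also have "\<dots> = x (\<theta> + \<omega>) - h 0 (\<theta> + \<omega>)"
      unfolding x_def by (rule suminf_split_head[OF sh])
    also have "h 0 (\<theta> + \<omega>) = g \<theta>" by (simp add: h_def)
    finally show ?thesis by simp
  qed
  ultimately show ?thesis using that by blast
qed

text \<open>Justifies the definite description in \<open>Wb\<close>: existence from the series, zero
  mean because averaging the recurrence makes the mean equal to \<open>lam\<close> times itself,
  uniqueness because the difference of two solutions has zero forcing.\<close>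

lemma Wb_properties:
  fixes A2 :: "real^'d \<Rightarrow> real^'d^'d"
  assumes A2: "continuous_on UNIV A2" "zperiodic A2" and lam: "0 < lam" "lam < 1"
  shows "continuous_on UNIV (Wb lam \<omega> A2)" "zperiodic (Wb lam \<omega> A2)" "torus_avg (Wb lam \<omega> A2) = 0"
    "\<And>\<theta>. Wb lam \<omega> A2 (\<theta> + \<omega>) = lam *\<^sub>R Wb lam \<omega> A2 \<theta> + (A2 \<theta> - torus_avg A2)"
proof -
  define g where "g = (\<lambda>\<theta>. A2 \<theta> - torus_avg A2)"
  have g: "continuous_on UNIV g" "zperiodic g"
    using A2 by (auto simp: g_def zperiodic_def intro!: continuous_intros)
  let ?P = "\<lambda>W. continuous_on UNIV W \<and> (\<forall>\<theta> k. W (\<theta> + ivec k) = W \<theta>) \<and> torus_avg W = 0 \<and>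
        (\<forall>\<theta>. lam *\<^sub>R W \<theta> - W (\<theta> + \<omega>) = - (A2 \<theta> - torus_avg A2))"
  obtain W where W: "continuous_on UNIV W" "zperiodic W" "\<And>\<theta>. W (\<theta> + \<omega>) = lam *\<^sub>R W \<theta> + g \<theta>"
    using contraction_recurrence_solution[OF g lam] by blast
  have "torus_avg W = torus_avg (\<lambda>\<theta>. lam *\<^sub>R W \<theta> + g \<theta>)"
    using torus_avg_shift[OF W(1,2), of \<omega>] by (simp add: W(3))
  also have "\<dots> = lam *\<^sub>R torus_avg W + torus_avg g"
    by (simp add: torus_avg_add torus_avg_linear[OF bounded_linear_scaleR_right] W(1) g(1) continuous_on_scaleR)
  also have "torus_avg g = 0"
    unfolding g_def by (subst torus_avg_diff) (auto intro: A2)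
  finally have eq: "torus_avg W = lam *\<^sub>R torus_avg W + 0" .
  have "1 *\<^sub>R torus_avg W = lam *\<^sub>R torus_avg W"
    by (rule trans[OF scaleR_one trans[OF eq add_0_right]])
  then have W0: "torus_avg W = 0" unfolding scaleR_cancel_right using lam by simp
  have "?P W" using W W0 by (auto simp: g_def zperiodic_def)
  moreover have "W' = W" if "?P W'" for W'
  proof -
    have W': "continuous_on UNIV W'" "zperiodic W'" using that by (auto simp: zperiodic_def)
    obtain X where X: "\<And>\<theta>. norm (W' \<theta>) \<le> X" using zperiodic_bounded[OF W'] by blast
    obtain Y where Y: "\<And>\<theta>. norm (W \<theta>) \<le> Y" using zperiodic_bounded[OF W(1,2)] by blast
    have W'eq: "W' (\<theta> + \<omega>) = lam *\<^sub>R W' \<theta> + g \<theta>" for \<theta>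
    proof -
      have "lam *\<^sub>R W' \<theta> - W' (\<theta> + \<omega>) = - g \<theta>" using that by (simp add: g_def)
      then show ?thesis by (simp add: algebra_simps)
    qed
    have "norm (W' \<theta> - W \<theta>) \<le> 0 / (1 - lam)" for \<theta>
    proof (rule contraction_recurrence_bound[where g = "\<lambda>_. 0" and X = "X + Y" and \<omega> = \<omega>])
      show "W' (\<theta> + \<omega>) - W (\<theta> + \<omega>) = lam *\<^sub>R (W' \<theta> - W \<theta>) + 0" for \<theta>
        unfolding W(3) W'eq by (simp add: algebra_simps)
      show "norm (W' \<theta> - W \<theta>) \<le> X + Y" for \<theta>
        using norm_triangle_ineq4[of "W' \<theta>" "W \<theta>"] X[of \<theta>] Y[of \<theta>] by linarith
    qed (use lam in auto)
    then show ?thesis by auto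
  qed
  ultimately have "?P (Wb lam \<omega> A2)"
    unfolding Wb_def by (rule theI)
  then show "continuous_on UNIV (Wb lam \<omega> A2)" "zperiodic (Wb lam \<omega> A2)" "torus_avg (Wb lam \<omega> A2) = 0"
    by (auto simp: zperiodic_def)
  fix \<theta>
  have "lam *\<^sub>R Wb lam \<omega> A2 \<theta> - Wb lam \<omega> A2 (\<theta> + \<omega>) = - (A2 \<theta> - torus_avg A2)"
    using \<open>?P (Wb lam \<omega> A2)\<close> by blast
  then show "Wb lam \<omega> A2 (\<theta> + \<omega>) = lam *\<^sub>R Wb lam \<omega> A2 \<theta> + (A2 \<theta> - torus_avg A2)"
    by (simp add: algebra_simps)
qed

lemma block_mat_mult:
  "block_mat A B C D *v join_parts x y = join_parts (A *v x + B *v y) (C *v x + D *v y)"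
  by (auto simp: block_mat_def join_parts_def matrix_vector_mult_def sum_UNIV_sum vec_eq_iff split: sum.splits)

lemma bounded_linear_mv_left: "bounded_linear (\<lambda>A :: real^'m^'k. A *v x)"
  by (rule bounded_bilinear.bounded_linear_left[OF bounded_bilinear_matrix_vector])

lemma torus_avg_mv:
  fixes A :: "real^'d \<Rightarrow> real^'m^'k"
  assumes "continuous_on UNIV A"
  shows "torus_avg (\<lambda>\<theta>. A \<theta> *v x) = torus_avg A *v x"
  by (rule torus_avg_linear[OF bounded_linear_mv_left assms])

text \<open>Subtracting \<open>Wb *v \<sigma>\<close> and its mean from \<open>w\<close> leaves a remainder controlled by the contraction;
  the two means then solve the linear system whose matrix is the nondegeneracy matrix.\<close>

lemma center_estimate:
  fixes S A1 A2 :: "real^'d \<Rightarrow> real^'d^'d"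
  assumes S: "continuous_on UNIV S" "zperiodic S" and A1: "continuous_on UNIV A1"
    and A2: "continuous_on UNIV A2" "zperiodic A2" and lam: "0 < lam" "lam < 1"
    and det: "det (block_mat (torus_avg S) (torus_avg (\<lambda>\<theta>. S \<theta> ** Wb lam \<omega> A2 \<theta>) + torus_avg A1)
      ((lam - 1) *\<^sub>R mat 1) (torus_avg A2)) \<noteq> 0"
  shows "\<exists>C>0. \<forall>w \<sigma> r1 E. continuous_on UNIV w \<longrightarrow> zperiodic w \<longrightarrow> continuous_on UNIV r1 \<longrightarrow>
      torus_avg (\<lambda>\<theta>. S \<theta> *v w \<theta> + A1 \<theta> *v \<sigma> + r1 \<theta>) = 0 \<longrightarrow> (\<forall>\<theta>. norm (r1 \<theta>) \<le> E) \<longrightarrow>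
      (\<forall>\<theta>. norm (w (\<theta> + \<omega>) - (lam *\<^sub>R w \<theta> + A2 \<theta> *v \<sigma>)) \<le> E) \<longrightarrow>
      norm \<sigma> \<le> C * E \<and> (\<forall>\<theta>. norm (w \<theta>) \<le> C * E)"
proof -
  define W where "W = Wb lam \<omega> A2"
  note W = Wb_properties[OF A2 lam, of \<omega>, folded W_def]
  obtain BS where BS: "BS > 0" "\<And>\<theta>. norm (S \<theta>) \<le> BS" using zperiodic_bounded[OF S] by blast
  obtain BW where BW: "BW > 0" "\<And>\<theta>. norm (W \<theta>) \<le> BW" using zperiodic_bounded[OF W(1,2)] by blast
  define Q where "Q = block_mat (torus_avg S) (torus_avg (\<lambda>\<theta>. S \<theta> ** W \<theta>) + torus_avg A1)
      ((lam - 1) *\<^sub>R mat 1) (torus_avg A2)"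
  have Q: "invertible Q" using det by (simp add: invertible_det_nz Q_def W_def)
  \<comment> \<open>The 2 accounts for \<open>r2\<close> together with its mean, which is subtracted
    before the contraction estimate.\<close>
  define c1 where "c1 = 2 / (1 - lam)"
  have c1: "c1 > 0" using lam by (simp add: c1_def)
  \<comment> \<open>Bounds the solution of the linear system: \<open>BS * c1\<close> comes from the
    mean of \<open>S\<close> applied to the remainder \<open>p\<close>, the 2 from the means of
    \<open>r1\<close> and \<open>r2\<close>.\<close>
  define c2 where "c2 = norm (matrix_inv Q) * (BS * c1 + 2)"
  have c2: "c2 \<ge> 0" using BS c1 by (simp add: c2_def)
  have cSW: "continuous_on UNIV (\<lambda>\<theta>. S \<theta> ** W \<theta>)" by (intro continuous_intros S W)
  show ?thesis
  proof (intro exI[of _ "c1 + c2 + BW * c2 + c2"] conjI[of "0 < _"] allI impI)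
    have "BW * c2 \<ge> 0" using c2 BW by simp
    then show "c1 + c2 + BW * c2 + c2 > 0" using c1 c2 by linarith
    fix w \<sigma> r1 E
    assume w: "continuous_on UNIV w" "zperiodic w" and r1: "continuous_on UNIV r1"
      and avg0: "torus_avg (\<lambda>\<theta>. S \<theta> *v w \<theta> + A1 \<theta> *v \<sigma> + r1 \<theta>) = 0"
      and bounds: "\<forall>\<theta>. norm (r1 \<theta>) \<le> E"
        "\<forall>\<theta>. norm (w (\<theta> + \<omega>) - (lam *\<^sub>R w \<theta> + A2 \<theta> *v \<sigma>)) \<le> E"
    note r1E = bounds(1)[rule_format] and r2E = bounds(2)[rule_format]
    have E: "E \<ge> 0" using order_trans[OF norm_ge_zero r1E] .
    define r2 where "r2 = (\<lambda>\<theta>. w (\<theta> + \<omega>) - (lam *\<^sub>R w \<theta> + A2 \<theta> *v \<sigma>))"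
    have cont_shift: "continuous_on UNIV (\<lambda>\<theta>. w (\<theta> + \<omega>))"
      by (intro continuous_on_compose2[OF w(1)] continuous_intros) auto
    have r2c: "continuous_on UNIV r2"
      unfolding r2_def by (intro continuous_intros cont_shift w A2)
    \<comment> \<open>\<open>W\<close> absorbs the oscillating part of
      \<open>A2 \<theta> *v \<sigma>\<close>, so that \<sigma> enters the recurrence for
      \<open>q\<close> only through the constant vector
      \<open>torus_avg A2 *v \<sigma>\<close>.\<close>
    define q where "q = (\<lambda>\<theta>. w \<theta> - W \<theta> *v \<sigma>)"
    have qc: "continuous_on UNIV q" and qp: "zperiodic q"
      using w W(1,2) by (auto simp: q_def zperiodic_def intro!: continuous_intros)
    define c where "c = torus_avg q"
    have qrec: "q (\<theta> + \<omega>) = lam *\<^sub>R q \<theta> + torus_avg A2 *v \<sigma> + r2 \<theta>" for \<theta>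
      unfolding q_def r2_def W(4) by (simp add: algebra_simps scaleR_matrix_vector_assoc[symmetric])
    \<comment> \<open>Averaging the recurrence yields the second block row of the system.\<close>
    have "c = torus_avg (\<lambda>\<theta>. q (\<theta> + \<omega>))"
      unfolding c_def using torus_avg_shift[OF qc qp] by simp
    also have "\<dots> = lam *\<^sub>R c + torus_avg A2 *v \<sigma> + torus_avg r2"
      unfolding qrec c_def
      by (simp add: torus_avg_add torus_avg_linear[OF bounded_linear_scaleR_right] qc r2c continuous_intros)
    finally have ceq: "lam *\<^sub>R c + torus_avg A2 *v \<sigma> + torus_avg r2 = c" by (rule sym)
    have "(lam - 1) *\<^sub>R c + torus_avg A2 *v \<sigma> + torus_avg r2 =
        lam *\<^sub>R c + torus_avg A2 *v \<sigma> + torus_avg r2 - c" by (simp add: algebra_simps)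
    also have "\<dots> = 0" unfolding ceq by simp
    finally have c: "(lam - 1) *\<^sub>R c + torus_avg A2 *v \<sigma> = - torus_avg r2"
      by (simp only: eq_neg_iff_add_eq_0)
    have r2avg: "norm (torus_avg r2) \<le> E"
      by (rule norm_torus_avg_le[OF r2c]) (use r2E in \<open>simp add: r2_def\<close>)
    define p where "p = (\<lambda>\<theta>. q \<theta> - c)"
    have pc: "continuous_on UNIV p" and pp: "zperiodic p"
      using qc qp by (auto simp: p_def zperiodic_def intro!: continuous_intros)
    obtain X where X: "\<And>\<theta>. norm (p \<theta>) \<le> X" using zperiodic_bounded[OF pc pp] by blast
    have pE: "norm (p \<theta>) \<le> c1 * E" for \<theta>
    proof -
      have "norm (p \<theta>) \<le> (2 * E) / (1 - lam)"
      proof (rule contraction_recurrence_bound[OF _ lam X])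
        show "p (\<theta> + \<omega>) = lam *\<^sub>R p \<theta> + (r2 \<theta> - torus_avg r2)" for \<theta>
        proof -
          have "torus_avg A2 *v \<sigma> = - torus_avg r2 - (lam - 1) *\<^sub>R c"
            using c by (simp add: algebra_simps)
          then show ?thesis unfolding p_def qrec by (simp add: algebra_simps)
        qed
        show "norm (r2 \<theta> - torus_avg r2) \<le> 2 * E" for \<theta>
          using norm_triangle_ineq4[of "r2 \<theta>" "torus_avg r2"] r2avg r2E[of \<theta>] by (simp add: r2_def)
      qed
      then show ?thesis by (simp add: c1_def)
    qed
    have weq: "w \<theta> = p \<theta> + c + W \<theta> *v \<sigma>" for \<theta> by (simp add: p_def q_def)
    \<comment> \<open>Inserting the decomposition of \<open>w\<close> into the vanishing mean yields
      the first block row.\<close>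
    have "S \<theta> *v w \<theta> + A1 \<theta> *v \<sigma> + r1 \<theta> =
        S \<theta> *v p \<theta> + S \<theta> *v c + (S \<theta> ** W \<theta>) *v \<sigma> + A1 \<theta> *v \<sigma> + r1 \<theta>" for \<theta>
      by (simp add: weq matrix_vector_right_distrib matrix_vector_mul_assoc)
    then have "0 = torus_avg (\<lambda>\<theta>. S \<theta> *v p \<theta> + S \<theta> *v c + (S \<theta> ** W \<theta>) *v \<sigma> + A1 \<theta> *v \<sigma> + r1 \<theta>)"
      using avg0 by simp
    also have "\<dots> = torus_avg (\<lambda>\<theta>. S \<theta> *v p \<theta>) + torus_avg S *v c + torus_avg (\<lambda>\<theta>. S \<theta> ** W \<theta>) *v \<sigma>
        + torus_avg A1 *v \<sigma> + torus_avg r1"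
      by (simp add: torus_avg_add torus_avg_mv S A1 cSW r1 pc continuous_intros)
    finally have Qx: "Q *v join_parts c \<sigma> =
        join_parts (- torus_avg (\<lambda>\<theta>. S \<theta> *v p \<theta>) - torus_avg r1) (- torus_avg r2)"
      unfolding Q_def block_mat_mult using c
      by (intro arg_cong2[where f=join_parts])
        (simp_all add: matrix_vector_mult_add_rdistrib scaleR_matrix_vector_assoc[symmetric] algebra_simps
          eq_neg_iff_add_eq_0)
    have avgS: "norm (torus_avg (\<lambda>\<theta>. S \<theta> *v p \<theta>)) \<le> BS * (c1 * E)"
    proof (rule norm_torus_avg_le)
      show "norm (S \<theta> *v p \<theta>) \<le> BS * (c1 * E)" for \<theta>
        using norm_matrix_vector_le[of "S \<theta>" "p \<theta>"] mult_mono[OF BS(2) pE] BS(1)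
        by (meson less_imp_le norm_ge_zero order_trans)
    qed (intro continuous_intros S pc)
    have r1avg: "norm (torus_avg r1) \<le> E" by (rule norm_torus_avg_le[OF r1 r1E])
    have "norm (Q *v join_parts c \<sigma>) \<le> norm (- torus_avg (\<lambda>\<theta>. S \<theta> *v p \<theta>) - torus_avg r1) + norm (- torus_avg r2)"
      unfolding Qx using norm_join_parts_le[of "join_parts (- torus_avg (\<lambda>\<theta>. S \<theta> *v p \<theta>) - torus_avg r1) (- torus_avg r2)"]
      by simp
    also have "\<dots> \<le> BS * (c1 * E) + E + E"
      using avgS r1avg r2avg norm_triangle_ineq4[of "- torus_avg (\<lambda>\<theta>. S \<theta> *v p \<theta>)" "torus_avg r1"] by simp
    finally have Qn: "norm (Q *v join_parts c \<sigma>) \<le> (BS * c1 + 2) * E" by (simp add: algebra_simps)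
    have "join_parts c \<sigma> = matrix_inv Q *v (Q *v join_parts c \<sigma>)"
      using matrix_inv_left_right(2)[OF Q] by (simp add: matrix_vector_mul_assoc)
    then have "norm (join_parts c \<sigma>) \<le> norm (matrix_inv Q) * norm (Q *v join_parts c \<sigma>)"
      by (metis norm_matrix_vector_le)
    also have "\<dots> \<le> c2 * E"
      using mult_left_mono[OF Qn, of "norm (matrix_inv Q)"] by (simp add: c2_def mult.assoc)
    finally have j: "norm (join_parts c \<sigma>) \<le> c2 * E" .
    have cn: "norm c \<le> c2 * E" and sn: "norm \<sigma> \<le> c2 * E"
      using norm_inl_part_le[of "join_parts c \<sigma>"] norm_inr_part_le[of "join_parts c \<sigma>"] j by simp_all
    have nn: "0 \<le> c1 * E" "0 \<le> c2 * E" "0 \<le> BW * (c2 * E)" using c1 c2 E BW by simp_all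
    have sum: "(c1 + c2 + BW * c2 + c2) * E = c1 * E + c2 * E + BW * (c2 * E) + c2 * E"
      by (simp add: algebra_simps)
    have "norm (w \<theta>) \<le> (c1 + c2 + BW * c2 + c2) * E" for \<theta>
    proof -
      have "norm (W \<theta> *v \<sigma>) \<le> BW * (c2 * E)"
        using norm_matrix_vector_le[of "W \<theta>" \<sigma>] mult_mono[OF BW(2) sn] BW(1)
        by (meson less_imp_le norm_ge_zero order_trans)
      then show ?thesis
        unfolding weq sum using pE[of \<theta>] cn nn norm_triangle_ineq[of "p \<theta> + c" "W \<theta> *v \<sigma>"]
          norm_triangle_ineq[of "p \<theta>" c] by linarith
    qed
    moreover have "norm \<sigma> \<le> (c1 + c2 + BW * c2 + c2) * E"
      unfolding sum using sn nn by linarith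
    ultimately show "norm \<sigma> \<le> (c1 + c2 + BW * c2 + c2) * E \<and> (\<forall>\<theta>. norm (w \<theta>) \<le> (c1 + c2 + BW * c2 + c2) * E)"
      by blast
  qed
qed

subsection \<open>Perturbations of the identity\<close>

text \<open>The equation is the fixed point problem of
  \<open>a - (h \<theta> a - y \<theta>)\<close>, a contraction with factor 1/2. The same hypothesis
  prevents \<open>h \<theta>\<close> from shrinking distances by more than a factor 2, which gives
  the bound, the uniqueness and the continuity in \<theta>.\<close>

lemma near_identity_solution:
  fixes h :: "'a::metric_space \<Rightarrow> 'b::euclidean_space \<Rightarrow> 'b"
  assumes r: "r > 0" and h0: "\<And>\<theta>. h \<theta> 0 = 0"
    and lip: "\<And>\<theta> a a'. norm a \<le> r \<Longrightarrow> norm a' \<le> r \<Longrightarrow>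
      norm (h \<theta> a - h \<theta> a' - (a - a')) \<le> norm (a - a') / 2"
    and hc: "\<And>a. norm a \<le> r \<Longrightarrow> continuous_on UNIV (\<lambda>\<theta>. h \<theta> a)"
    and y: "continuous_on UNIV y" "\<And>\<theta>. norm (y \<theta>) \<le> r / 2"
  obtains a where "continuous_on UNIV a" "\<And>\<theta>. norm (a \<theta>) \<le> 2 * norm (y \<theta>)" "\<And>\<theta>. h \<theta> (a \<theta>) = y \<theta>"
    "\<And>\<theta> a'. norm a' \<le> r \<Longrightarrow> h \<theta> a' = y \<theta> \<Longrightarrow> a' = a \<theta>"
proof -
  have exp: "norm (a - a') \<le> 2 * norm (h \<theta> a - h \<theta> a')" if "norm a \<le> r" "norm a' \<le> r" for \<theta> a a'
  proof -
    have "norm (a - a') \<le> norm (h \<theta> a - h \<theta> a') + norm (h \<theta> a - h \<theta> a' - (a - a'))"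
      using norm_triangle_ineq4[of "h \<theta> a - h \<theta> a'" "h \<theta> a - h \<theta> a' - (a - a')"] by simp
    then show ?thesis using lip[OF that, of \<theta>] by simp
  qed
  have "\<exists>a. norm a \<le> r \<and> h \<theta> a = y \<theta>" for \<theta>
  proof -
    let ?T = "\<lambda>a. a - (h \<theta> a - y \<theta>)"
    have "\<exists>!a\<in>cball 0 r. ?T a = a"
    proof (rule Banach_fix[where c = "1/2"])
      show "complete (cball (0::'b) r)" by (simp add: compact_imp_complete)
      show "cball (0::'b) r \<noteq> {}" using r by simp
      show "?T ` cball 0 r \<subseteq> cball 0 r"
      proof (rule image_subsetI)
        fix a :: 'b assume "a \<in> cball 0 r"
        then have a: "norm a \<le> r" by simp
        have "norm (h \<theta> a - a) \<le> norm a / 2"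
          using lip[OF a, of 0 \<theta>] r h0 by simp
        then have "norm (?T a) \<le> r"
          using norm_triangle_ineq[of "a - h \<theta> a" "y \<theta>"] y(2)[of \<theta>] a
          by (simp add: norm_minus_commute algebra_simps)
        then show "?T a \<in> cball 0 r" by simp
      qed
      show "dist (?T a) (?T a') \<le> 1/2 * dist a a'" if "a \<in> cball 0 r" "a' \<in> cball 0 r" for a a'
      proof -
        have "norm (?T a - ?T a') = norm (h \<theta> a - h \<theta> a' - (a - a'))"
          by (subst norm_minus_commute[of "h \<theta> a - h \<theta> a'"]) (simp add: algebra_simps)
        then show ?thesis using lip[of a a' \<theta>] that by (simp add: dist_norm)
      qed
    qed auto
    then obtain a where "a \<in> cball 0 r" "?T a = a" by blast
    then show ?thesis by (intro exI[of _ a]) simp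
  qed
  then obtain a where a: "\<And>\<theta>. norm (a \<theta>) \<le> r" "\<And>\<theta>. h \<theta> (a \<theta>) = y \<theta>" by metis
  show ?thesis
  proof (rule that[of a])
    show "norm (a \<theta>) \<le> 2 * norm (y \<theta>)" for \<theta>
      using exp[OF a(1), of 0 \<theta> \<theta>] r by (simp add: h0 a(2))
    show "a' = a \<theta>" if "norm a' \<le> r" "h \<theta> a' = y \<theta>" for \<theta> a'
      using exp[OF that(1) a(1)[of \<theta>], of \<theta>] that(2) a(2) by simp
    show "continuous_on UNIV a"
    proof (rule continuous_at_imp_continuous_on, rule ballI)
      fix \<theta>0
      have "continuous_on UNIV (\<lambda>\<theta>. y \<theta> - h \<theta> (a \<theta>0))"
        by (intro continuous_intros y hc a)
      then have "isCont (\<lambda>\<theta>. y \<theta> - h \<theta> (a \<theta>0)) \<theta>0"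
        by (simp add: continuous_on_eq_continuous_at)
      then have "((\<lambda>\<theta>. 2 * norm (y \<theta> - h \<theta> (a \<theta>0))) \<longlongrightarrow> 2 * norm (y \<theta>0 - h \<theta>0 (a \<theta>0))) (at \<theta>0)"
        unfolding isCont_def by (intro tendsto_mult_left tendsto_norm)
      then have lim: "((\<lambda>\<theta>. 2 * norm (y \<theta> - h \<theta> (a \<theta>0))) \<longlongrightarrow> 0) (at \<theta>0)"
        by (simp add: a(2))
      have "((\<lambda>\<theta>. a \<theta> - a \<theta>0) \<longlongrightarrow> 0) (at \<theta>0)"
        by (rule Lim_null_comparison[OF _ lim], rule always_eventually, rule allI)
          (use exp[OF a(1) a(1)] in \<open>simp add: a(2)[symmetric]\<close>)
      then show "isCont a \<theta>0" unfolding isCont_def by (rule LIM_zero_cancel)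
    qed
  qed (rule a)
qed

subsection \<open>Invariant whiskered tori\<close>

lemma phase_eq: "phase B = inr_part -` B"
  by (auto simp: phase_def inr_part_def)

lemma open_phase: "open B \<Longrightarrow> open (phase B)"
  unfolding phase_eq
  by (rule open_vimage) (auto intro: linear_continuous_on bounded_linear_inr_part)

lemma phase_shift: "x + zshift k \<in> phase B \<longleftrightarrow> x \<in> phase B"
proof -
  have "inr_part (x + zshift k) = inr_part x"
    by (simp add: inr_part_def zshift_def vec_eq_iff)
  then show ?thesis by (simp add: phase_eq)
qed

text \<open>Lattice shifts that differ by less than 1 coincide; this makes the difference of two
  nearby tori periodic.\<close>

lemma zshift_separated:
  assumes "zshift k \<noteq> zshift l"
  shows "1 \<le> norm (zshift k - zshift l)"
proof -
  have "k \<noteq> l" using assms by blast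
  then obtain i where "k $ i \<noteq> l $ i" by (auto simp: vec_eq_iff)
  then have "1 \<le> \<bar>real_of_int (k $ i) - real_of_int (l $ i)\<bar>" by linarith
  also have "\<dots> = \<bar>(zshift k - zshift l) $ Inl i\<bar>" by (simp add: zshift_def)
  also have "\<dots> \<le> norm (zshift k - zshift l)" by (rule component_le_norm_cart)
  finally show ?thesis .
qed

text \<open>In \<open>torus_map\<close> and \<open>phase_map\<close> the lattice shift may depend on
  the point. Continuity on a connected set makes it constant, after which it drops out of
  derivatives.\<close>

lemma zshift_valued_const:
  assumes "connected S" "continuous_on S g" and g: "\<And>x. x \<in> S \<Longrightarrow> \<exists>l. g x = zshift l"
    and "x \<in> S" "y \<in> S"
  shows "g x = g y"
proof -
  have "(\<lambda>x. g x $ i) constant_on S" for i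
  proof (rule continuous_discrete_range_constant[OF assms(1)])
    show "continuous_on S (\<lambda>x. g x $ i)" by (intro continuous_intros assms(2))
    have int: "\<exists>n. g x $ i = real_of_int n" if x: "x \<in> S" for x
    proof -
      obtain l where l: "g x = zshift l" using g[OF x] by blast
      show ?thesis
      proof (cases i)
        case (Inr b)
        then have "g x $ i = real_of_int 0" by (simp add: l zshift_def)
        then show ?thesis by blast
      qed (auto simp: l zshift_def)
    qed
    fix x assume x: "x \<in> S"
    show "\<exists>e>0. \<forall>y. y \<in> S \<and> g y $ i \<noteq> g x $ i \<longrightarrow> e \<le> norm (g y $ i - g x $ i)"
    proof (intro exI[of _ 1] conjI allI impI)
      fix y assume y: "y \<in> S \<and> g y $ i \<noteq> g x $ i"
      obtain k l where kl: "g x $ i = real_of_int k" "g y $ i = real_of_int l"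
        using int x y by blast
      with y have "1 \<le> \<bar>l - k\<bar>" by auto
      then have "1 \<le> \<bar>real_of_int (l - k)\<bar>" by linarith
      then show "1 \<le> norm (g y $ i - g x $ i)" by (simp add: kl)
    qed simp
  qed
  then show ?thesis using assms(4,5) by (simp add: constant_on_def vec_eq_iff) metis
qed

lemma has_derivative_matrix_unique:
  fixes A A' :: "real^'m^'k"
  assumes "(F has_derivative (\<lambda>h. A *v h)) (at x)" "(F has_derivative (\<lambda>h. A' *v h)) (at x)"
  shows "A = A'"
  using has_derivative_unique[OF assms] by (simp add: matrix_eq fun_eq_iff)

lemma jacobian_eqI:
  fixes A :: "real^'m^'k"
  assumes "(F has_derivative (\<lambda>h. A *v h)) (at x)"
  shows "jacobian F (at x) = A"
  unfolding jacobian_def frechet_derivative_at[OF assms, symmetric]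
  by (rule matrix_of_matrix_vector_mul)

lemma jacobian_translate:
  fixes F :: "real^'m \<Rightarrow> real^'k"
  assumes "F differentiable (at (x + c))" "open U" "x \<in> U" "\<And>y. y \<in> U \<Longrightarrow> F (y + c) = F y + e"
  shows "jacobian F (at (x + c)) = jacobian F (at x)"
proof -
  have "(F has_derivative (\<lambda>h. jacobian F (at (x + c)) *v h)) (at (x + c))"
    using assms(1) jacobian_works by blast
  moreover have "((\<lambda>y. y + c) has_derivative (\<lambda>h. h)) (at x)"
    by (auto intro!: derivative_eq_intros)
  ultimately have "((\<lambda>y. F (y + c)) has_derivative (\<lambda>h. jacobian F (at (x + c)) *v h)) (at x)"
    by (rule has_derivative_compose[rotated])
  then have "((\<lambda>y. F (y + c) - e) has_derivative (\<lambda>h. jacobian F (at (x + c)) *v h)) (at x)"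
    by (auto intro!: derivative_eq_intros)
  then have "(F has_derivative (\<lambda>h. jacobian F (at (x + c)) *v h)) (at x)"
    by (rule has_derivative_transform_within_open[where s = U]) (use assms in auto)
  then show ?thesis using jacobian_eqI by metis
qed

definition re_vec :: "complex^'m \<Rightarrow> real^'m" where
  "re_vec z = (\<chi> i. Re (z $ i))"

definition re_mat :: "complex^'m^'k \<Rightarrow> real^'m^'k" where
  "re_mat A = (\<chi> i j. Re (A $ i $ j))"

lemma re_vec_cvec [simp]: "re_vec (cvec x) = x"
  by (simp add: re_vec_def cvec_def vec_eq_iff)

lemma re_vec_mult: "re_vec (A *v cvec h) = re_mat A *v h"
  by (simp add: re_vec_def re_mat_def cvec_def matrix_vector_mult_def vec_eq_iff)

lemma bounded_linear_re_vec: "bounded_linear re_vec"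
  unfolding linear_conv_bounded_linear[symmetric]
  by (auto simp: linear_iff re_vec_def vec_eq_iff)

text \<open>\<open>analytic_splitting\<close> states periodicity for the three spaces; uniqueness
  carries it over to the projections.\<close>

lemma projection_unique:
  assumes "splitting_at Es Ec Eu Ps Pc Pu" "splitting_at Es Ec Eu Ps' Pc' Pu'"
  shows "Ps = Ps'" "Pc = Pc'" "Pu = Pu'"
proof -
  have "Ps *v v = Ps' *v v \<and> Pc *v v = Pc' *v v \<and> Pu *v v = Pu' *v v" for v
  proof -
    define a b c where "a = Ps *v v" and "b = Pc *v v" and "c = Pu *v v"
    have mem: "a \<in> Es" "b \<in> Ec" "c \<in> Eu" and v: "v = a + b + c"
      using assms(1) unfolding splitting_at_def a_def b_def c_def by metis+
    have "Ps' *v a = a" "Pc' *v a = 0" "Pu' *v a = 0" "Ps' *v b = 0" "Pc' *v b = b" "Pu' *v b = 0"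
      "Ps' *v c = 0" "Pc' *v c = 0" "Pu' *v c = c"
      using assms(2) mem unfolding splitting_at_def by metis+
    then have "Ps' *v v = a" "Pc' *v v = b" "Pu' *v v = c"
      by (simp_all add: v matrix_vector_right_distrib)
    then show ?thesis by (simp add: a_def b_def c_def)
  qed
  then show "Ps = Ps'" "Pc = Pc'" "Pu = Pu'" by (simp_all add: matrix_eq)
qed

text \<open>Collects the data of the first torus, with \<open>r\<close> the width of the strip on
  which it is given. The constants below are produced from this data, which is why they do not
  depend on the second solution.\<close>

locale invariant_torus =
  fixes B :: "(real^'n) set"
    and \<Omega> :: "real^('n::finite+'n) \<Rightarrow> real^('n::finite+'n) \<Rightarrow> real^('n::finite+'n) \<Rightarrow> real"
    and f :: "real^'d \<Rightarrow> real^('n::finite+'n) \<Rightarrow> real^('n::finite+'n)"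
    and K :: "real^'d \<Rightarrow> real^('n::finite+'n)"
    and \<mu> \<omega> :: "real^'d"
    and lam r :: real
    and Es Ec Eu :: "real^'d \<Rightarrow> (real^('n::finite+'n)) set"
    and Ps Pc Pu :: "real^'d \<Rightarrow> real^('n::finite+'n)^('n::finite+'n)"
  assumes open_B: "open B" and symplectic: "symplectic_form B \<Omega>"
    and lam: "0 < lam" "lam < 1"
    and phase_map: "\<And>m. phase_map B (f m)"
    and conformal: "conf_symplectic B \<Omega> lam (f \<mu>)"
    and r: "r > 0"
    and torus: "torus_map B K" and K_analytic: "in_A r K"
    and invariance: "\<And>\<theta>. f \<mu> (K \<theta>) = K (\<theta> + \<omega>)"
    and extends: "extends_near B f \<mu> r K"
    and whiskered: "whiskered_torus (f \<mu>) lam \<omega> K Es Ec Eu Ps Pc Pu"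
    and gram: "\<And>\<theta>. invertible (transpose (DK K \<theta>) ** DK K \<theta>)"
begin

lemma open_phase_B: "open (phase B)"
  by (rule open_phase[OF open_B])

lemma K_in: "K \<theta> \<in> phase B"
  using torus by (simp add: torus_map_def)

lemma f_der: "x \<in> phase B \<Longrightarrow> (f m has_derivative (\<lambda>h. jacobian (f m) (at x) *v h)) (at x)"
  and f_jac_cont: "continuous_on (phase B) (\<lambda>x. jacobian (f m) (at x))"
  using phase_map[of m] real_analytic_on_jacobian[of "f m" "phase B", OF _ open_phase_B]
  by (auto simp: phase_map_def)

lemma f_cont: "continuous_on (phase B) (f m)"
  by (rule continuous_at_imp_continuous_on) (use f_der has_derivative_continuous in blast)

lemma K_der: "(K has_derivative (\<lambda>h. DK K \<theta> *v h)) (at \<theta>)"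
  and DK_cont: "continuous_on UNIV (DK K)"
proof -
  obtain G where "strip_ext r K G" using K_analytic by (auto simp: in_A_def)
  from real_analytic_on_jacobian[OF strip_ext_real_analytic[OF this r] open_UNIV]
  show "(K has_derivative (\<lambda>h. DK K \<theta> *v h)) (at \<theta>)" "continuous_on UNIV (DK K)"
    by (auto simp: DK_def[abs_def])
qed

lemma K_cont: "continuous_on UNIV K"
  by (rule continuous_at_imp_continuous_on) (use K_der has_derivative_continuous in blast)

lemma K_shift: "\<exists>l. \<forall>\<theta>. K (\<theta> + ivec k) = K \<theta> + zshift l"
proof -
  define g where "g = (\<lambda>\<theta>. K (\<theta> + ivec k) - K \<theta>)"
  have g: "\<exists>l. g \<theta> = zshift l" for \<theta>
    using torus by (simp add: g_def torus_map_def) (metis add_diff_cancel_left')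
  have "continuous_on UNIV g"
    unfolding g_def
    by (intro continuous_intros K_cont continuous_on_compose2[OF K_cont]) auto
  then have "g \<theta> = g 0" for \<theta>
    using zshift_valued_const[of UNIV g] g by blast
  moreover obtain l where "g 0 = zshift l" using g by blast
  ultimately have "K (\<theta> + ivec k) = K \<theta> + zshift l" for \<theta>
    by (metis add.commute diff_add_cancel g_def)
  then show ?thesis by blast
qed

lemma DK_periodic: "zperiodic (DK K)"
  unfolding zperiodic_def
proof (intro allI)
  fix \<theta> k
  obtain l where l: "\<And>\<theta>. K (\<theta> + ivec k) = K \<theta> + zshift l"
    using K_shift[of k] by blast
  show "DK K (\<theta> + ivec k) = DK K \<theta>"
    unfolding DK_def
    by (rule jacobian_translate[where U = UNIV and e = "zshift l"])
      (use l differentiableI[OF K_der] in auto)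
qed

lemma f_shift:
  assumes "x \<in> phase B"
  shows "\<exists>l. f m (x + zshift k) = f m x + zshift l"
proof -
  have "\<forall>x\<in>phase B. \<forall>k. \<exists>l. f m (x + zshift k) = f m x + zshift l"
    using phase_map[of m] unfolding phase_map_def by (elim conjE)
  then show ?thesis using assms by simp
qed

lemma f_jac_shift:
  assumes x: "x \<in> phase B"
  shows "jacobian (f m) (at (x + zshift k)) = jacobian (f m) (at x)"
proof -
  obtain e where e: "e > 0" "ball x e \<subseteq> phase B"
    using open_phase_B x open_contains_ball by blast
  define g where "g = (\<lambda>y. f m (y + zshift k) - f m y)"
  have g: "\<exists>l. g y = zshift l" if "y \<in> ball x e" for y
  proof -
    have "y \<in> phase B" using that e by blast
    then obtain l where "f m (y + zshift k) = f m y + zshift l"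
      using f_shift by blast
    then show ?thesis by (auto simp: g_def)
  qed
  have cg: "continuous_on (ball x e) g"
    unfolding g_def
    by (intro continuous_intros continuous_on_compose2[OF f_cont]) (use e phase_shift in auto)
  have "g y = g x" if "y \<in> ball x e" for y
    using zshift_valued_const[OF connected_ball cg g that, of x] e by simp
  then have "f m (y + zshift k) = f m y + g x" if "y \<in> ball x e" for y
    using that by (metis add.commute diff_add_cancel g_def)
  then show ?thesis
    by (intro jacobian_translate[where U = "ball x e" and e = "g x"])
      (use e differentiableI[OF f_der[OF phase_shift[THEN iffD2, OF x]]] in auto)
qed

definition \<gamma> :: "real^'d \<Rightarrow> real^('n+'n)^('n+'n)" where
  "\<gamma> \<theta> = jacobian (f \<mu>) (at (K \<theta>))"

lemma \<gamma>_periodic: "zperiodic \<gamma>"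
  unfolding zperiodic_def \<gamma>_def
proof (intro allI)
  fix \<theta> k
  obtain l where l: "\<And>\<theta>. K (\<theta> + ivec k) = K \<theta> + zshift l"
    using K_shift[of k] by blast
  show "jacobian (f \<mu>) (at (K (\<theta> + ivec k))) = jacobian (f \<mu>) (at (K \<theta>))"
    unfolding l by (rule f_jac_shift[OF K_in])
qed

lemma \<gamma>_cont: "continuous_on UNIV \<gamma>"
  unfolding \<gamma>_def by (rule continuous_on_compose2[OF f_jac_cont K_cont]) (use K_in in auto)

text \<open>The derivative of the invariance equation.\<close>

lemma \<gamma>_DK: "\<gamma> \<theta> *v (DK K \<theta> *v u) = DK K (\<theta> + \<omega>) *v u"
proof -
  have "((\<lambda>\<theta>. f \<mu> (K \<theta>)) has_derivative (\<lambda>h. \<gamma> \<theta> *v (DK K \<theta> *v h))) (at \<theta>)"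
    unfolding \<gamma>_def by (rule has_derivative_compose[OF K_der f_der[OF K_in]])
  then have "((\<lambda>\<theta>. K (\<theta> + \<omega>)) has_derivative (\<lambda>h. (\<gamma> \<theta> ** DK K \<theta>) *v h)) (at \<theta>)"
    by (simp add: invariance matrix_vector_mul_assoc)
  moreover have "((\<lambda>\<theta>. \<theta> + \<omega>) has_derivative (\<lambda>h. h)) (at \<theta>)"
    by (auto intro!: derivative_eq_intros)
  then have "((\<lambda>\<theta>. K (\<theta> + \<omega>)) has_derivative (\<lambda>h. DK K (\<theta> + \<omega>) *v h)) (at \<theta>)"
    by (rule has_derivative_compose[OF _ K_der])
  ultimately have "\<gamma> \<theta> ** DK K \<theta> = DK K (\<theta> + \<omega>)"
    by (rule has_derivative_matrix_unique)
  then show ?thesis by (simp add: matrix_vector_mul_assoc)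
qed

definition w :: "real^'d \<Rightarrow> real^('n+'n) \<Rightarrow> real^('n+'n) \<Rightarrow> real" where
  "w \<theta> = \<Omega> (K \<theta>)"

lemmas symplectic_parts = symplectic[unfolded symplectic_form_def, THEN conjunct1, rule_format]
  symplectic[unfolded symplectic_form_def, THEN conjunct2, THEN conjunct1, rule_format, THEN conjunct1]
  symplectic[unfolded symplectic_form_def, THEN conjunct2, THEN conjunct1, rule_format, THEN conjunct2, rule_format]
  symplectic[unfolded symplectic_form_def, THEN conjunct2, THEN conjunct2, THEN conjunct1, rule_format]
  symplectic[unfolded symplectic_form_def, THEN conjunct2, THEN conjunct2, THEN conjunct2, THEN conjunct2, rule_format]

lemma w_bilinear: "bilinear (w \<theta>)"
  unfolding w_def by (rule symplectic_parts(2)[OF K_in])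

lemma w_antisym: "w \<theta> u v = - w \<theta> v u"
  unfolding w_def by (rule symplectic_parts(3)[OF K_in])

lemma w_nondeg:
  assumes "\<And>u. w \<theta> u x = 0"
  shows "x = 0"
proof (rule ccontr)
  assume "x \<noteq> 0"
  then obtain v where "w \<theta> x v \<noteq> 0"
    using symplectic_parts(4)[OF K_in[of \<theta>]] unfolding w_def by blast
  then show False using w_antisym[of \<theta> x v] assms by simp
qed

lemma w_periodic: "zperiodic w"
  unfolding zperiodic_def w_def
proof (intro allI)
  fix \<theta> k
  obtain l where l: "\<And>\<theta>. K (\<theta> + ivec k) = K \<theta> + zshift l"
    using K_shift[of k] by blast
  show "\<Omega> (K (\<theta> + ivec k)) = \<Omega> (K \<theta>)"
    unfolding l by (rule symplectic_parts(5)[OF K_in])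
qed

lemma w_cont: "continuous_on UNIV (\<lambda>\<theta>. w \<theta> u v)"
  unfolding w_def
  by (rule continuous_on_compose2[OF real_analytic_on_continuous[OF symplectic_parts(1) open_phase_B] K_cont])
    (use K_in in auto)

lemma w_conformal: "w (\<theta> + \<omega>) (\<gamma> \<theta> *v u) (\<gamma> \<theta> *v v) = lam * w \<theta> u v"
  using conformal K_in[of \<theta>] by (simp add: conf_symplectic_def w_def \<gamma>_def flip: invariance)

text \<open>Taking the whole space as \<open>E\<close> gives access to the matrix of the form,
  \<open>Om\<close> below, whose entries are continuous and periodic in \<theta>.\<close>

lemma nondeg_full: "nondeg_subspace (w \<theta>) UNIV (mat 1)"
proof
  show "x = 0" if "\<And>u. u \<in> UNIV \<Longrightarrow> w \<theta> u x = 0" for x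
    using that by (intro w_nondeg) simp
qed (simp_all add: w_bilinear w_antisym[symmetric])

definition Om :: "real^'d \<Rightarrow> real^('n+'n)^('n+'n)" where
  "Om \<theta> = (\<chi> i j. w \<theta> (axis i 1) (axis j 1))"

lemma Om: "u \<bullet> (Om \<theta> *v v) = w \<theta> u v"
  using nondeg_subspace.form_matrix[OF nondeg_full, of u \<theta> v]
  by (simp add: nondeg_subspace.form_matrix_def[OF nondeg_full] Om_def)

lemma Om_cont: "continuous_on UNIV Om"
  unfolding Om_def by (intro continuous_intros w_cont)

lemma Om_periodic: "zperiodic Om"
  using w_periodic by (simp add: zperiodic_def Om_def)

lemma w_bounded: obtains W where "\<And>\<theta> u v. \<bar>w \<theta> u v\<bar> \<le> W * norm u * norm v"
proof -
  obtain W where W: "\<And>\<theta>. norm (Om \<theta>) \<le> W"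
    using zperiodic_bounded[OF Om_cont Om_periodic] by blast
  have "\<bar>w \<theta> u v\<bar> \<le> W * norm u * norm v" for \<theta> u v
  proof -
    have "\<bar>w \<theta> u v\<bar> \<le> norm u * norm (Om \<theta> *v v)"
      unfolding Om[symmetric] by (rule Cauchy_Schwarz_ineq2)
    also have "\<dots> \<le> norm u * (norm (Om \<theta>) * norm v)"
      by (intro mult_left_mono norm_matrix_vector_le) auto
    also have "\<dots> \<le> norm u * (W * norm v)"
      by (intro mult_left_mono mult_right_mono W) auto
    finally show ?thesis by (simp add: ac_simps)
  qed
  with that show ?thesis by blast
qed

text \<open>By conformality a kernel vector pairs to zero with everything, up to the nonzero factor
  \<open>lam\<close>, and the form is nondegenerate.\<close>

lemma \<gamma>_invertible: "invertible (\<gamma> \<theta>)"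
proof -
  have "x = 0" if "\<gamma> \<theta> *v x = 0" for x
  proof (rule w_nondeg)
    show "w \<theta> u x = 0" for u
      using w_conformal[of \<theta> u x] that lam w_bilinear by (simp add: bilinear_rzero)
  qed
  then show ?thesis
    using invertible_left_inverse matrix_left_invertible_ker by blast
qed

lemma whiskered_parts:
  "analytic_splitting Es Ec Eu Ps Pc Pu"
  "E \<in> {Es, Ec, Eu} \<Longrightarrow> (\<lambda>v. \<gamma> \<theta> *v v) ` E \<theta> = E (\<theta> + \<omega>)"
  "dim (Ec \<theta>) = 2 * CARD('d)" "trichotomy lam \<omega> \<gamma> Es Ec Eu"
  using whiskered unfolding whiskered_torus_def Let_def \<gamma>_def[abs_def] by blast+

sublocale split_cocycle \<gamma> \<omega> lam Es Ec Eu Ps Pc Pu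
proof
  show "splitting_at (Es \<theta>) (Ec \<theta>) (Eu \<theta>) (Ps \<theta>) (Pc \<theta>) (Pu \<theta>)" for \<theta>
    using whiskered_parts(1) by (simp add: analytic_splitting_def)
qed (use \<gamma>_invertible whiskered_parts lam in auto)

lemma spaces_periodic: "zperiodic Es" "zperiodic Ec" "zperiodic Eu"
  using whiskered_parts(1) by (auto simp: analytic_splitting_def zperiodic_def)

lemma projections_periodic: "zperiodic Ps" "zperiodic Pc" "zperiodic Pu"
proof -
  have "Ps (\<theta> + ivec k) = Ps \<theta> \<and> Pc (\<theta> + ivec k) = Pc \<theta> \<and> Pu (\<theta> + ivec k) = Pu \<theta>" for \<theta> k
    using projection_unique[OF split[of "\<theta> + ivec k", unfolded spaces_periodic[THEN zperiodicD]] split[of \<theta>]]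
    by simp
  then show "zperiodic Ps" "zperiodic Pc" "zperiodic Pu" by (auto simp: zperiodic_def)
qed

lemma projections_cont: "continuous_on UNIV Ps" "continuous_on UNIV Pc" "continuous_on UNIV Pu"
proof -
  have "continuous_on UNIV P" if P: "P \<in> {Ps, Pc, Pu}" for P
  proof -
    have "real_analytic_on (\<lambda>\<theta>. P \<theta> $ i $ j) UNIV" for i j
      using whiskered_parts(1) P unfolding analytic_splitting_def by blast
    then have "continuous_on UNIV (\<lambda>\<theta>. P \<theta> $ i $ j)" for i j
      using real_analytic_on_continuous open_UNIV by blast
    then have "continuous_on UNIV (\<lambda>\<theta>. \<chi> i j. P \<theta> $ i $ j)"
      by (intro continuous_on_vec_lambda)
    then show ?thesis by simp
  qed
  then show "continuous_on UNIV Ps" "continuous_on UNIV Pc" "continuous_on UNIV Pu" by auto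
qed

lemma G_DK: "G j \<theta> *v (DK K \<theta> *v u) = DK K (\<theta> + real j *\<^sub>R \<omega>) *v u"
proof (induction j)
  case (Suc j)
  have "\<theta> + real (Suc j) *\<^sub>R \<omega> = \<theta> + real j *\<^sub>R \<omega> + \<omega>" by (simp add: algebra_simps)
  then show ?case
    using Suc \<gamma>_DK[of "\<theta> + real j *\<^sub>R \<omega>" u]
    by (simp only: cocycle_nat.simps matrix_vector_mul_assoc[symmetric])
qed simp

text \<open>The cocycle carries \<open>DK K\<close> at one angle to \<open>DK K\<close> at the
  rotated angle, so tangent vectors have orbits bounded in both time directions.\<close>

lemma DK_in_center: "DK K \<theta> *v u \<in> Ec \<theta>"
proof -
  obtain X where X: "\<And>\<theta>. norm (DK K \<theta>) \<le> X"
    using zperiodic_bounded[OF DK_cont DK_periodic] by blast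
  have bd: "norm (DK K \<theta> *v u) \<le> X * norm u" for \<theta>
    using norm_matrix_vector_le[of "DK K \<theta>" u] mult_right_mono[OF X, of "norm u" \<theta>] by simp
  show ?thesis
  proof (rule bounded_orbit_in_center)
    show "norm (G j \<theta> *v (DK K \<theta> *v u)) \<le> X * norm u" for j
      unfolding G_DK by (rule bd)
    show "norm (matrix_inv (G j (\<theta> - real j *\<^sub>R \<omega>)) *v (DK K \<theta> *v u)) \<le> X * norm u" for j
      using G_inv_cancel(1)[of j "\<theta> - real j *\<^sub>R \<omega>" "DK K (\<theta> - real j *\<^sub>R \<omega>) *v u"] bd
      by (simp add: G_DK)
  qed
qed

text \<open>The form pulled back to the torus is multiplied by \<open>lam\<close> under the
  rotation; a bounded function with this property vanishes, by the contraction bound with zero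
  forcing.\<close>

lemma DK_isotropic: "w \<theta> (DK K \<theta> *v u) (DK K \<theta> *v v) = 0"
proof -
  define x where "x = (\<lambda>\<theta>. w \<theta> (DK K \<theta> *v u) (DK K \<theta> *v v))"
  have xc: "continuous_on UNIV x"
    unfolding x_def Om[symmetric] by (intro continuous_intros DK_cont Om_cont)
  have xp: "zperiodic x"
    using w_periodic DK_periodic by (simp add: x_def zperiodic_def)
  obtain X where X: "\<And>\<theta>. norm (x \<theta>) \<le> X" using zperiodic_bounded[OF xc xp] by blast
  have "norm (x \<theta>) \<le> 0 / (1 - lam)"
  proof (rule contraction_recurrence_bound[where g = "\<lambda>_. 0" and \<omega> = \<omega>, OF _ lam X])
    show "x (\<theta> + \<omega>) = lam *\<^sub>R x \<theta> + 0" for \<theta>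
      using w_conformal[of \<theta> "DK K \<theta> *v u" "DK K \<theta> *v v"] by (simp add: x_def \<gamma>_DK)
  qed simp
  then show ?thesis by (simp add: x_def)
qed

text \<open>\<open>Es\<close> and \<open>Eu\<close> are orthogonal to \<open>Ec\<close> by the rate
  conditions, so a vector of \<open>Ec\<close> orthogonal to \<open>Ec\<close> is orthogonal to the
  whole space.\<close>

lemma center_nondeg:
  assumes x: "x \<in> Ec \<theta>" and 0: "\<And>u. u \<in> Ec \<theta> \<Longrightarrow> w \<theta> u x = 0"
  shows "x = 0"
proof (rule w_nondeg)
  fix y
  obtain W where W: "\<And>\<theta> u v. \<bar>w \<theta> u v\<bar> \<le> W * norm u * norm v" using w_bounded by blast
  have "w \<theta> (Ps \<theta> *v y) x = 0" "w \<theta> (Pu \<theta> *v y) x = 0"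
    using center_orthogonal[of w, OF w_conformal W x] splitD(4,6) by blast+
  moreover have "w \<theta> (Pc \<theta> *v y) x = 0" using 0 splitD(5) by blast
  moreover have "w \<theta> y x = w \<theta> (Ps \<theta> *v y + Pc \<theta> *v y + Pu \<theta> *v y) x" by (simp add: splitD(7))
  ultimately show "w \<theta> y x = 0" by (simp add: bilinear_ladd[OF w_bilinear])
qed

section \<open>The symplectic frame over the torus\<close>

sublocale frame: symplectic_frame "w \<theta>" "Ec \<theta>" "Pc \<theta>" "DK K \<theta>" for \<theta>
  by unfold_locales
    (simp_all add: w_bilinear w_antisym[symmetric] splitD DK_in_center gram DK_isotropic whiskered_parts(3) center_nondeg)

definition J :: "real^'d \<Rightarrow> real^('n+'n)^('n+'n)" where
  "J \<theta> = form_inv (w \<theta>) (Ec \<theta>) (Pc \<theta>)"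

definition M :: "real^'d \<Rightarrow> real^('d::finite+'d)^('n+'n)" where
  "M \<theta> = frame (w \<theta>) (Ec \<theta>) (Pc \<theta>) (DK K \<theta>)"

definition Mi :: "real^'d \<Rightarrow> real^('n+'n)^('d::finite+'d)" where
  "Mi \<theta> = frame_inv (w \<theta>) (Ec \<theta>) (Pc \<theta>) (DK K \<theta>)"

definition S :: "real^'d \<Rightarrow> real^'d^'d" where
  "S = S_mat \<Omega> (f \<mu>) lam \<omega> K Ec Pc"

definition D\<mu> :: "real^'d \<Rightarrow> real^'d^('n+'n)" where
  "D\<mu> \<theta> = jacobian (\<lambda>m. f m (K \<theta>)) (at \<mu>)"

definition A :: "real^'d \<Rightarrow> real^'d^('d::finite+'d)" where
  "A = A_mat \<Omega> f \<mu> \<omega> K Ec Pc"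

lemma Mi_eq: "Minv_Pc \<Omega> K Ec Pc = Mi"
  by (simp add: fun_eq_iff Mi_def frame_defs w_def)

lemma A_eq: "A \<theta> = Mi (\<theta> + \<omega>) ** D\<mu> \<theta>"
  by (simp add: A_def A_mat_def Mi_eq D\<mu>_def)

lemma frame_periodic: "zperiodic J" "zperiodic M" "zperiodic Mi"
  using w_periodic spaces_periodic projections_periodic DK_periodic
  by (simp_all add: zperiodic_def J_def M_def Mi_def)

lemma J_cont: "continuous_on UNIV J"
proof -
  have eq: "J \<theta> = matrix_inv (transpose (Pc \<theta>) ** Om \<theta> ** Pc \<theta> +
      transpose (mat 1 - Pc \<theta>) ** (mat 1 - Pc \<theta>)) ** transpose (Pc \<theta>) ** Pc \<theta>" for \<theta>
    unfolding J_def frame.form_inv_eq frame.form_system_def frame.form_matrix_def Om_def ..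
  have "invertible (transpose (Pc \<theta>) ** Om \<theta> ** Pc \<theta> + transpose (mat 1 - Pc \<theta>) ** (mat 1 - Pc \<theta>))" for \<theta>
    using frame.invertible_form_system[of \<theta>] unfolding frame.form_system_def frame.form_matrix_def Om_def .
  then show ?thesis
    unfolding eq[abs_def] by (intro continuous_intros projections_cont Om_cont) auto
qed

lemma N_cont: "continuous_on UNIV (\<lambda>\<theta>. matrix_inv (transpose (DK K \<theta>) ** DK K \<theta>))"
  by (intro continuous_intros DK_cont gram)

lemma M_cont: "continuous_on UNIV M"
proof -
  have c: "continuous_on UNIV (\<lambda>\<theta>. J \<theta> ** DK K \<theta> ** matrix_inv (transpose (DK K \<theta>) ** DK K \<theta>))"
    by (intro continuous_intros N_cont J_cont DK_cont)
  have "continuous_on UNIV (\<lambda>\<theta>. M \<theta> $ i $ j)" for i j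
  proof (cases j)
    case (Inl a)
    then show ?thesis by (simp add: M_def frame_def continuous_intros DK_cont)
  next
    case (Inr b)
    then show ?thesis
      using continuous_on_component[OF continuous_on_component[OF c]]
      by (simp add: M_def frame_def flip: J_def)
  qed
  then have "continuous_on UNIV (\<lambda>\<theta>. \<chi> i j. M \<theta> $ i $ j)"
    by (intro continuous_on_vec_lambda)
  then show ?thesis by simp
qed

lemma Mi_cont: "continuous_on UNIV Mi"
proof -
  have "continuous_on UNIV (\<lambda>\<theta>. matrix_inv (transpose (M \<theta>) ** M \<theta>) ** transpose (M \<theta>) ** Pc \<theta>)"
    by (intro continuous_intros M_cont projections_cont)
      (use frame.invertible_frame_gram in \<open>simp add: M_def\<close>)
  then show ?thesis by (simp add: Mi_def[abs_def] M_def frame.frame_inv_eq)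
qed

lemma S_eq: "S \<theta> = transpose (DK K (\<theta> + \<omega>) ** matrix_inv (transpose (DK K (\<theta> + \<omega>)) ** DK K (\<theta> + \<omega>)))
    ** \<gamma> \<theta> ** J \<theta> ** (DK K \<theta> ** matrix_inv (transpose (DK K \<theta>) ** DK K \<theta>))
  - lam *\<^sub>R (transpose (matrix_inv (transpose (DK K (\<theta> + \<omega>)) ** DK K (\<theta> + \<omega>))) **
     (transpose (DK K (\<theta> + \<omega>)) ** J (\<theta> + \<omega>) ** DK K (\<theta> + \<omega>)) **
     matrix_inv (transpose (DK K (\<theta> + \<omega>)) ** DK K (\<theta> + \<omega>)))"
  unfolding S_def S_mat_def P_mat_def N_mat_def chi_mat_def J_def w_def \<gamma>_def frame_defs ..

lemma continuous_shift: "continuous_on UNIV g \<Longrightarrow> continuous_on UNIV (\<lambda>\<theta>. g (\<theta> + v))"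
  for g :: "real^'d \<Rightarrow> 'b::topological_space"
  by (rule continuous_on_compose2[of UNIV g]) (auto intro: continuous_intros)

lemma S_cont: "continuous_on UNIV S"
  unfolding S_eq[abs_def]
  by (intro continuous_intros N_cont J_cont DK_cont \<gamma>_cont continuous_shift[OF N_cont]
      continuous_shift[OF J_cont] continuous_shift[OF DK_cont])

lemma S_periodic: "zperiodic S"
  unfolding zperiodic_def S_eq
  using zperiodic_shift[OF DK_periodic, of \<omega>] zperiodic_shift[OF frame_periodic(1), of \<omega>]
    DK_periodic frame_periodic(1) \<gamma>_periodic
  by (simp add: zperiodic_def)

text \<open>Automatic reducibility: in the frame the center cocycle is block triangular, neutral
  along the torus and contracting by \<open>lam\<close> in the conjugate direction, with the torsion
  \<open>S\<close> as coupling.\<close>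

lemma reducibility:
  "Mi (\<theta> + \<omega>) *v (\<gamma> \<theta> *v (M \<theta> *v x)) =
    join_parts (inl_part x + S \<theta> *v inr_part x) (lam *\<^sub>R inr_part x)"
  unfolding Mi_def M_def S_eq J_def
proof (rule frame_reducibility)
  show "symplectic_frame (w \<theta>) (Ec \<theta>) (Pc \<theta>) (DK K \<theta>)"
    "symplectic_frame (w (\<theta> + \<omega>)) (Ec (\<theta> + \<omega>)) (Pc (\<theta> + \<omega>)) (DK K (\<theta> + \<omega>))"
    by (rule frame.symplectic_frame_axioms)+
  show "\<gamma> \<theta> *v v \<in> Ec (\<theta> + \<omega>)" if "v \<in> Ec \<theta>" for v
    using invar[of Ec \<theta>] that by auto
qed (use w_conformal \<gamma>_DK in auto)

lemma Mi_facts: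
  "M \<theta> *v (Mi \<theta> *v v) = Pc \<theta> *v v" "Mi \<theta> *v (M \<theta> *v x) = x"
  "Mi \<theta> *v (Pc \<theta> *v v) = Mi \<theta> *v v" "Mi \<theta> *v (DK K \<theta> *v u) = join_parts u 0"
  by (simp_all add: M_def Mi_def frame.frame_frame_inv frame.frame_inv_frame frame.frame_inv_P
      frame.frame_inv_L)

section \<open>Dependence on the parameter\<close>

text \<open>Passes from the complex family in \<open>extends_near\<close> to a real one: at real
  points of the domain that lie in \<open>phase B\<close> the extension agrees with
  \<open>f\<close>, and real parts turn its parameter derivative into a real matrix, still jointly
  continuous.\<close>

lemma parameter_derivative:
  obtains \<epsilon> U J where "\<epsilon> > 0" "open U" "U \<subseteq> phase B" "range K \<subseteq> U" "\<forall>x k. x \<in> U \<longrightarrow> x + zshift k \<in> U"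
    "\<forall>x m. x \<in> U \<longrightarrow> m \<in> ball \<mu> \<epsilon> \<longrightarrow> ((\<lambda>m. f m x) has_derivative (\<lambda>h. J m x *v h)) (at m)"
    "continuous_on (ball \<mu> \<epsilon> \<times> U) (\<lambda>(m, x). J m x)"
proof -
  obtain G U \<epsilon> F D where *: "strip_ext r K G" "open U" "G ` closed_strip r \<subseteq> U"
    "\<forall>z\<in>U. \<forall>k. z + cvec (zshift k) \<in> U" "\<epsilon> > 0"
    and F: "\<forall>m\<in>ball \<mu> \<epsilon>.
           (\<forall>i. holo_on (\<lambda>z. F m z $ i) U) \<and>
           (\<forall>x\<in>phase B. cvec x \<in> U \<longrightarrow> F m (cvec x) = cvec (f m x)) \<and>
           (\<forall>z\<in>U. ((\<lambda>m'. F m' z) has_derivative (\<lambda>h. D m z *v cvec h)) (at m))"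
    and D: "continuous_on (ball \<mu> \<epsilon> \<times> U) (\<lambda>(m, z). (D m z :: complex^'d^('n::finite+'n)))"
    using extends unfolding extends_near_def by (elim exE conjE) (rule that)
  define V where "V = phase B \<inter> cvec -` U"
  show ?thesis
  proof (rule that[of \<epsilon> V "\<lambda>m x. re_mat (D m (cvec x))"])
    have "open (cvec -` U :: (real^('n+'n)) set)"
      by (intro open_vimage *(2) linear_continuous_on bounded_linear_cvec)
    then show "open V" unfolding V_def using open_phase_B by (intro open_Int)
    show "V \<subseteq> phase B" by (simp add: V_def)
    show "range K \<subseteq> V"
    proof (rule image_subsetI)
      fix \<theta> :: "real^'d"
      have "cvec \<theta> \<in> closed_strip r" using r by (auto simp: closed_strip_def cvec_def)
      then have "G (cvec \<theta>) \<in> U" using *(3) by blast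
      then show "K \<theta> \<in> V" using *(1) K_in by (simp add: V_def strip_ext_def)
    qed
    show "\<forall>x k. x \<in> V \<longrightarrow> x + zshift k \<in> V"
      using *(4) by (simp add: V_def phase_shift cvec_add)
    have "((\<lambda>m. f m x) has_derivative (\<lambda>h. re_mat (D m (cvec x)) *v h)) (at m)"
      if x: "x \<in> V" and m: "m \<in> ball \<mu> \<epsilon>" for x m
    proof -
      have "((\<lambda>m'. F m' (cvec x)) has_derivative (\<lambda>h. D m (cvec x) *v cvec h)) (at m)"
        using F m x by (simp add: V_def)
      from bounded_linear.has_derivative[OF bounded_linear_re_vec this]
      have "((\<lambda>m'. re_vec (F m' (cvec x))) has_derivative (\<lambda>h. re_mat (D m (cvec x)) *v h)) (at m)"
        by (simp add: re_vec_mult)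
      then show ?thesis
        by (rule has_derivative_transform_within_open[where s = "ball \<mu> \<epsilon>"])
          (use F m x in \<open>auto simp: V_def\<close>)
    qed
    then show "\<forall>x m. x \<in> V \<longrightarrow> m \<in> ball \<mu> \<epsilon> \<longrightarrow>
        ((\<lambda>m. f m x) has_derivative (\<lambda>h. re_mat (D m (cvec x)) *v h)) (at m)" by blast
    have "continuous_on (ball \<mu> \<epsilon> \<times> V) (\<lambda>p. (\<lambda>(m, z). D m z) (fst p, cvec (snd p)))"
      by (rule continuous_on_compose2[OF D])
        (auto simp: V_def intro!: continuous_intros bounded_linear.continuous_on[OF bounded_linear_cvec])
    then have "continuous_on (ball \<mu> \<epsilon> \<times> V) (\<lambda>p. \<chi> i j. Re (((\<lambda>(m, z). D m z) (fst p, cvec (snd p))) $ i $ j))"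
      by (intro continuous_intros)
    then show "continuous_on (ball \<mu> \<epsilon> \<times> V) (\<lambda>(m, x). re_mat (D m (cvec x)))"
      by (simp add: re_mat_def split_def)
  qed (rule *(5))
qed

lemma D\<mu>_cont: "continuous_on UNIV D\<mu>" and D\<mu>_periodic: "zperiodic D\<mu>"
proof -
  obtain \<epsilon> U J where p: "\<epsilon> > 0" "open U" "U \<subseteq> phase B" "range K \<subseteq> U" "\<forall>x k. x \<in> U \<longrightarrow> x + zshift k \<in> U"
    "\<forall>x m. x \<in> U \<longrightarrow> m \<in> ball \<mu> \<epsilon> \<longrightarrow> ((\<lambda>m. f m x) has_derivative (\<lambda>h. J m x *v h)) (at m)"
    "continuous_on (ball \<mu> \<epsilon> \<times> U) (\<lambda>(m, x). J m x)"
    by (rule parameter_derivative)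
  note p5 = p(5)[rule_format] and p6 = p(6)[rule_format]
  have D: "D\<mu> \<theta> = J \<mu> (K \<theta>)" for \<theta>
    unfolding D\<mu>_def by (rule jacobian_eqI, rule p6) (use p(1,4) in auto)
  have "continuous_on UNIV (\<lambda>\<theta>. (\<lambda>(m, x). J m x) (\<mu>, K \<theta>))"
    by (rule continuous_on_compose2[OF p(7)]) (use p(1,4) K_cont in \<open>auto intro!: continuous_intros\<close>)
  then show "continuous_on UNIV D\<mu>" by (simp add: D[abs_def])
  show "zperiodic D\<mu>"
    unfolding zperiodic_def
  proof (intro allI)
    fix \<theta> k
    obtain l where l: "\<And>\<theta>. K (\<theta> + ivec k) = K \<theta> + zshift l"
    using K_shift[of k] by blast
    define x where "x = K \<theta>"
    have xU: "x \<in> U" "x + zshift l \<in> U" using p(4) p5 by (auto simp: x_def)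
    \<comment> \<open>The lattice shift could vary with the parameter; being continuous in it, it is
      constant on the ball and does not contribute to the derivative.\<close>
    define g where "g = (\<lambda>m. f m (x + zshift l) - f m x)"
    have gl: "\<exists>l. g m = zshift l" for m
    proof -
      have "x \<in> phase B" using xU p(3) by blast
      then obtain l' where "f m (x + zshift l) = f m x + zshift l'"
        using f_shift by blast
      then show ?thesis by (auto simp: g_def)
    qed
    have fm: "continuous_on (ball \<mu> \<epsilon>) (\<lambda>m. f m y)" if "y \<in> U" for y
      by (rule continuous_at_imp_continuous_on) (use p6[OF that] has_derivative_continuous in blast)
    have cg: "continuous_on (ball \<mu> \<epsilon>) g"
      unfolding g_def by (intro continuous_intros fm xU)
    have "g m = g \<mu>" if "m \<in> ball \<mu> \<epsilon>" for m
      using zshift_valued_const[OF connected_ball cg gl that, of \<mu>] p(1) by simp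
    then have eq: "f m (x + zshift l) - g \<mu> = f m x" if "m \<in> ball \<mu> \<epsilon>" for m
      using that by (metis add_diff_cancel_left' diff_add_cancel g_def add.commute)
    have "((\<lambda>m. f m (x + zshift l) - g \<mu>) has_derivative (\<lambda>h. J \<mu> (x + zshift l) *v h)) (at \<mu>)"
      using has_derivative_diff[OF p6[OF xU(2)] has_derivative_const, of \<mu>] p(1) by simp
    then have "((\<lambda>m. f m x) has_derivative (\<lambda>h. J \<mu> (x + zshift l) *v h)) (at \<mu>)"
      by (rule has_derivative_transform_within_open[where s = "ball \<mu> \<epsilon>"]) (use p(1) eq in auto)
    moreover have "((\<lambda>m. f m x) has_derivative (\<lambda>h. J \<mu> x *v h)) (at \<mu>)"
      using p6[OF xU(1)] p(1) by simp
    ultimately have "J \<mu> (x + zshift l) = J \<mu> x" by (rule has_derivative_matrix_unique)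
    then show "D\<mu> (\<theta> + ivec k) = D\<mu> \<theta>" by (simp add: D l x_def)
  qed
qed

lemma A_cont: "continuous_on UNIV A" and A_periodic: "zperiodic A"
proof -
  show "continuous_on UNIV A"
    unfolding A_eq[abs_def] by (intro continuous_intros continuous_shift Mi_cont D\<mu>_cont)
  show "zperiodic A"
    using zperiodic_shift[OF frame_periodic(3), of \<omega>] D\<mu>_periodic by (simp add: zperiodic_def A_eq)
qed

end

lemma top_rows_mult: "top_rows X *v v = inl_part (X *v v)"
  and bottom_rows_mult: "bottom_rows X *v v = inr_part (X *v v)"
  by (simp_all add: top_rows_def bottom_rows_def inl_part_def inr_part_def vec_eq_iff
      matrix_vector_mult_def)

lemma continuous_on_inl_part [continuous_intros]:
  "continuous_on U g \<Longrightarrow> continuous_on U (\<lambda>x. inl_part (g x))"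
  and continuous_on_inr_part [continuous_intros]:
  "continuous_on U g \<Longrightarrow> continuous_on U (\<lambda>x. inr_part (g x))"
  by (simp_all add: bounded_linear.continuous_on[OF bounded_linear_inl_part]
      bounded_linear.continuous_on[OF bounded_linear_inr_part])

lemma parts_add:
  "inl_part (x + y) = inl_part x + inl_part y" "inr_part (x + y) = inr_part x + inr_part y"
  "inl_part (x - y) = inl_part x - inl_part y" "inr_part (x - y) = inr_part x - inr_part y"
  by (simp_all add: inl_part_def inr_part_def vec_eq_iff)

lemma norm_mv_le: "norm A \<le> a \<Longrightarrow> norm x \<le> b \<Longrightarrow> norm (A *v x) \<le> a * b" for A :: "real^'m^'k"
  using norm_matrix_vector_le[of A x] mult_mono[of "norm A" a "norm x" b]
  by (smt (verit) norm_ge_zero)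

context invariant_torus
begin

subsection \<open>Local uniqueness\<close>

text \<open>Uniform over all \<theta> although \<open>K\<close> is only a lift: moving the base
  point into the unit cube changes both values by the same lattice vector, which cancels.\<close>

lemma K_linearization:
  assumes "\<eta> > 0"
  shows "\<exists>s>0. \<forall>\<theta> a a'. norm a < s \<longrightarrow> norm a' < s \<longrightarrow>
    norm (K (\<theta> + a') - K (\<theta> + a) - DK K \<theta> *v (a' - a)) \<le> \<eta> * norm (a' - a)"
proof -
  obtain s where s: "s > 0" "\<forall>\<theta>\<in>cbox 0 1. \<forall>y\<in>ball \<theta> s. \<forall>y'\<in>ball \<theta> s.
       norm (K y' - K y - DK K \<theta> *v (y' - y)) \<le> \<eta> * norm (y' - y)"
    using C1_uniform_linearization[OF compact_cbox subset_UNIV open_UNIV K_der DK_cont assms, of 0 1]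
    by blast
  show ?thesis
  proof (intro exI[of _ s] conjI s(1) allI impI)
    fix \<theta> a a' :: "real^'d" assume a: "norm a < s" "norm a' < s"
    obtain k where k: "\<theta> + ivec k \<in> cbox 0 1" using reduce_to_unit_cube .
    obtain l where l: "\<And>\<theta>. K (\<theta> + ivec k) = K \<theta> + zshift l" using K_shift[of k] by blast
    have sh: "K (\<theta> + ivec k + c) = K (\<theta> + c) + zshift l" for c
      using l[of "\<theta> + c"] by (simp add: ac_simps)
    show "norm (K (\<theta> + a') - K (\<theta> + a) - DK K \<theta> *v (a' - a)) \<le> \<eta> * norm (a' - a)"
      using s(2)[rule_format, OF k, of "\<theta> + ivec k + a" "\<theta> + ivec k + a'"] a
      by (simp add: sh zperiodicD[OF DK_periodic] dist_norm)
  qed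
qed

lemma f_linearization:
  assumes "\<eta> > 0"
  shows "\<exists>s>0. \<forall>\<theta>\<in>cbox 0 1. \<forall>y\<in>ball (K \<theta>) s. \<forall>y'\<in>ball (K \<theta>) s.
    norm (f \<mu> y' - f \<mu> y - \<gamma> \<theta> *v (y' - y)) \<le> \<eta> * norm (y' - y)"
proof -
  have C: "compact (K ` cbox 0 1)" "K ` cbox 0 1 \<subseteq> phase B"
    using compact_continuous_image[OF continuous_on_subset[OF K_cont subset_UNIV] compact_cbox] K_in
    by auto
  show ?thesis
    using C1_uniform_linearization[OF C open_phase_B f_der[where m = \<mu>] f_jac_cont assms]
    unfolding \<gamma>_def by (simp only: ball_simps)
qed

text \<open>Uniform in the point \<open>y\<close> as well: the parameter derivative is jointly
  continuous, hence close to \<open>D\<mu> \<theta>\<close> near the compact set of pairs of \<mu>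
  and a point of the torus.\<close>

lemma parameter_linearization:
  assumes "\<eta> > 0"
  shows "\<exists>s>0. \<forall>\<theta>\<in>cbox 0 1. \<forall>y\<in>ball (K \<theta>) s. \<forall>m\<in>ball \<mu> s.
    norm (f m y - f \<mu> y - D\<mu> \<theta> *v (m - \<mu>)) \<le> \<eta> * norm (m - \<mu>)"
proof -
  obtain \<epsilon> U J where p: "\<epsilon> > 0" "open U" "U \<subseteq> phase B" "range K \<subseteq> U" "\<forall>x k. x \<in> U \<longrightarrow> x + zshift k \<in> U"
    "\<forall>x m. x \<in> U \<longrightarrow> m \<in> ball \<mu> \<epsilon> \<longrightarrow> ((\<lambda>m. f m x) has_derivative (\<lambda>h. J m x *v h)) (at m)"
    "continuous_on (ball \<mu> \<epsilon> \<times> U) (\<lambda>(m, x). J m x)"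
    by (rule parameter_derivative)
  note p6 = p(6)[rule_format]
  have D: "D\<mu> \<theta> = J \<mu> (K \<theta>)" for \<theta>
    unfolding D\<mu>_def by (rule jacobian_eqI, rule p6) (use p(1,4) in auto)
  define C where "C = {\<mu>} \<times> K ` cbox 0 1"
  have C: "compact C" "C \<subseteq> ball \<mu> \<epsilon> \<times> U"
    using compact_continuous_image[OF continuous_on_subset[OF K_cont subset_UNIV] compact_cbox] p(1,4)
    by (auto simp: C_def intro!: compact_Times)
  have o: "open (ball \<mu> \<epsilon> \<times> U)" using p(2) by (intro open_Times) auto
  obtain e where e: "e > 0" "compact (\<Union>x\<in>C. cball x e)" "(\<Union>x\<in>C. cball x e) \<subseteq> ball \<mu> \<epsilon> \<times> U"
    using compact_neighbourhood[OF C(1) o C(2)] .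
  have "uniformly_continuous_on (\<Union>x\<in>C. cball x e) (\<lambda>(m, x). J m x)"
    using compact_uniformly_continuous continuous_on_subset[OF p(7) e(3)] e(2) by blast
  then obtain d where d: "d > 0" "\<And>x x'. x \<in> (\<Union>x\<in>C. cball x e) \<Longrightarrow> x' \<in> (\<Union>x\<in>C. cball x e) \<Longrightarrow>
      dist x' x < d \<Longrightarrow> dist ((\<lambda>(m, x). J m x) x') ((\<lambda>(m, x). J m x) x) < \<eta>"
    using \<open>\<eta> > 0\<close> unfolding uniformly_continuous_on_def by meson
  \<comment> \<open>Halved because the distance in the product is estimated by the sum of the two
    distances.\<close>
  define s where "s = min d e / 2"
  have s: "s > 0" using d e by (simp add: s_def)
  show ?thesis
  proof (intro exI[of _ s] conjI s ballI)
    fix \<theta> y m assume \<theta>: "\<theta> \<in> cbox 0 1" and y: "y \<in> ball (K \<theta>) s" and m: "m \<in> ball \<mu> s"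
    have near: "dist (m', y) (\<mu>, K \<theta>) < min d e" if "m' \<in> ball \<mu> s" for m'
    proof -
      have "dist (m', y) (\<mu>, K \<theta>) \<le> dist m' \<mu> + dist y (K \<theta>)"
        unfolding dist_Pair_Pair by (rule sqrt_sum_squares_le_sum) auto
      also have "\<dots> < s + s" using that y by (simp add: dist_commute)
      finally show ?thesis by (simp add: s_def)
    qed
    have inC: "(\<mu>, K \<theta>) \<in> C" using \<theta> by (simp add: C_def)
    have mem: "(m', y) \<in> (\<Union>x\<in>C. cball x e)" if "m' \<in> ball \<mu> s" for m'
      by (rule UN_I[OF inC]) (use near[OF that] in \<open>simp add: dist_commute\<close>)
    have mem0: "(\<mu>, K \<theta>) \<in> (\<Union>x\<in>C. cball x e)"
      by (rule UN_I[OF inC]) (use e in simp)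
    \<comment> \<open>Subtracting the linear map first leaves a function of \<open>m\<close> whose
      derivative has norm at most \<eta>.\<close>
    have "norm ((f m y - D\<mu> \<theta> *v m) - (f \<mu> y - D\<mu> \<theta> *v \<mu>)) \<le> \<eta> * norm (m - \<mu>)"
    proof (rule differentiable_bound[where S = "ball \<mu> s" and f' = "\<lambda>m' h. J m' y *v h - D\<mu> \<theta> *v h"])
      fix m' assume m': "m' \<in> ball \<mu> s"
      have "((\<lambda>m. f m y) has_derivative (\<lambda>h. J m' y *v h)) (at m')"
        by (rule p6) (use mem[OF m'] e(3) in blast)+
      then show "((\<lambda>m'. f m' y - D\<mu> \<theta> *v m') has_derivative (\<lambda>h. J m' y *v h - D\<mu> \<theta> *v h)) (at m' within ball \<mu> s)"
        by (rule has_derivative_at_withinI[OF has_derivative_diff[OF _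
                bounded_linear_imp_has_derivative[OF matrix_vector_mul_bounded_linear]]])
      have "norm (J m' y - D\<mu> \<theta>) \<le> \<eta>"
        using d(2)[OF mem0 mem[OF m']] near[OF m'] by (simp add: D dist_norm)
      then have "norm ((J m' y - D\<mu> \<theta>) *v h) \<le> \<eta> * norm h" for h by (rule norm_mv_le) simp
      then show "onorm (\<lambda>h. J m' y *v h - D\<mu> \<theta> *v h) \<le> \<eta>"
        by (intro onorm_bound) (use assms in \<open>auto simp: matrix_vector_mult_diff_rdistrib\<close>)
    qed (use m s in auto)
    then show "norm (f m y - f \<mu> y - D\<mu> \<theta> *v (m - \<mu>)) \<le> \<eta> * norm (m - \<mu>)"
      by (simp add: matrix_vector_mult_diff_distrib algebra_simps)
  qed
qed

lemma DK_bounded: obtains X where "X > 0" "\<And>\<theta>. norm (DK K \<theta>) \<le> X"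
  using zperiodic_bounded[OF DK_cont DK_periodic] by blast

text \<open>All matrices are taken at unshifted angles. The error splits into three remainders of
  Lipschitz type, for the point, the parameter and the increment of the angle; this works because
  \<open>f \<mu>\<close> maps \<open>K (\<theta> + a)\<close> exactly to
  \<open>K (\<theta> + \<omega> + a)\<close>.\<close>

lemma linearization:
  assumes "\<eta> > 0"
  shows "\<exists>s>0. \<forall>\<theta>\<in>cbox 0 1. \<forall>a a' y m. norm a < s \<longrightarrow> norm a' < s \<longrightarrow> norm (y - K \<theta>) < s \<longrightarrow>
      norm (m - \<mu>) < s \<longrightarrow>
      norm (f m y - K (\<theta> + \<omega> + a') -
        (\<gamma> \<theta> *v (y - K (\<theta> + a)) + D\<mu> \<theta> *v (m - \<mu>) - DK K (\<theta> + \<omega>) *v (a' - a)))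
      \<le> \<eta> * (norm (y - K (\<theta> + a)) + norm (m - \<mu>) + norm (a' - a))"
proof -
  obtain s1 where s1': "s1 > 0" "\<forall>\<theta> a a'. norm a < s1 \<longrightarrow> norm a' < s1 \<longrightarrow>
    norm (K (\<theta> + a') - K (\<theta> + a) - DK K \<theta> *v (a' - a)) \<le> \<eta> * norm (a' - a)"
    using K_linearization[OF assms] by blast
  obtain s2 where s2': "s2 > 0" "\<forall>\<theta>\<in>cbox 0 1. \<forall>y\<in>ball (K \<theta>) s2. \<forall>y'\<in>ball (K \<theta>) s2.
    norm (f \<mu> y' - f \<mu> y - \<gamma> \<theta> *v (y' - y)) \<le> \<eta> * norm (y' - y)"
    using f_linearization[OF assms] by blast
  obtain s3 where s3': "s3 > 0" "\<forall>\<theta>\<in>cbox 0 1. \<forall>y\<in>ball (K \<theta>) s3. \<forall>m\<in>ball \<mu> s3.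
    norm (f m y - f \<mu> y - D\<mu> \<theta> *v (m - \<mu>)) \<le> \<eta> * norm (m - \<mu>)"
    using parameter_linearization[OF assms] by blast
  note s1 = s1'(1) s1'(2)[rule_format] and s2 = s2'(1) s2'(2)[rule_format]
    and s3 = s3'(1) s3'(2)[rule_format]
  obtain X where X: "X > 0" "\<And>\<theta>. norm (DK K \<theta>) \<le> X" using DK_bounded by blast
  \<comment> \<open>The last entry keeps \<open>K (\<theta> + a)\<close> within \<open>s2\<close> of
    \<open>K \<theta>\<close>, with \<open>\<eta> + X\<close> as a Lipschitz constant of
    \<open>K\<close>.\<close>
  define s where "s = min (min s1 s2) (min s3 (s2 / (\<eta> + X)))"
  have pos: "\<eta> + X > 0" using X assms by simp
  have s: "s > 0" "s \<le> s1" "s \<le> s2" "s \<le> s3" "s \<le> s2 / (\<eta> + X)"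
    using s1 s2 s3 pos by (auto simp: s_def)
  show ?thesis
  proof (intro exI[of _ s] conjI s(1) allI impI ballI)
    fix \<theta> a a' m :: "real^'d" and y :: "real^('n+'n)"
    assume \<theta>: "\<theta> \<in> cbox 0 1" and a: "norm a < s" and a': "norm a' < s" and y: "norm (y - K \<theta>) < s"
      and m: "norm (m - \<mu>) < s"
    let ?x = "K (\<theta> + a)"
    have "norm (?x - K \<theta>) < s2"
    proof -
      have "norm (?x - K \<theta> - DK K \<theta> *v a) \<le> \<eta> * norm a"
        using s1(2)[of 0 a \<theta>] a s by simp
      moreover have "norm (DK K \<theta> *v a) \<le> X * norm a" by (rule norm_mv_le[OF X(2)]) simp
      ultimately have "norm (?x - K \<theta>) \<le> \<eta> * norm a + X * norm a"
        using norm_triangle_ineq[of "?x - K \<theta> - DK K \<theta> *v a" "DK K \<theta> *v a"] by simp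
      also have "\<dots> = (\<eta> + X) * norm a" by (simp add: algebra_simps)
      also have "\<dots> < (\<eta> + X) * (s2 / (\<eta> + X))"
        using a s(5) pos by (intro mult_strict_left_mono) auto
      finally show ?thesis using pos by simp
    qed
    then have 2: "norm (f \<mu> y - f \<mu> ?x - \<gamma> \<theta> *v (y - ?x)) \<le> \<eta> * norm (y - ?x)"
      using y s by (intro s2(2) \<theta>) (auto simp: dist_norm norm_minus_commute)
    have 3: "norm (f m y - f \<mu> y - D\<mu> \<theta> *v (m - \<mu>)) \<le> \<eta> * norm (m - \<mu>)"
      using y m s by (intro s3(2) \<theta>) (auto simp: dist_norm norm_minus_commute)
    have 1: "norm (K (\<theta> + \<omega> + a') - K (\<theta> + \<omega> + a) - DK K (\<theta> + \<omega>) *v (a' - a)) \<le> \<eta> * norm (a' - a)"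
      using a a' s by (intro s1(2)) auto
    have fx: "f \<mu> ?x = K (\<theta> + \<omega> + a)" by (simp add: invariance ac_simps)
    have "f m y - K (\<theta> + \<omega> + a') -
        (\<gamma> \<theta> *v (y - ?x) + D\<mu> \<theta> *v (m - \<mu>) - DK K (\<theta> + \<omega>) *v (a' - a)) =
      (f \<mu> y - f \<mu> ?x - \<gamma> \<theta> *v (y - ?x)) + (f m y - f \<mu> y - D\<mu> \<theta> *v (m - \<mu>))
       - (K (\<theta> + \<omega> + a') - K (\<theta> + \<omega> + a) - DK K (\<theta> + \<omega>) *v (a' - a))" (is "?L = ?u + ?v - ?z")
      unfolding fx by simp
    then have "norm ?L = norm (?u + ?v - ?z)" by (rule arg_cong)
    also have "\<dots> \<le> norm ?u + norm ?v + norm ?z"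
      by (rule order_trans[OF norm_triangle_ineq4 add_right_mono[OF norm_triangle_ineq]])
    also have "\<dots> \<le> \<eta> * norm (y - ?x) + \<eta> * norm (m - \<mu>) + \<eta> * norm (a' - a)"
      by (intro add_mono 1 2 3)
    finally show "norm ?L \<le> \<eta> * (norm (y - ?x) + norm (m - \<mu>) + norm (a' - a))"
      by (simp add: algebra_simps)
  qed
qed

text \<open>The frame is evaluated at \<open>\<theta>\<close> and not at \<open>\<theta> + a\<close>, so that only \<open>K\<close> has to be differentiated
  in \<open>a\<close>.\<close>

definition tangential :: "real^'d \<Rightarrow> real^'d \<Rightarrow> real^'d" where
  "tangential \<theta> a = inl_part (Mi \<theta> *v (K (\<theta> + a) - K \<theta>))"

lemma Mi_bounded: obtains X where "X > 0" "\<And>\<theta>. norm (Mi \<theta>) \<le> X"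
  using zperiodic_bounded[OF Mi_cont frame_periodic(3)] by blast

text \<open>At \<open>a = 0\<close> the derivative is the first block of
  \<open>Mi \<theta> ** DK K \<theta>\<close>, the identity. Accuracy \<open>1 / (2 * X)\<close> for
  \<open>K\<close> against the bound \<open>X\<close> for \<open>Mi\<close> leaves the factor
  1/2.\<close>

lemma tangential_near_identity:
  shows "\<exists>s>0. \<forall>\<theta> a a'. norm a \<le> s \<longrightarrow> norm a' \<le> s \<longrightarrow>
    norm (tangential \<theta> a - tangential \<theta> a' - (a - a')) \<le> norm (a - a') / 2"
proof -
  obtain X where X: "X > 0" "\<And>\<theta>. norm (Mi \<theta>) \<le> X" using Mi_bounded by blast
  then have "1 / (2 * X) > 0" by simp
  then obtain s where s': "s > 0" "\<forall>\<theta> a a'. norm a < s \<longrightarrow> norm a' < s \<longrightarrow>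
    norm (K (\<theta> + a') - K (\<theta> + a) - DK K \<theta> *v (a' - a)) \<le> 1 / (2 * X) * norm (a' - a)"
    using K_linearization by blast
  note s = s'(1) s'(2)[rule_format]
  show ?thesis
  proof (intro exI[of _ "s / 2"] conjI allI impI)
    show "s / 2 > 0" using s by simp
    fix \<theta> a a' :: "real^'d" assume a: "norm a \<le> s / 2" "norm a' \<le> s / 2"
    let ?v = "K (\<theta> + a) - K (\<theta> + a') - DK K \<theta> *v (a - a')"
    have "tangential \<theta> a - tangential \<theta> a' - (a - a') = inl_part (Mi \<theta> *v ?v)"
      by (simp add: tangential_def matrix_vector_mult_diff_distrib[of "Mi \<theta>"] Mi_facts parts_add)
    also have "norm \<dots> \<le> norm (Mi \<theta> *v ?v)" by (rule norm_inl_part_le)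
    also have "\<dots> \<le> X * (1 / (2 * X) * norm (a - a'))"
      by (rule norm_mv_le[OF X(2)]) (use s(2)[of a' a \<theta>] a s(1) in simp)
    also have "\<dots> = norm (a - a') / 2" using X by simp
    finally show "norm (tangential \<theta> a - tangential \<theta> a' - (a - a')) \<le> norm (a - a') / 2" .
  qed
qed

lemma K_diff_periodic: "zperiodic (\<lambda>\<theta>. K (\<theta> + a) - K \<theta>)"
  unfolding zperiodic_def
proof (intro allI)
  fix \<theta> k
  obtain l where l: "\<And>\<theta>. K (\<theta> + ivec k) = K \<theta> + zshift l" using K_shift[of k] by blast
  show "K (\<theta> + ivec k + a) - K (\<theta> + ivec k) = K (\<theta> + a) - K \<theta>"
    using l[of "\<theta> + a"] l[of \<theta>] by (simp add: ac_simps)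
qed

lemma tangential_periodic: "tangential (\<theta> + ivec k) a = tangential \<theta> a"
  unfolding tangential_def
  using zperiodicD[OF K_diff_periodic, of \<theta> k a] zperiodicD[OF frame_periodic(3), of \<theta> k] by simp

lemma tangential_cont: "continuous_on UNIV (\<lambda>\<theta>. tangential \<theta> a)"
  unfolding tangential_def by (intro continuous_intros Mi_cont K_cont continuous_shift)

lemma projections_DK: "Ps \<theta> *v (DK K \<theta> *v u) = 0" "Pu \<theta> *v (DK K \<theta> *v u) = 0"
  using splitD(11,13)[OF DK_in_center] by auto

text \<open>\<open>Mi\<close> sees only the center component; the center projection commutes with
  the cocycle, and \<open>M\<close> reconstructs its values from the coordinates.\<close>

lemma Mi_\<gamma>:
  "Mi (\<theta> + \<omega>) *v (\<gamma> \<theta> *v v) =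
    join_parts (inl_part (Mi \<theta> *v v) + S \<theta> *v inr_part (Mi \<theta> *v v)) (lam *\<^sub>R inr_part (Mi \<theta> *v v))"
proof -
  have "Mi (\<theta> + \<omega>) *v (\<gamma> \<theta> *v v) = Mi (\<theta> + \<omega>) *v (Pc (\<theta> + \<omega>) *v (\<gamma> \<theta> *v v))"
    by (simp add: Mi_facts)
  also have "\<dots> = Mi (\<theta> + \<omega>) *v (\<gamma> \<theta> *v (M \<theta> *v (Mi \<theta> *v v)))"
    by (simp add: projections_equivariant Mi_facts(1))
  finally show ?thesis by (simp add: reducibility)
qed

text \<open>In the frame, \<open>DK K (\<theta> + \<omega>) *v b \<theta>\<close> has coordinates
  \<open>b \<theta>\<close> and 0. As \<open>n\<close> has no first coordinates at either end, the
  first block becomes a formula for \<open>b\<close> and the second a contracting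
  recurrence.\<close>

lemma frame_equations:
  assumes 0: "inl_part (Mi \<theta> *v n \<theta>) = 0" "inl_part (Mi (\<theta> + \<omega>) *v n (\<theta> + \<omega>)) = 0"
    and eq: "n (\<theta> + \<omega>) = \<gamma> \<theta> *v n \<theta> + D\<mu> \<theta> *v \<sigma> - DK K (\<theta> + \<omega>) *v b \<theta> + R \<theta>"
  shows "b \<theta> = S \<theta> *v inr_part (Mi \<theta> *v n \<theta>) + inl_part (A \<theta> *v \<sigma>) + inl_part (Mi (\<theta> + \<omega>) *v R \<theta>)"
    and "inr_part (Mi (\<theta> + \<omega>) *v n (\<theta> + \<omega>)) =
        lam *\<^sub>R inr_part (Mi \<theta> *v n \<theta>) + inr_part (A \<theta> *v \<sigma>) + inr_part (Mi (\<theta> + \<omega>) *v R \<theta>)"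
proof -
  have *: "Mi (\<theta> + \<omega>) *v n (\<theta> + \<omega>) =
      join_parts (S \<theta> *v inr_part (Mi \<theta> *v n \<theta>)) (lam *\<^sub>R inr_part (Mi \<theta> *v n \<theta>)) + A \<theta> *v \<sigma>
      - join_parts (b \<theta>) 0 + Mi (\<theta> + \<omega>) *v R \<theta>"
    unfolding eq
    by (simp add: matrix_vector_right_distrib matrix_vector_mult_diff_distrib Mi_\<gamma> 0 Mi_facts(4) A_eq
        flip: matrix_vector_mul_assoc)
  have "0 = S \<theta> *v inr_part (Mi \<theta> *v n \<theta>) + inl_part (A \<theta> *v \<sigma>) - b \<theta> + inl_part (Mi (\<theta> + \<omega>) *v R \<theta>)"
    using arg_cong[OF *, of inl_part] unfolding 0(2) parts_add join_parts_simps .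
  then show "b \<theta> = S \<theta> *v inr_part (Mi \<theta> *v n \<theta>) + inl_part (A \<theta> *v \<sigma>) + inl_part (Mi (\<theta> + \<omega>) *v R \<theta>)"
    by (simp add: algebra_simps)
  show "inr_part (Mi (\<theta> + \<omega>) *v n (\<theta> + \<omega>)) =
        lam *\<^sub>R inr_part (Mi \<theta> *v n \<theta>) + inr_part (A \<theta> *v \<sigma>) + inr_part (Mi (\<theta> + \<omega>) *v R \<theta>)"
    using arg_cong[OF *, of inr_part] by (simp only: parts_add join_parts_simps diff_0_right)
qed

text \<open>A pointwise consequence of the first block. It serves to eliminate \<open>b\<close> from
  the bound on the remainder, which contains \<open>b\<close> itself.\<close>

lemma increment_estimate:
  "\<exists>C>0. \<forall>n b R \<sigma> \<theta>. inl_part (Mi \<theta> *v n \<theta>) = 0 \<longrightarrow> inl_part (Mi (\<theta> + \<omega>) *v n (\<theta> + \<omega>)) = 0 \<longrightarrow>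
      n (\<theta> + \<omega>) = \<gamma> \<theta> *v n \<theta> + D\<mu> \<theta> *v \<sigma> - DK K (\<theta> + \<omega>) *v b \<theta> + R \<theta> \<longrightarrow>
      norm (b \<theta>) \<le> C * (norm (n \<theta>) + norm \<sigma> + norm (R \<theta>))"
proof -
  obtain BM where BM: "BM > 0" "\<And>\<theta>. norm (Mi \<theta>) \<le> BM" using Mi_bounded by blast
  obtain BS where BS: "BS > 0" "\<And>\<theta>. norm (S \<theta>) \<le> BS"
    using zperiodic_bounded[OF S_cont S_periodic] by blast
  obtain BA where BA: "BA > 0" "\<And>\<theta>. norm (A \<theta>) \<le> BA"
    using zperiodic_bounded[OF A_cont A_periodic] by blast
  define C where "C = BS * BM + BA + BM"
  have C: "C > 0" "BS * BM \<le> C" "BA \<le> C" "BM \<le> C"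
    using BS(1) BA(1) BM(1) by (simp_all add: C_def add_pos_pos)
  show ?thesis
  proof (intro exI[of _ C] conjI C(1) allI impI)
    fix n b R \<sigma> \<theta>
    assume 0: "inl_part (Mi \<theta> *v n \<theta>) = 0" "inl_part (Mi (\<theta> + \<omega>) *v n (\<theta> + \<omega>)) = 0"
      "n (\<theta> + \<omega>) = \<gamma> \<theta> *v n \<theta> + D\<mu> \<theta> *v \<sigma> - DK K (\<theta> + \<omega>) *v b \<theta> + R \<theta>"
    let ?u = "S \<theta> *v inr_part (Mi \<theta> *v n \<theta>)" and ?v = "inl_part (A \<theta> *v \<sigma>)"
      and ?z = "inl_part (Mi (\<theta> + \<omega>) *v R \<theta>)"
    have 1: "norm ?u \<le> BS * (BM * norm (n \<theta>))"
      by (rule norm_mv_le[OF BS(2)], rule order_trans[OF norm_inr_part_le norm_mv_le[OF BM(2)]]) simp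
    have 2: "norm ?v \<le> BA * norm \<sigma>"
      by (rule order_trans[OF norm_inl_part_le norm_mv_le[OF BA(2)]]) simp
    have 3: "norm ?z \<le> BM * norm (R \<theta>)"
      by (rule order_trans[OF norm_inl_part_le norm_mv_le[OF BM(2)]]) simp
    have "norm (b \<theta>) \<le> norm ?u + norm ?v + norm ?z"
      unfolding frame_equations(1)[where n = n and b = b and R = R, OF 0]
      using norm_triangle_ineq[of "?u + ?v" ?z] norm_triangle_ineq[of ?u ?v] by linarith
    also have "\<dots> \<le> (BS * BM) * norm (n \<theta>) + BA * norm \<sigma> + BM * norm (R \<theta>)"
      using 1 2 3 by simp
    also have "\<dots> \<le> C * norm (n \<theta>) + C * norm \<sigma> + C * norm (R \<theta>)"
      by (intro add_mono mult_right_mono C) auto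
    finally show "norm (b \<theta>) \<le> C * (norm (n \<theta>) + norm \<sigma> + norm (R \<theta>))" by (simp add: algebra_simps)
  qed
qed

text \<open>Here \<open>n\<close> is a displacement without tangential component, \<open>b\<close> the increment along the rotation
  of the reparametrization that has absorbed that component, and \<open>\<sigma>\<close> the parameter shift.\<close>

lemma linear_estimate:
  assumes det: "det (nondeg_mat \<Omega> f \<mu> lam \<omega> K Ec Pc) \<noteq> 0"
  shows "\<exists>C>0. \<forall>n b R \<sigma> E. continuous_on UNIV n \<longrightarrow> zperiodic n \<longrightarrow> continuous_on UNIV b \<longrightarrow>
      torus_avg b = 0 \<longrightarrow> (\<forall>\<theta>. inl_part (Mi \<theta> *v n \<theta>) = 0) \<longrightarrow>
      (\<forall>\<theta>. n (\<theta> + \<omega>) = \<gamma> \<theta> *v n \<theta> + D\<mu> \<theta> *v \<sigma> - DK K (\<theta> + \<omega>) *v b \<theta> + R \<theta>) \<longrightarrow>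
      (\<forall>\<theta>. norm (R \<theta>) \<le> E) \<longrightarrow> norm \<sigma> \<le> C * E \<and> (\<forall>\<theta>. norm (n \<theta>) \<le> C * E)"
proof -
  define A1 A2 where "A1 = (\<lambda>\<theta>. top_rows (A \<theta>))" and "A2 = (\<lambda>\<theta>. bottom_rows (A \<theta>))"
  have A1c: "continuous_on UNIV A1" and A2c: "continuous_on UNIV A2"
    unfolding A1_def A2_def top_rows_def bottom_rows_def by (intro continuous_intros A_cont)+
  have A2p: "zperiodic A2" using A_periodic by (simp add: zperiodic_def A2_def)
  have det': "det (block_mat (torus_avg S) (torus_avg (\<lambda>\<theta>. S \<theta> ** Wb lam \<omega> A2 \<theta>) + torus_avg A1)
      ((lam - 1) *\<^sub>R mat 1) (torus_avg A2)) \<noteq> 0"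
    using det by (simp add: nondeg_mat_def Let_def S_def A_def A1_def A2_def)
  obtain Cc where Cc: "Cc > 0"
    "\<forall>w \<sigma> r1 E. continuous_on UNIV w \<longrightarrow> zperiodic w \<longrightarrow> continuous_on UNIV r1 \<longrightarrow>
      torus_avg (\<lambda>\<theta>. S \<theta> *v w \<theta> + A1 \<theta> *v \<sigma> + r1 \<theta>) = 0 \<longrightarrow> (\<forall>\<theta>. norm (r1 \<theta>) \<le> E) \<longrightarrow>
      (\<forall>\<theta>. norm (w (\<theta> + \<omega>) - (lam *\<^sub>R w \<theta> + A2 \<theta> *v \<sigma>)) \<le> E) \<longrightarrow>
      norm \<sigma> \<le> Cc * E \<and> (\<forall>\<theta>. norm (w \<theta>) \<le> Cc * E)"
    using center_estimate[OF S_cont S_periodic A1c A2c A2p lam det'] by blast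
  obtain Cs where Cs: "Cs > 0"
    "\<forall>x g X D. (\<forall>\<theta>. x \<theta> \<in> Es \<theta>) \<longrightarrow> (\<forall>\<theta>. x (\<theta> + \<omega>) = \<gamma> \<theta> *v x \<theta> + g \<theta>) \<longrightarrow>
      (\<forall>\<theta>. norm (x \<theta>) \<le> X) \<longrightarrow> (\<forall>\<theta>. norm (g \<theta>) \<le> D) \<longrightarrow> (\<forall>\<theta>. norm (x \<theta>) \<le> Cs * D)"
    using stable_estimate by blast
  obtain Cu where Cu: "Cu > 0"
    "\<forall>x g X D. (\<forall>\<theta>. x \<theta> \<in> Eu \<theta>) \<longrightarrow> (\<forall>\<theta>. x (\<theta> + \<omega>) = \<gamma> \<theta> *v x \<theta> + g \<theta>) \<longrightarrow>
      (\<forall>\<theta>. norm (x \<theta>) \<le> X) \<longrightarrow> (\<forall>\<theta>. norm (g \<theta>) \<le> D) \<longrightarrow> (\<forall>\<theta>. norm (x \<theta>) \<le> Cu * D)"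
    using unstable_estimate by blast
  obtain BM where BM: "BM > 0" "\<And>\<theta>. norm (Mi \<theta>) \<le> BM" using Mi_bounded by blast
  obtain BF where BF: "BF > 0" "\<And>\<theta>. norm (M \<theta>) \<le> BF"
    using zperiodic_bounded[OF M_cont frame_periodic(2)] by blast
  obtain BD where BD: "BD > 0" "\<And>\<theta>. norm (D\<mu> \<theta>) \<le> BD"
    using zperiodic_bounded[OF D\<mu>_cont D\<mu>_periodic] by blast
  obtain BP where BP: "BP > 0" "\<And>\<theta>. norm (Ps \<theta>) \<le> BP"
    using zperiodic_bounded[OF projections_cont(1) projections_periodic(1)] by blast
  obtain BQ where BQ: "BQ > 0" "\<And>\<theta>. norm (Pu \<theta>) \<le> BQ"
    using zperiodic_bounded[OF projections_cont(3) projections_periodic(3)] by blast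
  \<comment> \<open>\<open>c1\<close> bounds \<sigma> and the conjugate center coordinate,
    \<open>c2\<close> the forcing term of the stable and unstable components.\<close>
  define c1 where "c1 = Cc * BM"
  define c2 where "c2 = BD * c1 + 1"
  define C where "C = c1 + (BF * c1 + Cs * (BP * c2) + Cu * (BQ * c2))"
  have c: "c1 > 0" "c2 > 0" using Cc(1) BM(1) BD(1) by (auto simp: c1_def c2_def add_pos_pos)
  then have cpos: "BF * c1 + Cs * (BP * c2) + Cu * (BQ * c2) > 0"
    using Cs(1) Cu(1) BF(1) BP(1) BQ(1) by (simp add: add_pos_pos)
  show ?thesis
  proof (intro exI[of _ C] conjI[of "0 < _"] allI impI)
    show "C > 0" using c cpos by (simp add: C_def)
    fix n b R \<sigma> E
    assume n: "continuous_on UNIV n" "zperiodic n" and b: "continuous_on UNIV b" "torus_avg b = 0"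
      and hyps: "\<forall>\<theta>. inl_part (Mi \<theta> *v n \<theta>) = 0"
        "\<forall>\<theta>. n (\<theta> + \<omega>) = \<gamma> \<theta> *v n \<theta> + D\<mu> \<theta> *v \<sigma> - DK K (\<theta> + \<omega>) *v b \<theta> + R \<theta>"
        "\<forall>\<theta>. norm (R \<theta>) \<le> E"
    note 0 = hyps(1)[rule_format] and eq = hyps(2)[rule_format] and R = hyps(3)[rule_format]
    have E: "E \<ge> 0" using order_trans[OF norm_ge_zero R] .
    note fe = frame_equations[where n = n and R = R and b = b, OF 0 0 eq]
    define v where "v = (\<lambda>\<theta>. inr_part (Mi \<theta> *v n \<theta>))"
    define r1 where "r1 = (\<lambda>\<theta>. b \<theta> - (S \<theta> *v v \<theta> + A1 \<theta> *v \<sigma>))"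
    have vc: "continuous_on UNIV v" and vp: "zperiodic v"
      unfolding v_def using n frame_periodic(3)
      by (auto simp: zperiodic_def intro!: continuous_intros Mi_cont)
    have r1: "r1 \<theta> = inl_part (Mi (\<theta> + \<omega>) *v R \<theta>)" for \<theta>
      using fe(1)[of \<theta>] by (simp add: r1_def v_def A1_def top_rows_mult)
    have r1c: "continuous_on UNIV r1"
      unfolding r1_def by (intro continuous_intros b S_cont vc A1c)
    \<comment> \<open>Since \<open>r1\<close> is defined as what is missing to \<open>b\<close>, the
      mean that has to vanish is the mean of \<open>b\<close>.\<close>
    have "norm \<sigma> \<le> Cc * (BM * E) \<and> (\<forall>\<theta>. norm (v \<theta>) \<le> Cc * (BM * E))"
    proof (rule Cc(2)[rule_format, OF vc vp r1c])
      show "torus_avg (\<lambda>\<theta>. S \<theta> *v v \<theta> + A1 \<theta> *v \<sigma> + r1 \<theta>) = 0"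
        using b(2) by (simp add: r1_def)
      show "norm (r1 \<theta>) \<le> BM * E" for \<theta>
        unfolding r1 by (rule order_trans[OF norm_inl_part_le norm_mv_le[OF BM(2) R]])
      show "norm (v (\<theta> + \<omega>) - (lam *\<^sub>R v \<theta> + A2 \<theta> *v \<sigma>)) \<le> BM * E" for \<theta>
      proof -
        have "v (\<theta> + \<omega>) - (lam *\<^sub>R v \<theta> + A2 \<theta> *v \<sigma>) = inr_part (Mi (\<theta> + \<omega>) *v R \<theta>)"
          using fe(2)[of \<theta>] by (simp add: v_def A2_def bottom_rows_mult)
        then show ?thesis
          using order_trans[OF norm_inr_part_le norm_mv_le[OF BM(2) R], of "\<theta> + \<omega>" \<theta>] by simp
      qed
    qed
    then have \<sigma>E: "norm \<sigma> \<le> c1 * E" and vE: "\<And>\<theta>. norm (v \<theta>) \<le> c1 * E"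
      by (auto simp: c1_def mult.assoc)
    have gE: "norm (D\<mu> \<theta> *v \<sigma> + R \<theta>) \<le> c2 * E" for \<theta>
    proof -
      have "norm (D\<mu> \<theta> *v \<sigma>) \<le> BD * (c1 * E)" by (rule norm_mv_le[OF BD(2) \<sigma>E])
      then show ?thesis
        using norm_triangle_ineq[of "D\<mu> \<theta> *v \<sigma>" "R \<theta>"] R[of \<theta>] by (simp add: c2_def algebra_simps)
    qed
    have cont: "continuous_on UNIV (\<lambda>\<theta>. P \<theta> *v n \<theta>)" "zperiodic (\<lambda>\<theta>. P \<theta> *v n \<theta>)"
      if "continuous_on UNIV P" "zperiodic P" for P :: "real^'d \<Rightarrow> real^('n+'n)^('n+'n)"
      using that n by (auto simp: zperiodic_def intro!: continuous_intros)
    obtain Xs where Xs: "\<And>\<theta>. norm (Ps \<theta> *v n \<theta>) \<le> Xs"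
      using zperiodic_bounded[OF cont[OF projections_cont(1) projections_periodic(1)]] by blast
    obtain Xu where Xu: "\<And>\<theta>. norm (Pu \<theta> *v n \<theta>) \<le> Xu"
      using zperiodic_bounded[OF cont[OF projections_cont(3) projections_periodic(3)]] by blast
    \<comment> \<open>The term with \<open>b\<close> is tangent to the torus and is annihilated by
      the stable and the unstable projection.\<close>
    have sE: "norm (Ps \<theta> *v n \<theta>) \<le> Cs * (BP * (c2 * E))" for \<theta>
    proof (rule Cs(2)[rule_format, where x = "\<lambda>\<theta>. Ps \<theta> *v n \<theta>" and X = Xs])
      show "Ps (\<theta> + \<omega>) *v n (\<theta> + \<omega>) = \<gamma> \<theta> *v (Ps \<theta> *v n \<theta>) + Ps (\<theta> + \<omega>) *v (D\<mu> \<theta> *v \<sigma> + R \<theta>)" for \<theta>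
        unfolding eq
        by (simp add: matrix_vector_right_distrib matrix_vector_mult_diff_distrib projections_equivariant
            projections_DK)
      show "norm (Ps (\<theta> + \<omega>) *v (D\<mu> \<theta> *v \<sigma> + R \<theta>)) \<le> BP * (c2 * E)" for \<theta>
        by (rule norm_mv_le[OF BP(2) gE])
    qed (use splitD Xs in auto)
    have uE: "norm (Pu \<theta> *v n \<theta>) \<le> Cu * (BQ * (c2 * E))" for \<theta>
    proof (rule Cu(2)[rule_format, where x = "\<lambda>\<theta>. Pu \<theta> *v n \<theta>" and X = Xu])
      show "Pu (\<theta> + \<omega>) *v n (\<theta> + \<omega>) = \<gamma> \<theta> *v (Pu \<theta> *v n \<theta>) + Pu (\<theta> + \<omega>) *v (D\<mu> \<theta> *v \<sigma> + R \<theta>)" for \<theta>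
        unfolding eq
        by (simp add: matrix_vector_right_distrib matrix_vector_mult_diff_distrib projections_equivariant
            projections_DK)
      show "norm (Pu (\<theta> + \<omega>) *v (D\<mu> \<theta> *v \<sigma> + R \<theta>)) \<le> BQ * (c2 * E)" for \<theta>
        by (rule norm_mv_le[OF BQ(2) gE])
    qed (use splitD Xu in auto)
    have nE: "norm (n \<theta>) \<le> C * E" for \<theta>
    proof -
      have "norm (Mi \<theta> *v n \<theta>) \<le> c1 * E"
        using norm_join_parts_le[of "Mi \<theta> *v n \<theta>"] 0[of \<theta>] vE[of \<theta>] by (simp add: v_def)
      then have "norm (Pc \<theta> *v n \<theta>) \<le> BF * (c1 * E)"
        unfolding Mi_facts(1)[symmetric] by (rule norm_mv_le[OF BF(2)])
      moreover have "norm (n \<theta>) \<le> norm (Ps \<theta> *v n \<theta>) + norm (Pc \<theta> *v n \<theta>) + norm (Pu \<theta> *v n \<theta>)"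
        using splitD(7)[of \<theta> "n \<theta>"] norm_triangle_ineq[of "Ps \<theta> *v n \<theta> + Pc \<theta> *v n \<theta>" "Pu \<theta> *v n \<theta>"]
          norm_triangle_ineq[of "Ps \<theta> *v n \<theta>" "Pc \<theta> *v n \<theta>"] by simp
      ultimately have "norm (n \<theta>) \<le> (BF * c1 + Cs * (BP * c2) + Cu * (BQ * c2)) * E"
        using sE[of \<theta>] uE[of \<theta>] by (simp add: algebra_simps)
      also have "\<dots> \<le> C * E"
        using c cpos E by (intro mult_right_mono) (auto simp: C_def)
      finally show ?thesis .
    qed
    have "c1 * E \<le> C * E" using c cpos E by (intro mult_right_mono) (auto simp: C_def)
    then show "norm \<sigma> \<le> C * E \<and> (\<forall>\<theta>. norm (n \<theta>) \<le> C * E)"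
      using \<sigma>E nE by auto
  qed
qed

end

section \<open>Closing the nonlinear argument\<close>

context invariant_torus
begin

text \<open>The linear estimate bounds \<open>n\<close> and \<sigma> by the remainder, and the
  remainder is at most a small multiple of \<open>n\<close> and \<sigma>; the constants are arranged
  so that the two bounds combine to a factor 1/2. The radius \<open>e\<close> is fixed before
  \<open>K2\<close> and \<open>\<mu>2\<close> appear.\<close>

lemma local_uniqueness:
  assumes nonres: "nonresonant \<omega>" and det: "det (nondeg_mat \<Omega> f \<mu> lam \<omega> K Ec Pc) \<noteq> 0"
  shows "\<exists>e>0. \<forall>K2 \<mu>2. torus_map B K2 \<longrightarrow> continuous_on UNIV K2 \<longrightarrow>
    (\<forall>\<theta>. f \<mu>2 (K2 \<theta>) = K2 (\<theta> + \<omega>)) \<longrightarrow>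
    (\<forall>\<theta>. norm (Mi \<theta> *v (K2 \<theta> - K \<theta>)) \<le> e) \<longrightarrow> (\<forall>\<theta>. norm (Ps \<theta> *v (K2 \<theta> - K \<theta>)) \<le> e) \<longrightarrow>
    (\<forall>\<theta>. norm (Pu \<theta> *v (K2 \<theta> - K \<theta>)) \<le> e) \<longrightarrow> norm (\<mu>2 - \<mu>) \<le> e \<longrightarrow>
    torus_avg (\<lambda>\<theta>. inl_part (Mi \<theta> *v (K2 \<theta> - K \<theta>))) = 0 \<longrightarrow> K2 = K \<and> \<mu>2 = \<mu>"
proof -
  obtain C1 where C1: "C1 > 0"
    "\<forall>n b R \<sigma> E. continuous_on UNIV n \<longrightarrow> zperiodic n \<longrightarrow> continuous_on UNIV b \<longrightarrow>
      torus_avg b = 0 \<longrightarrow> (\<forall>\<theta>. inl_part (Mi \<theta> *v n \<theta>) = 0) \<longrightarrow>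
      (\<forall>\<theta>. n (\<theta> + \<omega>) = \<gamma> \<theta> *v n \<theta> + D\<mu> \<theta> *v \<sigma> - DK K (\<theta> + \<omega>) *v b \<theta> + R \<theta>) \<longrightarrow>
      (\<forall>\<theta>. norm (R \<theta>) \<le> E) \<longrightarrow> norm \<sigma> \<le> C1 * E \<and> (\<forall>\<theta>. norm (n \<theta>) \<le> C1 * E)"
    using linear_estimate[OF det] by blast
  obtain C2 where C2: "C2 > 0"
    "\<forall>n b R \<sigma> \<theta>. inl_part (Mi \<theta> *v n \<theta>) = 0 \<longrightarrow> inl_part (Mi (\<theta> + \<omega>) *v n (\<theta> + \<omega>)) = 0 \<longrightarrow>
      n (\<theta> + \<omega>) = \<gamma> \<theta> *v n \<theta> + D\<mu> \<theta> *v \<sigma> - DK K (\<theta> + \<omega>) *v b \<theta> + R \<theta> \<longrightarrow>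
      norm (b \<theta>) \<le> C2 * (norm (n \<theta>) + norm \<sigma> + norm (R \<theta>))"
    using increment_estimate by blast
  \<comment> \<open>The first entry absorbs the remainder that reappears through \<open>b\<close>.
    The second closes the loop: with \<open>E\<close> as below, \<open>2 * (C1 * E)\<close> is at
    most half of \<open>N + norm \<sigma>\<close>.\<close>
  define \<eta> where "\<eta> = min (1 / (2 * C2)) (1 / (8 * C1 * (1 + C2)))"
  have \<eta>: "\<eta> > 0" "\<eta> * C2 \<le> 1 / 2" "8 * C1 * (1 + C2) * \<eta> \<le> 1"
  proof -
    show "\<eta> > 0" using C1(1) C2(1) by (simp add: \<eta>_def)
    have "\<eta> \<le> 1 / (2 * C2)" by (simp add: \<eta>_def)
    then show "\<eta> * C2 \<le> 1 / 2" using C2(1) by (simp add: field_simps)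
    have "\<eta> \<le> 1 / (8 * C1 * (1 + C2))" unfolding \<eta>_def by (rule min.cobounded2)
    moreover have "8 * C1 * (1 + C2) > 0" using C1(1) C2(1) by simp
    ultimately show "8 * C1 * (1 + C2) * \<eta> \<le> 1"
      by (simp only: pos_le_divide_eq mult.commute)
  qed
  obtain s where s: "s > 0"
    "\<forall>\<theta>\<in>cbox 0 1. \<forall>a a' y m. norm a < s \<longrightarrow> norm a' < s \<longrightarrow> norm (y - K \<theta>) < s \<longrightarrow>
      norm (m - \<mu>) < s \<longrightarrow>
      norm (f m y - K (\<theta> + \<omega> + a') -
        (\<gamma> \<theta> *v (y - K (\<theta> + a)) + D\<mu> \<theta> *v (m - \<mu>) - DK K (\<theta> + \<omega>) *v (a' - a)))
      \<le> \<eta> * (norm (y - K (\<theta> + a)) + norm (m - \<mu>) + norm (a' - a))"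
    using linearization[OF \<eta>(1)] by blast
  obtain r0 where r0: "r0 > 0" "\<forall>\<theta> a a'. norm a \<le> r0 \<longrightarrow> norm a' \<le> r0 \<longrightarrow>
    norm (tangential \<theta> a - tangential \<theta> a' - (a - a')) \<le> norm (a - a') / 2"
    using tangential_near_identity by blast
  obtain BF where BF: "BF > 0" "\<And>\<theta>. norm (M \<theta>) \<le> BF"
    using zperiodic_bounded[OF M_cont frame_periodic(2)] by blast
  \<comment> \<open>At most 1/2, so that two displacements differ by less than 1, the minimal
    distance of lattice shifts.\<close>
  define t where "t = min s (1 / 2)"
  \<comment> \<open>The displacement is at most \<open>(BF + 2) * e\<close>: the center part, read
    through \<open>M\<close>, and the two hyperbolic parts. The larger constant yields strict
    inequalities, and \<open>r0 / 2\<close> is the range in which the reparametrization can be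
    solved for.\<close>
  define e where "e = min (r0 / 2) (t / (2 * (BF + 3)))"
  have t: "t > 0" "t \<le> s" "t \<le> 1 / 2" using s by (simp_all add: t_def)
  have e: "e > 0" "e \<le> r0 / 2" "2 * ((BF + 3) * e) \<le> t"
  proof -
    show "e > 0" using t(1) r0(1) BF(1) by (simp add: e_def)
    show "e \<le> r0 / 2" unfolding e_def by (rule min.cobounded1)
    have "e \<le> t / (2 * (BF + 3))" by (simp add: e_def)
    then show "2 * ((BF + 3) * e) \<le> t" using BF(1) by (simp add: field_simps)
  qed
  have es: "2 * e < t" "(BF + 2) * e < t"
  proof -
    have "BF * e > 0" using BF(1) e(1) by simp
    then have "2 * ((BF + 3) * e) > 2 * e" "2 * ((BF + 3) * e) > (BF + 2) * e"
      using e(1) by (simp_all add: algebra_simps)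
    then show "2 * e < t" "(BF + 2) * e < t" using e(3) by linarith+
  qed
  show ?thesis
  proof (intro exI[of _ e] conjI[of "0 < _"] e(1) allI impI)
    fix K2 \<mu>2
    assume K2: "torus_map B K2" "continuous_on UNIV K2" and inv2': "\<forall>\<theta>. f \<mu>2 (K2 \<theta>) = K2 (\<theta> + \<omega>)"
      and small': "\<forall>\<theta>. norm (Mi \<theta> *v (K2 \<theta> - K \<theta>)) \<le> e" "\<forall>\<theta>. norm (Ps \<theta> *v (K2 \<theta> - K \<theta>)) \<le> e"
        "\<forall>\<theta>. norm (Pu \<theta> *v (K2 \<theta> - K \<theta>)) \<le> e"
      and \<sigma>e: "norm (\<mu>2 - \<mu>) \<le> e" and avg0: "torus_avg (\<lambda>\<theta>. inl_part (Mi \<theta> *v (K2 \<theta> - K \<theta>))) = 0"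
    note inv2 = inv2'[rule_format] and small = small'[rule_format]
    define \<Delta> where "\<Delta> = (\<lambda>\<theta>. K2 \<theta> - K \<theta>)"
    have \<Delta>c: "continuous_on UNIV \<Delta>" unfolding \<Delta>_def by (intro continuous_intros K2 K_cont)
    have \<Delta>: "norm (\<Delta> \<theta>) < t" for \<theta>
    proof -
      have "norm (Pc \<theta> *v \<Delta> \<theta>) \<le> BF * e"
        unfolding Mi_facts(1)[symmetric] \<Delta>_def by (rule norm_mv_le[OF BF(2) small(1)])
      moreover have "norm (\<Delta> \<theta>) \<le> norm (Ps \<theta> *v \<Delta> \<theta>) + norm (Pc \<theta> *v \<Delta> \<theta>) + norm (Pu \<theta> *v \<Delta> \<theta>)"
        using splitD(7)[of \<theta> "\<Delta> \<theta>"] norm_triangle_ineq[of "Ps \<theta> *v \<Delta> \<theta> + Pc \<theta> *v \<Delta> \<theta>" "Pu \<theta> *v \<Delta> \<theta>"]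
          norm_triangle_ineq[of "Ps \<theta> *v \<Delta> \<theta>" "Pc \<theta> *v \<Delta> \<theta>"] by simp
      moreover have "norm (Ps \<theta> *v \<Delta> \<theta>) \<le> e" "norm (Pu \<theta> *v \<Delta> \<theta>) \<le> e"
        unfolding \<Delta>_def by (rule small)+
      ultimately have "norm (\<Delta> \<theta>) \<le> (BF + 2) * e" by (simp add: algebra_simps)
      then show ?thesis using es(2) by simp
    qed
    have \<Delta>p: "zperiodic \<Delta>"
      unfolding zperiodic_def
    proof (intro allI)
      fix \<theta> k
      obtain l where l: "K (\<theta> + ivec k) = K \<theta> + zshift l" using K_shift[of k] by blast
      obtain l2 where l2: "K2 (\<theta> + ivec k) = K2 \<theta> + zshift l2"
        using K2(1) unfolding torus_map_def by blast
      have d: "\<Delta> (\<theta> + ivec k) - \<Delta> \<theta> = zshift l2 - zshift l"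
        by (simp add: \<Delta>_def l l2)
      have "norm (\<Delta> (\<theta> + ivec k) - \<Delta> \<theta>) < t + t"
        using norm_triangle_ineq4[of "\<Delta> (\<theta> + ivec k)" "\<Delta> \<theta>"] \<Delta>[of \<theta>] \<Delta>[of "\<theta> + ivec k"] by linarith
      then have "norm (zshift l2 - zshift l :: real^('n+'n)) < 1" unfolding d using t(3) by linarith
      then have "(zshift l2 :: real^('n+'n)) = zshift l"
        using zshift_separated[of l2 l] by linarith
      then show "\<Delta> (\<theta> + ivec k) = \<Delta> \<theta>" using d by simp
    qed
    define y where "y = (\<lambda>\<theta>. inl_part (Mi \<theta> *v \<Delta> \<theta>))"
    have yc: "continuous_on UNIV y" unfolding y_def by (intro continuous_intros Mi_cont \<Delta>c)
    have yp: "y (\<theta> + ivec k) = y \<theta>" for \<theta> k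
      by (simp add: y_def zperiodicD[OF \<Delta>p] zperiodicD[OF frame_periodic(3)])
    have ye: "norm (y \<theta>) \<le> e" for \<theta>
      unfolding y_def \<Delta>_def by (rule order_trans[OF norm_inl_part_le small(1)])
    have t0: "tangential \<theta> 0 = 0" for \<theta> by (simp add: tangential_def inl_part_def vec_eq_iff)
    have yr: "norm (y \<theta>) \<le> r0 / 2" for \<theta> using ye[of \<theta>] e(2) by simp
    \<comment> \<open>Uniqueness of the solution is recorded because it yields the periodicity of
      \<open>a\<close>.\<close>
    obtain a where a: "continuous_on UNIV a" "\<And>\<theta>. norm (a \<theta>) \<le> 2 * norm (y \<theta>)"
        "\<And>\<theta>. tangential \<theta> (a \<theta>) = y \<theta>"
        "\<And>\<theta> a'. norm a' \<le> r0 \<Longrightarrow> tangential \<theta> a' = y \<theta> \<Longrightarrow> a' = a \<theta>"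
      using near_identity_solution[OF r0(1) t0 r0(2)[rule_format] tangential_cont yc yr] by metis
    have ae: "norm (a \<theta>) \<le> 2 * e" for \<theta> using a(2)[of \<theta>] ye[of \<theta>] by simp
    have ap: "zperiodic a"
      unfolding zperiodic_def
    proof (intro allI)
      fix \<theta> k
      show "a (\<theta> + ivec k) = a \<theta>"
      proof (rule a(4))
        show "norm (a (\<theta> + ivec k)) \<le> r0" using ae[of "\<theta> + ivec k"] e(2) by linarith
        show "tangential \<theta> (a (\<theta> + ivec k)) = y \<theta>"
          using a(3)[of "\<theta> + ivec k"] by (simp add: tangential_periodic yp)
      qed
    qed
    define n where "n = (\<lambda>\<theta>. K2 \<theta> - K (\<theta> + a \<theta>))"
    define b where "b = (\<lambda>\<theta>. a (\<theta> + \<omega>) - a \<theta>)"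
    define \<sigma> where "\<sigma> = \<mu>2 - \<mu>"
    \<comment> \<open>With the defect as a definition the linearized equation holds identically, and
      only the size of \<open>R\<close> is at stake.\<close>
    define R where "R = (\<lambda>\<theta>. n (\<theta> + \<omega>) - (\<gamma> \<theta> *v n \<theta> + D\<mu> \<theta> *v \<sigma> - DK K (\<theta> + \<omega>) *v b \<theta>))"
    have nc: "continuous_on UNIV n"
      unfolding n_def
      by (intro continuous_intros K2 continuous_on_compose2[OF K_cont _ subset_UNIV] a)
    have n_eq: "n \<theta> = \<Delta> \<theta> - (K (\<theta> + a \<theta>) - K \<theta>)" for \<theta> by (simp add: n_def \<Delta>_def)
    have np: "zperiodic n"
      unfolding zperiodic_def n_eq
      by (simp add: zperiodicD[OF \<Delta>p] zperiodicD[OF ap] zperiodicD[OF K_diff_periodic])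
    have bc: "continuous_on UNIV b"
      unfolding b_def by (intro continuous_intros a continuous_shift)
    have bp: "zperiodic b"
      using zperiodic_shift[OF ap, of \<omega>] ap by (simp add: zperiodic_def b_def)
    have bavg: "torus_avg b = 0"
      unfolding b_def
      by (simp add: torus_avg_diff continuous_shift a(1) torus_avg_shift[OF a(1) ap])
    have n0: "inl_part (Mi \<theta> *v n \<theta>) = 0" for \<theta>
      using a(3)[of \<theta>]
      by (simp add: n_eq matrix_vector_mult_diff_distrib parts_add tangential_def y_def)
    have eq: "n (\<theta> + \<omega>) = \<gamma> \<theta> *v n \<theta> + D\<mu> \<theta> *v \<sigma> - DK K (\<theta> + \<omega>) *v b \<theta> + R \<theta>" for \<theta>
      by (simp add: R_def)
    have Rp: "zperiodic R"
      using zperiodic_shift[OF np, of \<omega>] zperiodic_shift[OF DK_periodic, of \<omega>] np bp \<gamma>_periodic D\<mu>_periodic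
      by (simp add: zperiodic_def R_def)
    have R1: "norm (R \<theta>) \<le> \<eta> * (norm (n \<theta>) + norm \<sigma> + norm (b \<theta>))" for \<theta>
    proof -
      \<comment> \<open>The linearization is available over the unit cube; other angles follow
        because all terms are periodic.\<close>
      have cube: "norm (R \<theta>) \<le> \<eta> * (norm (n \<theta>) + norm \<sigma> + norm (b \<theta>))" if "\<theta> \<in> cbox 0 1" for \<theta>
      proof -
        have "norm (f \<mu>2 (K2 \<theta>) - K (\<theta> + \<omega> + a (\<theta> + \<omega>)) -
          (\<gamma> \<theta> *v (K2 \<theta> - K (\<theta> + a \<theta>)) + D\<mu> \<theta> *v (\<mu>2 - \<mu>) - DK K (\<theta> + \<omega>) *v (a (\<theta> + \<omega>) - a \<theta>)))
          \<le> \<eta> * (norm (K2 \<theta> - K (\<theta> + a \<theta>)) + norm (\<mu>2 - \<mu>) + norm (a (\<theta> + \<omega>) - a \<theta>))"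
        proof (rule s(2)[rule_format, OF that])
          show "norm (a \<theta>) < s" "norm (a (\<theta> + \<omega>)) < s"
            using ae[of \<theta>] ae[of "\<theta> + \<omega>"] es(1) t(2) by linarith+
          show "norm (K2 \<theta> - K \<theta>) < s" using \<Delta>[of \<theta>] t(2) by (simp add: \<Delta>_def)
          show "norm (\<mu>2 - \<mu>) < s" using \<sigma>e es(1) t(2) e(1) by linarith
        qed
        then show ?thesis unfolding R_def n_def b_def \<sigma>_def inv2 .
      qed
      obtain k where k: "\<theta> + ivec k \<in> cbox 0 1" using reduce_to_unit_cube .
      from cube[OF this] show ?thesis
        by (simp add: zperiodicD[OF Rp] zperiodicD[OF np] zperiodicD[OF bp])
    qed
    have bE: "norm (b \<theta>) \<le> C2 * (norm (n \<theta>) + norm \<sigma> + norm (R \<theta>))" for \<theta>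
      by (rule C2(2)[rule_format, where n = n and b = b and R = R, OF n0 n0 eq])
    \<comment> \<open>Inserting the bound on \<open>b\<close> makes \<open>R\<close> appear on the
      right with the factor \<open>\<eta> * C2\<close>, at most 1/2, and it is absorbed.\<close>
    have R2: "norm (R \<theta>) \<le> 2 * \<eta> * (1 + C2) * (norm (n \<theta>) + norm \<sigma>)" for \<theta>
    proof -
      have "norm (R \<theta>) \<le> \<eta> * (norm (n \<theta>) + norm \<sigma> + C2 * (norm (n \<theta>) + norm \<sigma> + norm (R \<theta>)))"
        using R1[of \<theta>] bE[of \<theta>] \<eta>(1) by (meson add_left_mono less_imp_le mult_left_mono order_trans)
      also have "\<dots> = \<eta> * (1 + C2) * (norm (n \<theta>) + norm \<sigma>) + (\<eta> * C2) * norm (R \<theta>)"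
        by (simp add: algebra_simps)
      also have "(\<eta> * C2) * norm (R \<theta>) \<le> 1 / 2 * norm (R \<theta>)"
        by (rule mult_right_mono[OF \<eta>(2)]) simp
      finally show ?thesis by simp
    qed
    obtain X where X: "\<And>\<theta>. norm (n \<theta>) \<le> X" using zperiodic_bounded[OF nc np] by blast
    \<comment> \<open>The supremum closes the pointwise estimates into a single inequality for
      \<open>N + norm \<sigma>\<close>.\<close>
    define N where "N = (SUP \<theta>. norm (n \<theta>))"
    have bdd: "bdd_above (range (\<lambda>\<theta>. norm (n \<theta>)))" by (rule bdd_aboveI2) (rule X)
    have N: "norm (n \<theta>) \<le> N" for \<theta> unfolding N_def by (rule cSUP_upper[OF UNIV_I bdd])
    define E where "E = 2 * \<eta> * (1 + C2) * (N + norm \<sigma>)"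
    have RE: "norm (R \<theta>) \<le> E" for \<theta>
    proof -
      have "2 * \<eta> * (1 + C2) * (norm (n \<theta>) + norm \<sigma>) \<le> E"
        unfolding E_def using N[of \<theta>] \<eta>(1) C2(1) by (intro mult_left_mono) auto
      with R2[of \<theta>] show ?thesis by (rule order_trans)
    qed
    have *: "norm \<sigma> \<le> C1 * E \<and> (\<forall>\<theta>. norm (n \<theta>) \<le> C1 * E)"
      using C1(2) nc np bc bavg n0 eq RE by blast
    then have "N \<le> C1 * E" unfolding N_def by (intro cSUP_least) auto
    with * have "N + norm \<sigma> \<le> 2 * (C1 * E)" by linarith
    also have "\<dots> = (8 * C1 * (1 + C2) * \<eta>) * ((N + norm \<sigma>) / 2)" by (simp add: E_def)
    also have "\<dots> \<le> 1 * ((N + norm \<sigma>) / 2)"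
      using order_trans[OF norm_ge_zero N] by (intro mult_right_mono \<eta>(3)) simp
    finally have le0: "N + norm \<sigma> \<le> 0" by simp
    have nz: "n \<theta> = 0" for \<theta>
    proof -
      have "norm (n \<theta>) \<le> 0" using le0 N[of \<theta>] norm_ge_zero[of \<sigma>] by linarith
      then show ?thesis by simp
    qed
    have \<sigma>0: "\<sigma> = 0"
    proof -
      have "norm \<sigma> \<le> 0" using le0 N[of 0] norm_ge_zero[of "n 0"] by linarith
      then show ?thesis by simp
    qed
    have R0: "R \<theta> = 0" for \<theta> using R2[of \<theta>] by (simp add: nz \<sigma>0)
    have "b \<theta> = 0" for \<theta> using bE[of \<theta>] by (simp add: nz \<sigma>0 R0)
    then have "a (\<theta> + \<omega>) = a \<theta>" for \<theta> by (simp add: b_def)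
    then have const: "a \<theta> = a 0" for \<theta>
      by (rule rotation_invariant_const[OF nonres a(1) ap])
    \<comment> \<open>For constant \<open>a\<close> the function \<open>y\<close> stays within
      \<open>norm (a 0) / 2\<close> of \<open>a 0\<close>, while its mean is 0 by the normalization;
      this forces \<open>a 0 = 0\<close>.\<close>
    have "norm (torus_avg (\<lambda>\<theta>. y \<theta> - a 0)) \<le> norm (a 0) / 2"
    proof (rule norm_torus_avg_le)
      show "continuous_on UNIV (\<lambda>\<theta>. y \<theta> - a 0)" by (intro continuous_intros yc)
      fix \<theta>
      have "norm (a 0) \<le> r0" using ae[of 0] e(2) by linarith
      then have "norm (tangential \<theta> (a 0) - tangential \<theta> 0 - (a 0 - 0)) \<le> norm (a 0 - 0) / 2"
        using r0 by (intro r0(2)[rule_format]) auto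
      then show "norm (y \<theta> - a 0) \<le> norm (a 0) / 2"
        using a(3)[of \<theta>] by (simp add: t0 const[of \<theta>])
    qed
    also have "torus_avg (\<lambda>\<theta>. y \<theta> - a 0) = - a 0"
    proof -
      have "torus_avg y = 0" using avg0 by (simp add: y_def \<Delta>_def)
      then show ?thesis by (simp add: torus_avg_diff yc)
    qed
    finally have "a 0 = 0" by simp
    have "K2 \<theta> = K \<theta>" for \<theta>
      using nz[of \<theta>] const[of \<theta>] \<open>a 0 = 0\<close> by (simp add: n_def)
    then show "K2 = K \<and> \<mu>2 = \<mu>" using \<sigma>0 by (auto simp: \<sigma>_def)
  qed
qed

end

section \<open>From strip norms to the uniqueness theorem\<close>

text \<open>Phrased in \<open>ennreal\<close> because a strip norm may be infinite; a positive
  factor times infinity is never below 1, so the first assumption includes finiteness.\<close>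

lemma ennreal_mult_less_one_imp_le:
  fixes x :: ennreal
  assumes "ennreal c * x < 1" "ennreal a \<le> x" "0 \<le> a" "e > 0" "c \<ge> 1 / e"
  shows "a \<le> e"
proof -
  have c: "c > 0" using assms(4,5) by (meson less_le_trans zero_less_divide_1_iff)
  have "ennreal (c * a) = ennreal c * ennreal a" using c assms(3) by (simp add: ennreal_mult)
  also have "\<dots> \<le> ennreal c * x" by (intro mult_left_mono assms) simp
  also have "\<dots> < 1" by fact
  finally have "c * a < 1" using c assms(3) by (simp flip: ennreal_1 add: ennreal_less_iff)
  moreover have "1 / e * a \<le> c * a" using assms by (intro mult_right_mono) auto
  ultimately have "1 / e * a < 1" by simp
  then show ?thesis using assms(4) by (simp add: field_simps)
qed

theorem theorem34:
  fixes B :: "(real^'n) set"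
    and \<Omega> :: "real^('n::finite+'n) \<Rightarrow> real^('n::finite+'n) \<Rightarrow> real^('n::finite+'n) \<Rightarrow> real"
    and f :: "real^'d \<Rightarrow> real^('n::finite+'n) \<Rightarrow> real^('n::finite+'n)"
    and K1 :: "real^'d \<Rightarrow> real^('n::finite+'n)"
    and \<mu>1 \<omega> :: "real^'d"
    and lam \<nu> \<tau> \<rho> \<delta> :: real
    and Es Ec Eu :: "real^'d \<Rightarrow> (real^('n::finite+'n)) set"
    and Ps Pc Pu :: "real^'d \<Rightarrow> real^('n::finite+'n)^('n::finite+'n)"
  assumes "CARD('d) \<le> CARD('n)"
    and "diophantine \<nu> \<tau> \<omega>"
    and "open B" and "simply_connected B" and "smooth_boundary B"
    and "symplectic_form B \<Omega>"
    and "0 < lam" and "lam < 1"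
    and "\<And>\<mu>. phase_map B (f \<mu>)"
    and "\<And>\<mu>. conf_symplectic B \<Omega> lam (f \<mu>)"
    and "0 < \<delta>" and "\<delta> < \<rho>"
    and "torus_map B K1" and "in_A (\<rho> + 2 * \<delta>) K1"
    and "\<And>\<theta>. f \<mu>1 (K1 \<theta>) = K1 (\<theta> + \<omega>)"
    and "extends_near B f \<mu>1 (\<rho> + 2 * \<delta>) K1"
    and "whiskered_torus (f \<mu>1) lam \<omega> K1 Es Ec Eu Ps Pc Pu"
    and "\<And>\<theta>. invertible (transpose (DK K1 \<theta>) ** DK K1 \<theta>)"
    and "det (nondeg_mat \<Omega> f \<mu>1 lam \<omega> K1 Ec Pc) \<noteq> 0"
  shows "\<exists>C>0. \<forall>K2 \<mu>2.
    torus_map B K2 \<longrightarrow> in_A (\<rho> + 2 * \<delta>) K2 \<longrightarrow>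
    (\<forall>\<theta>. f \<mu>2 (K2 \<theta>) = K2 (\<theta> + \<omega>)) \<longrightarrow>
    (let Wc = (\<lambda>\<theta>. Minv_Pc \<Omega> K1 Ec Pc \<theta> *v (K2 \<theta> - K1 \<theta>));
         Ws = (\<lambda>\<theta>. Ps \<theta> *v (K2 \<theta> - K1 \<theta>));
         Wu = (\<lambda>\<theta>. Pu \<theta> *v (K2 \<theta> - K1 \<theta>))
     in torus_avg (\<lambda>\<theta>. \<chi> i. Wc \<theta> $ Inl i) = 0 \<longrightarrow>
        ennreal (C * \<nu> * \<delta> powr (- \<tau>)) *
          max (strip_norm (\<rho> + 2 * \<delta>) Wc) (ennreal (norm (\<mu>2 - \<mu>1))) < 1 \<longrightarrow>
        ennreal C * (strip_norm (\<rho> + \<delta>) Ws + strip_norm (\<rho> + \<delta>) Wu) < 1 \<longrightarrow>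
        K1 = K2 \<and> \<mu>1 = \<mu>2)"
proof -
  have widths: "\<rho> + 2 * \<delta> > 0" "\<rho> + \<delta> > 0" using assms(11,12) by auto
  interpret invariant_torus B \<Omega> f K1 \<mu>1 \<omega> lam "\<rho> + 2 * \<delta>" Es Ec Eu Ps Pc Pu
    by unfold_locales (use assms widths in auto)
  obtain e where e: "e > 0" "\<forall>K2 \<mu>2. torus_map B K2 \<longrightarrow> continuous_on UNIV K2 \<longrightarrow>
    (\<forall>\<theta>. f \<mu>2 (K2 \<theta>) = K2 (\<theta> + \<omega>)) \<longrightarrow>
    (\<forall>\<theta>. norm (Mi \<theta> *v (K2 \<theta> - K1 \<theta>)) \<le> e) \<longrightarrow> (\<forall>\<theta>. norm (Ps \<theta> *v (K2 \<theta> - K1 \<theta>)) \<le> e) \<longrightarrow>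
    (\<forall>\<theta>. norm (Pu \<theta> *v (K2 \<theta> - K1 \<theta>)) \<le> e) \<longrightarrow> norm (\<mu>2 - \<mu>1) \<le> e \<longrightarrow>
    torus_avg (\<lambda>\<theta>. inl_part (Mi \<theta> *v (K2 \<theta> - K1 \<theta>))) = 0 \<longrightarrow> K2 = K1 \<and> \<mu>2 = \<mu>1"
    using local_uniqueness[OF diophantine_nonresonant[OF assms(2)] assms(19)] by blast
  define q where "q = \<nu> * \<delta> powr (- \<tau>)"
  have q: "q > 0" using diophantine_pos[OF assms(2)] assms(11) by (simp add: q_def)
  \<comment> \<open>Both conditions have to yield the radius \<open>e\<close>: one is scaled by
    \<open>C\<close> alone, the other by \<open>C * q\<close>. The choice precedes the second
    solution.\<close>
  define C where "C = max (1 / e) (1 / e / q)"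
  have C: "C > 0" "C \<ge> 1 / e" using e(1) by (auto simp: C_def intro: less_le_trans[of 0 "1 / e"])
  have "1 / e / q * q \<le> C * q"
    unfolding C_def using q by (intro mult_right_mono max.cobounded2) simp
  then have C': "C * \<nu> * \<delta> powr (- \<tau>) \<ge> 1 / e"
    using q by (simp add: mult.assoc flip: q_def)
  show ?thesis
  proof (intro exI[of _ C] conjI[of "0 < _"] C(1) allI impI, unfold Let_def, intro impI)
    fix K2 \<mu>2
    let ?Wc = "\<lambda>\<theta>. Minv_Pc \<Omega> K1 Ec Pc \<theta> *v (K2 \<theta> - K1 \<theta>)"
    let ?Ws = "\<lambda>\<theta>. Ps \<theta> *v (K2 \<theta> - K1 \<theta>)" and ?Wu = "\<lambda>\<theta>. Pu \<theta> *v (K2 \<theta> - K1 \<theta>)"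
    assume K2: "torus_map B K2" "in_A (\<rho> + 2 * \<delta>) K2" "\<forall>\<theta>. f \<mu>2 (K2 \<theta>) = K2 (\<theta> + \<omega>)"
      and avg: "torus_avg (\<lambda>\<theta>. \<chi> i. ?Wc \<theta> $ Inl i) = 0"
      and c: "ennreal (C * \<nu> * \<delta> powr (- \<tau>)) *
          max (strip_norm (\<rho> + 2 * \<delta>) ?Wc) (ennreal (norm (\<mu>2 - \<mu>1))) < 1"
      and su: "ennreal C * (strip_norm (\<rho> + \<delta>) ?Ws + strip_norm (\<rho> + \<delta>) ?Wu) < 1"
    have K2c: "continuous_on UNIV K2"
    proof -
      obtain G where "strip_ext (\<rho> + 2 * \<delta>) K2 G" using K2(2) by (auto simp: in_A_def)
      from real_analytic_on_continuous[OF strip_ext_real_analytic[OF this widths(1)] open_UNIV]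
      have "continuous_on UNIV (\<lambda>\<theta>. \<chi> i. K2 \<theta> $ i)" by (intro continuous_on_vec_lambda)
      then show ?thesis by simp
    qed
    have "norm (?Wc \<theta>) \<le> e" for \<theta>
      by (rule ennreal_mult_less_one_imp_le[OF c _ norm_ge_zero e(1) C'])
        (rule order_trans[OF norm_le_strip_norm[OF widths(1), of ?Wc] max.cobounded1])
    moreover have "norm (\<mu>2 - \<mu>1) \<le> e"
      by (rule ennreal_mult_less_one_imp_le[OF c max.cobounded2 norm_ge_zero e(1) C'])
    moreover have "norm (?Ws \<theta>) \<le> e" for \<theta>
      by (rule ennreal_mult_less_one_imp_le[OF su _ norm_ge_zero e(1) C(2)])
        (rule order_trans[OF norm_le_strip_norm[OF widths(2), of ?Ws]], simp)
    moreover have "norm (?Wu \<theta>) \<le> e" for \<theta>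
      by (rule ennreal_mult_less_one_imp_le[OF su _ norm_ge_zero e(1) C(2)])
        (rule order_trans[OF norm_le_strip_norm[OF widths(2), of ?Wu]], simp)
    ultimately show "K1 = K2 \<and> \<mu>1 = \<mu>2"
      using e(2)[rule_format, OF K2(1) K2c, of \<mu>2] K2(3) avg
      by (auto simp: Mi_eq inl_part_def)
  qed
qed

end
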